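(* Let $\mathscr{C}$ be a $2d$-Calabi-Yau $(d+2)$-angulated category that is $K$-linear, Hom-finite and Krull-Schmidt. Let $T$ and $U$ be two basic Oppermann-Thomas cluster tilting objects of $\mathscr{C}$, with $\mathscr{T}=\mathrm{add}(T)$ and $\mathscr{U}=\mathrm{add}(U)$. Let $u\in\mathrm{Indec}(\mathscr{U})$. Then the $c$-vector of the pair $(u,\mathscr{U})$ with respect to $\mathscr{T}$ is given by $$c_{\mathscr{T}}(u,\mathscr{U})=(-1)^d\,[u]^*\circ\mathrm{Ind}_{\mathscr{U}}\circ\Sigma^d\big|_{K_0^{\mathrm{split}}(\mathscr{T})}.$$
   Context: Throughout, $K$ is an algebraically closed field and $d$ is a positive integer. **$(d+2)$-angulated categories (Geiss-Keller-Oppermann).** Let $\mathscr{C}$ be an additive category with an automorphism $\Sigma^d$ (not assumed to be the $d$-th power of another functor). A $\Sigma^d$-sequence is a diagram $c^0\xrightarrow{\gamma^0}c^1\xrightarrow{\gamma^1}\cdots\to c^{d+1}\xrightarrow{\gamma^{d+1}}\Sigma^d(c^0)$. A $(d+2)$-angulated category is such a $\mathscr{C}$ together with a class of $\Sigma^d$-sequences, called $(d+2)$-angles, such that: (N1) the class is closed under sums and summands, contains $c\xrightarrow{\mathrm{id}}c\to0\to\cdots\to0\to\Sigma^d(c)$ for each $c$, and each morphism $c^0\to c^1$ is the first morphism of some $(d+2)$-angle; (N2) a $\Sigma^d$-sequence $c^0\xrightarrow{\gamma^0}c^1\xrightarrow{\gamma^1}\cdots\to c^{d+1}\xrightarrow{\gamma^{d+1}}\Sigma^d(c^0)$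 is a $(d+2)$-angle if and only if its left rotation $c^1\xrightarrow{\gamma^1}c^2\to\cdots\to c^{d+1}\xrightarrow{\gamma^{d+1}}\Sigma^d(c^0)\xrightarrow{(-1)^d\Sigma^d(\gamma^0)}\Sigma^d(c^1)$ is; (N3) given $(d+2)$-angles $b^\bullet$ and $c^\bullet$ with morphisms $\beta^i,\gamma^i$, and $\varphi^0:b^0\to c^0$, $\varphi^1:b^1\to c^1$ with $\varphi^1\beta^0=\gamma^0\varphi^0$, there are $\varphi^i:b^i\to c^i$ ($2\le i\le d+1$) completing $\varphi^0,\varphi^1,\Sigma^d(\varphi^0)$ to a morphism of $\Sigma^d$-sequences; (N4) (octahedral axiom) in (N3) the $\varphi^i$ can be chosen so that the mapping cone $b^1\oplus c^0\to b^2\oplus c^1\to\cdots\to\Sigma^d b^0\oplus c^{d+1}\to\Sigma^d b^1\oplus\Sigma^d c^0$, with morphisms $\begin{pmatrix}-\beta^{i+1}&0\\ \varphi^{i+1}&\gamma^i\end{pmatrix}$ for $0\le i\le d$ and last morphism $\begin{pmatrix}-\Sigma^d\beta^0&0\\ \Sigma^d\varphi^0&\gamma^{d+1}\end{pmatrix}$, is a $(d+2)$-angle. $\mathscr{C}$ is $2d$-Calabi-Yau if it has a Serre functor (an auto-equivalence $S$ with isomorphisms $\mathrm{Hom}_{\mathscr{C}}(Y,SX)\cong D\,\mathrm{Hom}_{\mathscr{C}}(X,Y)$ natural in $X,Y$, where $D=\mathrm{Hom}_K(-,K)$) isomorphic to $\Sigma^{2d}:=(\Sigma^d)^2$. **Oppermann-Thomas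 cluster tilting.** An object $T$ is an Oppermann-Thomas cluster tilting object if, with $\mathscr{T}=\mathrm{add}(T)$: (i) $\mathrm{Hom}_{\mathscr{C}}(\mathscr{T},\Sigma^d\mathscr{T})=0$; (ii) for every $c\in\mathscr{C}$ there is a $(d+2)$-angle $t_d\to t_{d-1}\to\cdots\to t_0\to c\to\Sigma^d(t_d)$ with all $t_i\in\mathscr{T}$. It is basic if its indecomposable summands are pairwise non-isomorphic. $\mathrm{Indec}(\mathscr{T})$ is the set of indecomposables of $\mathscr{T}$ up to isomorphism. **Split Grothendieck group and index.** For an additive category $\mathscr{A}$ (here $\mathscr{C}$, $\mathscr{T}$ or $\mathscr{U}$), $K_0^{\mathrm{split}}(\mathscr{A})$ is the abelian group generated by the objects of $\mathscr{A}$ modulo the relations $[a]=[a_0]+[a_1]$ whenever $a\cong a_0\oplus a_1$. For $\mathscr{T}=\mathrm{add}(T)$ with $T$ an Oppermann-Thomas cluster tilting object it is free on $[t]$, $t\in\mathrm{Indec}(\mathscr{T})$. $K_0^{\mathrm{split}}(\mathscr{T})$ and $K_0^{\mathrm{split}}(\mathscr{U})$ are regarded as subgroups of $K_0^{\mathrm{split}}(\mathscr{C})$. The index of $c\in\mathscr{C}$ is $\mathrm{Ind}_{\mathscr{T}}(c)=\sum_{i=0}^d(-1)^i[t_i]\in K_0^{\mathrm{split}}(\mathscr{T})$ for any $(d+2)$-angle as in (ii); it is well defined. It induces a homomorphism $\mathrm{Ind}_{\mathscr{T}}:K_0^{\mathrm{split}}(\mathscr{C})\to K_0^{\mathrm{split}}(\mathscr{T})$,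 $[c]\mapsto\mathrm{Ind}_{\mathscr{T}}(c)$, and similarly for $\mathscr{U}$. Also $\Sigma^d$ induces $K_0^{\mathrm{split}}(\mathscr{C})\to K_0^{\mathrm{split}}(\mathscr{C})$, $[x]\mapsto[\Sigma^dx]$. **Duals and $c$-vectors.** For an abelian group $A$, $A^*=\mathrm{Hom}(A,\mathbb{Z})$. For $u\in\mathrm{Indec}(\mathscr{U})$, $[u]^*\in K_0^{\mathrm{split}}(\mathscr{U})^*$ is defined by $[u]^*([v])=\delta_{uv}$ (Kronecker delta) for $v\in\mathrm{Indec}(\mathscr{U})$. The homological $c$-vector of $(u,\mathscr{U})$ with respect to $\mathscr{T}$ is the element $c_{\mathscr{T}}(u,\mathscr{U})\in K_0^{\mathrm{split}}(\mathscr{T})^*$ determined by $c_{\mathscr{T}}(u,\mathscr{U})(\mathrm{Ind}_{\mathscr{T}}(v))=\delta_{uv}$ for all $v\in\mathrm{Indec}(\mathscr{U})$; it exists and is unique because the $\mathrm{Ind}_{\mathscr{T}}(v)$, $v\in\mathrm{Indec}(\mathscr{U})$, form a basis of $K_0^{\mathrm{split}}(\mathscr{T})$. *)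

theory Defs
  imports "HOL-Algebra.Algebra" "HOL-Computational_Algebra.Polynomial"
begin

section \<open>Linear categories\<close>

text \<open>
  The morphism spaces of a category are subspaces of one ambient vector space \<open>'m\<close>, with
  a single composition and, for functors, a single action on morphisms. This is no loss of
  generality: an arbitrary linear category is recovered by taking for the ambient space the direct
  sum of all its morphism spaces, in which a nonzero morphism determines its source and target.
  The product \<open>g \<cdot> f\<close> is ``first \<open>f\<close>, then \<open>g\<close>''.
\<close>

record ('k, 'o, 'm) lin_cat =
  Ob :: "'o set"
  Hom :: "'o \<Rightarrow> 'o \<Rightarrow> 'm set"
  Comp :: "'m \<Rightarrow> 'm \<Rightarrow> 'm"  (infixl \<open>\<cdot>\<index>\<close> 75)
  Id :: "'o \<Rightarrow> 'm"
  Scale :: "'k \<Rightarrow> 'm \<Rightarrow> 'm"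

locale linear_category = vector_space "Scale C"
  for C :: "('k::field, 'o, 'm::ab_group_add, 'z) lin_cat_scheme" (structure) +
  assumes Hom_subspace: "\<lbrakk>x \<in> Ob C; y \<in> Ob C\<rbrakk> \<Longrightarrow> subspace (Hom C x y)"
    and Id_in_Hom: "x \<in> Ob C \<Longrightarrow> Id C x \<in> Hom C x x"
    and Comp_in_Hom: "\<lbrakk>x \<in> Ob C; y \<in> Ob C; z \<in> Ob C; f \<in> Hom C x y; g \<in> Hom C y z\<rbrakk>
      \<Longrightarrow> g \<cdot> f \<in> Hom C x z"
    and Comp_Id: "\<lbrakk>x \<in> Ob C; y \<in> Ob C; f \<in> Hom C x y\<rbrakk> \<Longrightarrow> f \<cdot> Id C x = f"
    and Id_Comp: "\<lbrakk>x \<in> Ob C; y \<in> Ob C; f \<in> Hom C x y\<rbrakk> \<Longrightarrow> Id C y \<cdot> f = f"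
    and Comp_assoc: "\<lbrakk>w \<in> Ob C; x \<in> Ob C; y \<in> Ob C; z \<in> Ob C;
        f \<in> Hom C w x; g \<in> Hom C x y; h \<in> Hom C y z\<rbrakk>
      \<Longrightarrow> h \<cdot> (g \<cdot> f) = (h \<cdot> g) \<cdot> f"
    and Comp_add_left: "\<lbrakk>x \<in> Ob C; y \<in> Ob C; z \<in> Ob C;
        f \<in> Hom C x y; g \<in> Hom C y z; g' \<in> Hom C y z\<rbrakk>
      \<Longrightarrow> (g + g') \<cdot> f = g \<cdot> f + g' \<cdot> f"
    and Comp_add_right: "\<lbrakk>x \<in> Ob C; y \<in> Ob C; z \<in> Ob C;
        f \<in> Hom C x y; f' \<in> Hom C x y; g \<in> Hom C y z\<rbrakk>
      \<Longrightarrow> g \<cdot> (f + f') = g \<cdot> f + g \<cdot> f'"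
    and Comp_scale_left: "\<lbrakk>x \<in> Ob C; y \<in> Ob C; z \<in> Ob C; f \<in> Hom C x y; g \<in> Hom C y z\<rbrakk>
      \<Longrightarrow> Scale C r g \<cdot> f = Scale C r (g \<cdot> f)"
    and Comp_scale_right: "\<lbrakk>x \<in> Ob C; y \<in> Ob C; z \<in> Ob C; f \<in> Hom C x y; g \<in> Hom C y z\<rbrakk>
      \<Longrightarrow> g \<cdot> Scale C r f = Scale C r (g \<cdot> f)"

definition iso_mor ::
  "('k, 'o, 'm, 'z) lin_cat_scheme \<Rightarrow> 'o \<Rightarrow> 'o \<Rightarrow> 'm \<Rightarrow> bool" where
  "iso_mor C x y f \<longleftrightarrow>
    f \<in> Hom C x y \<and> (\<exists>g\<in>Hom C y x. g \<cdot>\<^bsub>C\<^esub> f = Id C x \<and> f \<cdot>\<^bsub>C\<^esub> g = Id C y)"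

definition isomorphic_ob :: "('k, 'o, 'm, 'z) lin_cat_scheme \<Rightarrow> 'o \<Rightarrow> 'o \<Rightarrow> bool" where
  "isomorphic_ob C x y \<longleftrightarrow> (\<exists>f. iso_mor C x y f)"

definition zero_ob :: "('k, 'o, 'm::ab_group_add, 'z) lin_cat_scheme \<Rightarrow> 'o \<Rightarrow> bool" where
  "zero_ob C x \<longleftrightarrow> x \<in> Ob C \<and> Id C x = 0"

definition biproduct :: "('k, 'o, 'm::ab_group_add, 'z) lin_cat_scheme
    \<Rightarrow> 'o \<Rightarrow> 'o \<Rightarrow> 'o \<Rightarrow> 'm \<Rightarrow> 'm \<Rightarrow> 'm \<Rightarrow> 'm \<Rightarrow> bool" where
  "biproduct C a b s \<iota>\<^sub>1 \<iota>\<^sub>2 \<pi>\<^sub>1 \<pi>\<^sub>2 \<longleftrightarrow>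
    a \<in> Ob C \<and> b \<in> Ob C \<and> s \<in> Ob C \<and>
    \<iota>\<^sub>1 \<in> Hom C a s \<and> \<iota>\<^sub>2 \<in> Hom C b s \<and> \<pi>\<^sub>1 \<in> Hom C s a \<and> \<pi>\<^sub>2 \<in> Hom C s b \<and>
    \<pi>\<^sub>1 \<cdot>\<^bsub>C\<^esub> \<iota>\<^sub>1 = Id C a \<and> \<pi>\<^sub>2 \<cdot>\<^bsub>C\<^esub> \<iota>\<^sub>2 = Id C b \<and> \<pi>\<^sub>1 \<cdot>\<^bsub>C\<^esub> \<iota>\<^sub>2 = 0 \<and> \<pi>\<^sub>2 \<cdot>\<^bsub>C\<^esub> \<iota>\<^sub>1 = 0 \<and>
    \<iota>\<^sub>1 \<cdot>\<^bsub>C\<^esub> \<pi>\<^sub>1 + \<iota>\<^sub>2 \<cdot>\<^bsub>C\<^esub> \<pi>\<^sub>2 = Id C s"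

text \<open>\<open>is_sum C a b s\<close> says that \<open>s\<close> is isomorphic to the direct sum of \<open>a\<close> and \<open>b\<close>.\<close>

definition is_sum ::
  "('k, 'o, 'm::ab_group_add, 'z) lin_cat_scheme \<Rightarrow> 'o \<Rightarrow> 'o \<Rightarrow> 'o \<Rightarrow> bool" where
  "is_sum C a b s \<longleftrightarrow> (\<exists>\<iota>\<^sub>1 \<iota>\<^sub>2 \<pi>\<^sub>1 \<pi>\<^sub>2. biproduct C a b s \<iota>\<^sub>1 \<iota>\<^sub>2 \<pi>\<^sub>1 \<pi>\<^sub>2)"

definition is_finite_sum ::
  "('k, 'o, 'm::ab_group_add, 'z) lin_cat_scheme \<Rightarrow> nat \<Rightarrow> (nat \<Rightarrow> 'o) \<Rightarrow> 'o \<Rightarrow> bool" where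
  "is_finite_sum C n a s \<longleftrightarrow> s \<in> Ob C \<and> (\<forall>i<n. a i \<in> Ob C) \<and>
    (\<exists>\<iota> \<pi>. (\<forall>i<n. \<iota> i \<in> Hom C (a i) s \<and> \<pi> i \<in> Hom C s (a i)) \<and>
      (\<forall>i<n. \<forall>j<n. \<pi> j \<cdot>\<^bsub>C\<^esub> \<iota> i = (if i = j then Id C (a i) else 0)) \<and>
      (\<Sum>i<n. \<iota> i \<cdot>\<^bsub>C\<^esub> \<pi> i) = Id C s)"

locale additive_linear_category = linear_category C
  for C :: "('k::field, 'o, 'm::ab_group_add, 'z) lin_cat_scheme" (structure) +
  assumes zero_ob_exists: "\<exists>x. zero_ob C x"
    and sum_exists: "\<lbrakk>x \<in> Ob C; y \<in> Ob C\<rbrakk> \<Longrightarrow> \<exists>s. is_sum C x y s"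

locale hom_finite_category = linear_category C
  for C :: "('k::field, 'o, 'm::ab_group_add, 'z) lin_cat_scheme" (structure) +
  assumes hom_finite: "\<lbrakk>x \<in> Ob C; y \<in> Ob C\<rbrakk> \<Longrightarrow> \<exists>B. finite B \<and> span B = Hom C x y"

definition indecomposable ::
  "('k, 'o, 'm::ab_group_add, 'z) lin_cat_scheme \<Rightarrow> 'o \<Rightarrow> bool" where
  "indecomposable C x \<longleftrightarrow> x \<in> Ob C \<and> \<not> zero_ob C x \<and>
    (\<forall>a b. is_sum C a b x \<longrightarrow> zero_ob C a \<or> zero_ob C b)"

text \<open>A (noncommutative) ring is local if it is nonzero and sums of non-units are non-units.\<close>

definition local_End :: "('k, 'o, 'm::ab_group_add, 'z) lin_cat_scheme \<Rightarrow> 'o \<Rightarrow> bool" where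
  "local_End C x \<longleftrightarrow> Id C x \<noteq> 0 \<and>
    (\<forall>f\<in>Hom C x x. \<forall>g\<in>Hom C x x.
      \<not> iso_mor C x x f \<longrightarrow> \<not> iso_mor C x x g \<longrightarrow> \<not> iso_mor C x x (f + g))"

definition krull_schmidt :: "('k, 'o, 'm::ab_group_add, 'z) lin_cat_scheme \<Rightarrow> bool" where
  "krull_schmidt C \<longleftrightarrow>
    (\<forall>x\<in>Ob C. \<exists>n a. is_finite_sum C n a x \<and> (\<forall>i<n. local_End C (a i)))"

definition add_closure ::
  "('k, 'o, 'm::ab_group_add, 'z) lin_cat_scheme \<Rightarrow> 'o \<Rightarrow> 'o set" where
  "add_closure C t = {x. \<exists>n y s. is_finite_sum C n (\<lambda>_. t) s \<and> is_sum C x y s}"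

text \<open>
  Isomorphism classes of indecomposables are not formed: \<open>Indec\<close> contains all indecomposables of
  \<open>A\<close>, and \<open>kronecker\<close> compares them up to isomorphism.
\<close>

definition Indec ::
  "('k, 'o, 'm::ab_group_add, 'z) lin_cat_scheme \<Rightarrow> 'o set \<Rightarrow> 'o set" where
  "Indec C A = {x \<in> A. indecomposable C x}"

definition kronecker :: "('k, 'o, 'm, 'z) lin_cat_scheme \<Rightarrow> 'o \<Rightarrow> 'o \<Rightarrow> int" where
  "kronecker C u v = (if isomorphic_ob C u v then 1 else 0)"

definition basic :: "('k, 'o, 'm::ab_group_add, 'z) lin_cat_scheme \<Rightarrow> 'o \<Rightarrow> bool" where
  "basic C t \<longleftrightarrow> (\<exists>n a. is_finite_sum C n a t \<and> (\<forall>i<n. indecomposable C (a i)) \<and>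
    (\<forall>i<n. \<forall>j<n. i \<noteq> j \<longrightarrow> \<not> isomorphic_ob C (a i) (a j)))"


section \<open>Functors and Serre duality\<close>

text \<open>
  Automorphisms and equivalences of additive categories are automatically additive, so additivity
  is built into the notion of functor. Compatibility with scalars is not required.
\<close>

definition additive_functor :: "('k, 'o, 'm::ab_group_add, 'z) lin_cat_scheme
    \<Rightarrow> ('o \<Rightarrow> 'o) \<Rightarrow> ('m \<Rightarrow> 'm) \<Rightarrow> bool" where
  "additive_functor C F Fm \<longleftrightarrow>
    (\<forall>x\<in>Ob C. F x \<in> Ob C \<and> Fm (Id C x) = Id C (F x)) \<and>
    (\<forall>x\<in>Ob C. \<forall>y\<in>Ob C. \<forall>f\<in>Hom C x y. Fm f \<in> Hom C (F x) (F y)) \<and>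
    (\<forall>x\<in>Ob C. \<forall>y\<in>Ob C. \<forall>f\<in>Hom C x y. \<forall>g\<in>Hom C x y. Fm (f + g) = Fm f + Fm g) \<and>
    (\<forall>x\<in>Ob C. \<forall>y\<in>Ob C. \<forall>z\<in>Ob C. \<forall>f\<in>Hom C x y. \<forall>g\<in>Hom C y z.
      Fm (g \<cdot>\<^bsub>C\<^esub> f) = Fm g \<cdot>\<^bsub>C\<^esub> Fm f)"

definition automorphism :: "('k, 'o, 'm::ab_group_add, 'z) lin_cat_scheme
    \<Rightarrow> ('o \<Rightarrow> 'o) \<Rightarrow> ('m \<Rightarrow> 'm) \<Rightarrow> bool" where
  "automorphism C F Fm \<longleftrightarrow> additive_functor C F Fm \<and> bij_betw F (Ob C) (Ob C) \<and>
    (\<forall>x\<in>Ob C. \<forall>y\<in>Ob C. bij_betw Fm (Hom C x y) (Hom C (F x) (F y)))"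

definition naturally_isomorphic :: "('k, 'o, 'm, 'z) lin_cat_scheme
    \<Rightarrow> ('o \<Rightarrow> 'o) \<Rightarrow> ('m \<Rightarrow> 'm) \<Rightarrow> ('o \<Rightarrow> 'o) \<Rightarrow> ('m \<Rightarrow> 'm) \<Rightarrow> bool" where
  "naturally_isomorphic C F Fm G Gm \<longleftrightarrow>
    (\<exists>\<eta>. (\<forall>x\<in>Ob C. iso_mor C (F x) (G x) (\<eta> x)) \<and>
      (\<forall>x\<in>Ob C. \<forall>y\<in>Ob C. \<forall>f\<in>Hom C x y. \<eta> y \<cdot>\<^bsub>C\<^esub> Fm f = Gm f \<cdot>\<^bsub>C\<^esub> \<eta> x))"

definition auto_equivalence :: "('k, 'o, 'm::ab_group_add, 'z) lin_cat_scheme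
    \<Rightarrow> ('o \<Rightarrow> 'o) \<Rightarrow> ('m \<Rightarrow> 'm) \<Rightarrow> bool" where
  "auto_equivalence C F Fm \<longleftrightarrow> additive_functor C F Fm \<and>
    (\<exists>G Gm. additive_functor C G Gm \<and>
      naturally_isomorphic C (F \<circ> G) (Fm \<circ> Gm) id id \<and>
      naturally_isomorphic C (G \<circ> F) (Gm \<circ> Fm) id id)"

definition Hom_dual :: "('k::field, 'o, 'm::ab_group_add, 'z) lin_cat_scheme
    \<Rightarrow> 'o \<Rightarrow> 'o \<Rightarrow> ('m \<Rightarrow> 'k) set" where
  "Hom_dual C x y = {\<phi> \<in> extensional (Hom C x y).
    (\<forall>f\<in>Hom C x y. \<forall>g\<in>Hom C x y. \<phi> (f + g) = \<phi> f + \<phi> g) \<and>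
    (\<forall>r. \<forall>f\<in>Hom C x y. \<phi> (Scale C r f) = r * \<phi> f)}"

definition serre_functor :: "('k::field, 'o, 'm::ab_group_add, 'z) lin_cat_scheme
    \<Rightarrow> ('o \<Rightarrow> 'o) \<Rightarrow> ('m \<Rightarrow> 'm) \<Rightarrow> bool" where
  "serre_functor C S Sm \<longleftrightarrow> auto_equivalence C S Sm \<and>
    (\<exists>\<Phi> :: 'o \<Rightarrow> 'o \<Rightarrow> 'm \<Rightarrow> 'm \<Rightarrow> 'k.
      (\<forall>x\<in>Ob C. \<forall>y\<in>Ob C.
        bij_betw (\<Phi> x y) (Hom C y (S x)) (Hom_dual C x y) \<and>
        (\<forall>h\<in>Hom C y (S x). \<forall>h'\<in>Hom C y (S x). \<forall>k\<in>Hom C x y.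
          \<Phi> x y (h + h') k = \<Phi> x y h k + \<Phi> x y h' k) \<and>
        (\<forall>r. \<forall>h\<in>Hom C y (S x). \<forall>k\<in>Hom C x y. \<Phi> x y (Scale C r h) k = r * \<Phi> x y h k)) \<and>
      (\<forall>x\<in>Ob C. \<forall>x'\<in>Ob C. \<forall>y\<in>Ob C. \<forall>y'\<in>Ob C.
        \<forall>f\<in>Hom C x x'. \<forall>g\<in>Hom C y' y. \<forall>h\<in>Hom C y (S x). \<forall>k\<in>Hom C x' y'.
          \<Phi> x' y' (Sm f \<cdot>\<^bsub>C\<^esub> h \<cdot>\<^bsub>C\<^esub> g) k = \<Phi> x y h (g \<cdot>\<^bsub>C\<^esub> k \<cdot>\<^bsub>C\<^esub> f)))"


section \<open>Angulated categories\<close>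

text \<open>
  \<open>shift\<close> and \<open>shift_mor\<close> are the automorphism \<open>\<Sigma>\<^sup>d\<close> on objects and morphisms. A \<open>\<Sigma>\<^sup>d\<close>-sequence
  consists of objects \<open>c 0, ..., c (d + 1)\<close> and morphisms \<open>\<gamma> 0, ..., \<gamma> (d + 1)\<close>; values at larger
  indices are irrelevant, and \<open>Angle\<close> does not depend on them because closure under summands
  (axiom \<open>N1_summand\<close> below) yields closure under isomorphism.
\<close>

record ('k, 'o, 'm) ang_cat = "('k, 'o, 'm) lin_cat" +
  shift :: "'o \<Rightarrow> 'o"
  shift_mor :: "'m \<Rightarrow> 'm"
  Angle :: "(nat \<Rightarrow> 'o) \<Rightarrow> (nat \<Rightarrow> 'm) \<Rightarrow> bool"

text \<open>
  \<open>ext_ob\<close> and \<open>ext_mor\<close> continue a family indexed by \<open>0, ..., d + 1\<close> to the index \<open>d + 2\<close> by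
  applying \<open>\<Sigma>\<^sup>d\<close> to the term at \<open>0\<close>. They give the last object of a \<open>\<Sigma>\<^sup>d\<close>-sequence, the last
  component of a morphism of such sequences, and the last terms of a mapping cone.
\<close>

definition ext_ob :: "nat \<Rightarrow> ('k, 'o, 'm, 'z) ang_cat_scheme \<Rightarrow> (nat \<Rightarrow> 'o) \<Rightarrow> nat \<Rightarrow> 'o" where
  "ext_ob d C c i = (if i = d + 2 then shift C (c 0) else c i)"

definition ext_mor :: "nat \<Rightarrow> ('k, 'o, 'm, 'z) ang_cat_scheme \<Rightarrow> (nat \<Rightarrow> 'm) \<Rightarrow> nat \<Rightarrow> 'm" where
  "ext_mor d C \<gamma> i = (if i = d + 2 then shift_mor C (\<gamma> 0) else \<gamma> i)"

definition is_seq ::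
  "nat \<Rightarrow> ('k, 'o, 'm, 'z) ang_cat_scheme \<Rightarrow> (nat \<Rightarrow> 'o) \<Rightarrow> (nat \<Rightarrow> 'm) \<Rightarrow> bool" where
  "is_seq d C c \<gamma> \<longleftrightarrow> (\<forall>i\<le>d+1. c i \<in> Ob C) \<and>
    (\<forall>i\<le>d+1. \<gamma> i \<in> Hom C (c i) (ext_ob d C c (i + 1)))"

definition seq_mor :: "nat \<Rightarrow> ('k, 'o, 'm, 'z) ang_cat_scheme
    \<Rightarrow> (nat \<Rightarrow> 'o) \<Rightarrow> (nat \<Rightarrow> 'm) \<Rightarrow> (nat \<Rightarrow> 'o) \<Rightarrow> (nat \<Rightarrow> 'm) \<Rightarrow> (nat \<Rightarrow> 'm) \<Rightarrow> bool" where
  "seq_mor d C b \<beta> c \<gamma> \<phi> \<longleftrightarrow> (\<forall>i\<le>d+1. \<phi> i \<in> Hom C (b i) (c i)) \<and>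
    (\<forall>i\<le>d+1. ext_mor d C \<phi> (i + 1) \<cdot>\<^bsub>C\<^esub> \<beta> i = \<gamma> i \<cdot>\<^bsub>C\<^esub> \<phi> i)"

definition seq_sum :: "nat \<Rightarrow> ('k, 'o, 'm::ab_group_add, 'z) ang_cat_scheme
    \<Rightarrow> (nat \<Rightarrow> 'o) \<Rightarrow> (nat \<Rightarrow> 'm) \<Rightarrow> (nat \<Rightarrow> 'o) \<Rightarrow> (nat \<Rightarrow> 'm)
    \<Rightarrow> (nat \<Rightarrow> 'o) \<Rightarrow> (nat \<Rightarrow> 'm) \<Rightarrow> bool" where
  "seq_sum d C b \<beta> c \<gamma> s \<sigma> \<longleftrightarrow>
    (\<exists>\<iota>\<^sub>1 \<iota>\<^sub>2 \<pi>\<^sub>1 \<pi>\<^sub>2.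
      (\<forall>i\<le>d+1. biproduct C (b i) (c i) (s i) (\<iota>\<^sub>1 i) (\<iota>\<^sub>2 i) (\<pi>\<^sub>1 i) (\<pi>\<^sub>2 i)) \<and>
      (\<forall>i\<le>d+1. \<sigma> i = ext_mor d C \<iota>\<^sub>1 (i + 1) \<cdot>\<^bsub>C\<^esub> \<beta> i \<cdot>\<^bsub>C\<^esub> \<pi>\<^sub>1 i
                    + ext_mor d C \<iota>\<^sub>2 (i + 1) \<cdot>\<^bsub>C\<^esub> \<gamma> i \<cdot>\<^bsub>C\<^esub> \<pi>\<^sub>2 i))"

definition trivial_seq :: "nat \<Rightarrow> ('k, 'o, 'm::ab_group_add, 'z) ang_cat_scheme
    \<Rightarrow> 'o \<Rightarrow> (nat \<Rightarrow> 'o) \<Rightarrow> (nat \<Rightarrow> 'm) \<Rightarrow> bool" where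
  "trivial_seq d C x c \<gamma> \<longleftrightarrow> x \<in> Ob C \<and> c 0 = x \<and> c 1 = x \<and> (\<forall>i\<in>{2..d+1}. zero_ob C (c i)) \<and>
    \<gamma> 0 = Id C x \<and> (\<forall>i\<in>{1..d+1}. \<gamma> i = 0)"

definition rot_ob :: "nat \<Rightarrow> ('k, 'o, 'm, 'z) ang_cat_scheme \<Rightarrow> (nat \<Rightarrow> 'o) \<Rightarrow> nat \<Rightarrow> 'o" where
  "rot_ob d C c i = (if i \<le> d then c (i + 1) else shift C (c 0))"

definition rot_mor ::
  "nat \<Rightarrow> ('k::field, 'o, 'm, 'z) ang_cat_scheme \<Rightarrow> (nat \<Rightarrow> 'm) \<Rightarrow> nat \<Rightarrow> 'm" where
  "rot_mor d C \<gamma> i =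
    (if i \<le> d then \<gamma> (i + 1) else Scale C ((-1) ^ d) (shift_mor C (\<gamma> 0)))"

text \<open>
  The mapping cone has terms \<open>b\<^sup>i\<^sup>+\<^sup>1 \<oplus> c\<^sup>i\<close> for \<open>0 \<le> i \<le> d + 1\<close> (with \<open>b\<^sup>d\<^sup>+\<^sup>2 = \<Sigma>\<^sup>d b\<^sup>0\<close>) and morphisms
  the matrices with rows \<open>(-\<beta>\<^sup>i\<^sup>+\<^sup>1, 0)\<close> and \<open>(\<phi>\<^sup>i\<^sup>+\<^sup>1, \<gamma>\<^sup>i)\<close>; its last object
  \<open>\<Sigma>\<^sup>d b\<^sup>1 \<oplus> \<Sigma>\<^sup>d c\<^sup>0\<close> is \<open>\<Sigma>\<^sup>d\<close> of its first one. The sums may be formed by any choice of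
  biproducts; the choice is immaterial since angles are closed under isomorphism.
\<close>

definition is_cone :: "nat \<Rightarrow> ('k, 'o, 'm::ab_group_add, 'z) ang_cat_scheme
    \<Rightarrow> (nat \<Rightarrow> 'o) \<Rightarrow> (nat \<Rightarrow> 'm) \<Rightarrow> (nat \<Rightarrow> 'o) \<Rightarrow> (nat \<Rightarrow> 'm) \<Rightarrow> (nat \<Rightarrow> 'm)
    \<Rightarrow> (nat \<Rightarrow> 'o) \<Rightarrow> (nat \<Rightarrow> 'm) \<Rightarrow> bool" where
  "is_cone d C b \<beta> c \<gamma> \<phi> s \<sigma> \<longleftrightarrow>
    (\<exists>\<iota>\<^sub>1 \<iota>\<^sub>2 \<pi>\<^sub>1 \<pi>\<^sub>2.
      (\<forall>i\<le>d+1. biproduct C (ext_ob d C b (i + 1)) (c i) (s i) (\<iota>\<^sub>1 i) (\<iota>\<^sub>2 i) (\<pi>\<^sub>1 i) (\<pi>\<^sub>2 i)) \<and>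
      (\<forall>i\<le>d+1. \<sigma> i =
          ext_mor d C \<iota>\<^sub>1 (i + 1) \<cdot>\<^bsub>C\<^esub> (- ext_mor d C \<beta> (i + 1)) \<cdot>\<^bsub>C\<^esub> \<pi>\<^sub>1 i
        + ext_mor d C \<iota>\<^sub>2 (i + 1) \<cdot>\<^bsub>C\<^esub> ext_mor d C \<phi> (i + 1) \<cdot>\<^bsub>C\<^esub> \<pi>\<^sub>1 i
        + ext_mor d C \<iota>\<^sub>2 (i + 1) \<cdot>\<^bsub>C\<^esub> \<gamma> i \<cdot>\<^bsub>C\<^esub> \<pi>\<^sub>2 i))"

text \<open>\<open>angulated_category d C\<close>: \<open>C\<close> is a \<open>(d + 2)\<close>-angulated category.\<close>

locale angulated_category = additive_linear_category C
  for d :: nat and C :: "('k::field, 'o, 'm::ab_group_add, 'z) ang_cat_scheme" (structure) +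
  assumes d_pos: "0 < d"
    and shift_automorphism: "automorphism C (shift C) (shift_mor C)"
    and Angle_is_seq: "Angle C c \<gamma> \<Longrightarrow> is_seq d C c \<gamma>"
    and N1_sum: "\<lbrakk>Angle C b \<beta>; Angle C c \<gamma>; seq_sum d C b \<beta> c \<gamma> s \<sigma>\<rbrakk> \<Longrightarrow> Angle C s \<sigma>"
    and N1_summand: "\<lbrakk>is_seq d C b \<beta>; is_seq d C c \<gamma>; seq_sum d C b \<beta> c \<gamma> s \<sigma>; Angle C s \<sigma>\<rbrakk>
      \<Longrightarrow> Angle C b \<beta> \<and> Angle C c \<gamma>"
    and N1_trivial: "trivial_seq d C x c \<gamma> \<Longrightarrow> Angle C c \<gamma>"
    and N1_complete: "\<lbrakk>x \<in> Ob C; y \<in> Ob C; f \<in> Hom C x y\<rbrakk>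
      \<Longrightarrow> \<exists>c \<gamma>. Angle C c \<gamma> \<and> c 0 = x \<and> c 1 = y \<and> \<gamma> 0 = f"
    and N2: "is_seq d C c \<gamma> \<Longrightarrow> Angle C c \<gamma> \<longleftrightarrow> Angle C (rot_ob d C c) (rot_mor d C \<gamma>)"
    and N3: "\<lbrakk>Angle C b \<beta>; Angle C c \<gamma>; f \<in> Hom C (b 0) (c 0); g \<in> Hom C (b 1) (c 1);
        g \<cdot> \<beta> 0 = \<gamma> 0 \<cdot> f\<rbrakk>
      \<Longrightarrow> \<exists>\<phi>. \<phi> 0 = f \<and> \<phi> 1 = g \<and> seq_mor d C b \<beta> c \<gamma> \<phi>"
    and N4: "\<lbrakk>Angle C b \<beta>; Angle C c \<gamma>; f \<in> Hom C (b 0) (c 0); g \<in> Hom C (b 1) (c 1);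
        g \<cdot> \<beta> 0 = \<gamma> 0 \<cdot> f\<rbrakk>
      \<Longrightarrow> \<exists>\<phi>. \<phi> 0 = f \<and> \<phi> 1 = g \<and> seq_mor d C b \<beta> c \<gamma> \<phi> \<and>
            (\<forall>s \<sigma>. is_cone d C b \<beta> c \<gamma> \<phi> s \<sigma> \<longrightarrow> Angle C s \<sigma>)"

text \<open>\<open>2d\<close>-Calabi-Yau: \<open>d\<close> enters only through the automorphism \<open>shift\<close>, which is \<open>\<Sigma>\<^sup>d\<close>.\<close>

definition calabi_yau :: "('k::field, 'o, 'm::ab_group_add, 'z) ang_cat_scheme \<Rightarrow> bool" where
  "calabi_yau C \<longleftrightarrow> (\<exists>S Sm. serre_functor C S Sm \<and>
    naturally_isomorphic C S Sm (shift C \<circ> shift C) (shift_mor C \<circ> shift_mor C))"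

text \<open>
  \<open>resolution d C T x t\<close>: an angle \<open>t\<^sub>d \<rightarrow> ... \<rightarrow> t\<^sub>0 \<rightarrow> x \<rightarrow> \<Sigma>\<^sup>d t\<^sub>d\<close> with all \<open>t\<^sub>i\<close> in \<open>T\<close>.
  The lower index counts from the right, so \<open>t\<^sub>i\<close> is the object at position \<open>d - i\<close>.
\<close>

definition resolution :: "nat \<Rightarrow> ('k, 'o, 'm, 'z) ang_cat_scheme
    \<Rightarrow> 'o set \<Rightarrow> 'o \<Rightarrow> (nat \<Rightarrow> 'o) \<Rightarrow> bool" where
  "resolution d C T x t \<longleftrightarrow> (\<forall>i\<le>d. t i \<in> T) \<and>
    (\<exists>c \<gamma>. Angle C c \<gamma> \<and> c (d + 1) = x \<and> (\<forall>i\<le>d. c (d - i) = t i))"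

definition OT_cluster_tilting ::
  "nat \<Rightarrow> ('k, 'o, 'm::ab_group_add, 'z) ang_cat_scheme \<Rightarrow> 'o \<Rightarrow> bool" where
  "OT_cluster_tilting d C T \<longleftrightarrow> T \<in> Ob C \<and>
    (\<forall>x\<in>add_closure C T. \<forall>y\<in>add_closure C T. Hom C x (shift C y) = {0}) \<and>
    (\<forall>x\<in>Ob C. \<exists>t. resolution d C (add_closure C T) x t)"


section \<open>Split Grothendieck groups, the index and c-vectors\<close>

text \<open>In this section \<open>A\<close> is a set of objects, standing for the full subcategory it spans.\<close>

definition K0_relations ::
  "('k, 'o, 'm::ab_group_add, 'z) lin_cat_scheme \<Rightarrow> 'o set \<Rightarrow> ('o \<Rightarrow>\<^sub>0 int) set" where
  "K0_relations C A =
    generate (free_Abelian_group A)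
      {frag_of a - (frag_of a\<^sub>0 + frag_of a\<^sub>1) | a a\<^sub>0 a\<^sub>1.
        a \<in> A \<and> a\<^sub>0 \<in> A \<and> a\<^sub>1 \<in> A \<and> is_sum C a\<^sub>0 a\<^sub>1 a}"

definition K0 ::
  "('k, 'o, 'm::ab_group_add, 'z) lin_cat_scheme \<Rightarrow> 'o set \<Rightarrow> ('o \<Rightarrow>\<^sub>0 int) set monoid" where
  "K0 C A = free_Abelian_group A Mod K0_relations C A"

text \<open>\<open>K0_class C A w\<close> is the class in \<open>K0 C A\<close> of a formal integral combination \<open>w\<close> of objects.\<close>

definition K0_class :: "('k, 'o, 'm::ab_group_add, 'z) lin_cat_scheme \<Rightarrow> 'o set
    \<Rightarrow> ('o \<Rightarrow>\<^sub>0 int) \<Rightarrow> ('o \<Rightarrow>\<^sub>0 int) set" where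
  "K0_class C A w = K0_relations C A #>\<^bsub>free_Abelian_group A\<^esub> w"

text \<open>The homomorphism \<open>h\<close> from \<open>G\<close> to \<open>H\<close> determined by \<open>h (p i) = q i\<close> for all \<open>i\<close> in \<open>I\<close>.\<close>

definition the_hom :: "'a monoid \<Rightarrow> 'b monoid \<Rightarrow> 'i set \<Rightarrow> ('i \<Rightarrow> 'a) \<Rightarrow> ('i \<Rightarrow> 'b) \<Rightarrow> 'a \<Rightarrow> 'b" where
  "the_hom G H I p q =
    (THE h. h \<in> hom G H \<and> h \<in> extensional (carrier G) \<and> (\<forall>i\<in>I. h (p i) = q i))"

text \<open>The canonical map by which \<open>K0 C A\<close> is regarded as a subgroup of \<open>K0 C (Ob C)\<close>.\<close>

definition K0_incl :: "('k, 'o, 'm::ab_group_add, 'z) lin_cat_scheme \<Rightarrow> 'o set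
    \<Rightarrow> ('o \<Rightarrow>\<^sub>0 int) set \<Rightarrow> ('o \<Rightarrow>\<^sub>0 int) set" where
  "K0_incl C A = the_hom (K0 C A) (K0 C (Ob C)) A
    (\<lambda>a. K0_class C A (frag_of a)) (\<lambda>a. K0_class C (Ob C) (frag_of a))"

definition K0_shift :: "('k, 'o, 'm::ab_group_add, 'z) ang_cat_scheme
    \<Rightarrow> ('o \<Rightarrow>\<^sub>0 int) set \<Rightarrow> ('o \<Rightarrow>\<^sub>0 int) set" where
  "K0_shift C = the_hom (K0 C (Ob C)) (K0 C (Ob C)) (Ob C)
    (\<lambda>x. K0_class C (Ob C) (frag_of x)) (\<lambda>x. K0_class C (Ob C) (frag_of (shift C x)))"

definition index_ob :: "nat \<Rightarrow> ('k, 'o, 'm::ab_group_add, 'z) ang_cat_scheme \<Rightarrow> 'o set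
    \<Rightarrow> 'o \<Rightarrow> ('o \<Rightarrow>\<^sub>0 int) set" where
  "index_ob d C A x = (THE e. \<exists>t. resolution d C A x t \<and>
    e = K0_class C A (\<Sum>i\<le>d. frag_cmul ((-1) ^ i) (frag_of (t i))))"

definition index_hom :: "nat \<Rightarrow> ('k, 'o, 'm::ab_group_add, 'z) ang_cat_scheme \<Rightarrow> 'o set
    \<Rightarrow> ('o \<Rightarrow>\<^sub>0 int) set \<Rightarrow> ('o \<Rightarrow>\<^sub>0 int) set" where
  "index_hom d C A = the_hom (K0 C (Ob C)) (K0 C A) (Ob C)
    (\<lambda>x. K0_class C (Ob C) (frag_of x)) (index_ob d C A)"

definition dual_class :: "('k, 'o, 'm::ab_group_add, 'z) lin_cat_scheme \<Rightarrow> 'o set \<Rightarrow> 'o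
    \<Rightarrow> ('o \<Rightarrow>\<^sub>0 int) set \<Rightarrow> int" where
  "dual_class C A u = the_hom (K0 C A) integer_group (Indec C A)
    (\<lambda>v. K0_class C A (frag_of v)) (kronecker C u)"

definition c_vector :: "nat \<Rightarrow> ('k, 'o, 'm::ab_group_add, 'z) ang_cat_scheme
    \<Rightarrow> 'o set \<Rightarrow> 'o \<Rightarrow> 'o set \<Rightarrow> ('o \<Rightarrow>\<^sub>0 int) set \<Rightarrow> int" where
  "c_vector d C A u B = the_hom (K0 C A) integer_group (Indec C B)
    (index_ob d C A) (kronecker C u)"

end

theory Submission
  imports Defs
begin

text \<open>
  An angle all of whose terms lie in \<open>add T\<close> has zero connecting morphism, hence splits, and so
  its alternating sum vanishes in \<open>K\<^sub>0(add T)\<close>. If two angles have the same last term, all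
  other terms of the first one are in \<open>add T\<close> and so is the initial term of the second one,
  then the octahedral axiom replaces the second angle by one ending one step earlier, whose
  remaining new terms come from \<open>add T\<close>. Iterating this with resolutions shows that \<open>\<Sum>(-1)\<^sup>i
  Ind(s\<^sup>i) = 0\<close> for every angle whose initial term \<open>s\<^sup>0\<close> is in \<open>add T\<close>.

  For \<open>v\<close> in \<open>add U\<close>, a full rotation of its \<open>T\<close>-resolution is an angle \<open>v \<rightarrow> \<Sigma>\<^sup>d t\<^sub>d \<rightarrow> ... \<rightarrow>
  \<Sigma>\<^sup>d t\<^sub>0 \<rightarrow> \<Sigma>\<^sup>d v\<close> with initial term in \<open>add U\<close>, so \<open>Ind\<^sub>U \<circ> \<Sigma>\<^sup>d \<circ> Ind\<^sub>T\<close> maps \<open>[v]\<close> to \<open>(-1)\<^sup>d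
  [v]\<close>. In the same way the \<open>U\<close>-resolution of \<open>\<Sigma>\<^sup>d t\<close> shows that the indices of the objects of
  \<open>add U\<close> generate \<open>K\<^sub>0(add T)\<close>. Krull-Schmidt multiplicities give the dual classes.
\<close>

section \<open>Biproducts and Krull-Schmidt decompositions\<close>

text \<open>The index, the dual classes, the induced maps and the c-vector are all definite
  descriptions. Each therefore needs a witness and a uniqueness argument, and uniqueness always
  rests on a generating set. This is why generation by indecomposables, and by indices of objects of
  add U, is proved alongside the computation. Exactness of angles has to be extracted from the
  axioms: weak kernels and weak cokernels come from (N3), applied to morphisms into or out of
  rotations of a trivial angle. Rigidity acts at two places. It kills the connecting morphism of an
  angle inside add T, and it kills the obstruction to lifting a morphism when the cone is formed.
  The Krull-Schmidt property also acts twice. Local endomorphism rings make idempotents split, which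
  provides the images needed to decompose an angle with zero connecting morphism; and uniqueness of
  decompositions makes multiplicities additive. The sign \<open>(-1) ^ d\<close> arises because the
  index counts a resolution from its right end, whereas the relation attached to the rotated angle
  counts from the left.\<close>

context linear_category begin

section \<open>Arithmetic of typed morphisms\<close>

text \<open>Membership of both objects is bundled with membership of the morphism, so that one fact
  about an arrow discharges every side condition of the category laws.\<close>

definition arr :: "'m \<Rightarrow> 'o \<Rightarrow> 'o \<Rightarrow> bool" where
  "arr f x y \<longleftrightarrow> x \<in> Ob C \<and> y \<in> Ob C \<and> f \<in> Hom C x y"

text \<open>Annotating a composite with its three objects makes associativity and bilinearity usable
  as rewrite rules: their side conditions then contain no object that the redex does not
  mention.\<close>

definition cmp :: "'o \<Rightarrow> 'o \<Rightarrow> 'o \<Rightarrow> 'm \<Rightarrow> 'm \<Rightarrow> 'm" where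
  "cmp x y z g f = g \<cdot> f"

lemma arr_obs: "arr f x y \<Longrightarrow> x \<in> Ob C" "arr f x y \<Longrightarrow> y \<in> Ob C"
  unfolding arr_def by blast+

lemma cmp_arr: "arr f x y \<Longrightarrow> arr g y z \<Longrightarrow> arr (cmp x y z g f) x z"
  unfolding arr_def cmp_def using Comp_in_Hom by blast

lemma Id_arr: "x \<in> Ob C \<Longrightarrow> arr (Id C x) x x"
  unfolding arr_def using Id_in_Hom by blast

lemma zero_arr: "x \<in> Ob C \<Longrightarrow> y \<in> Ob C \<Longrightarrow> arr 0 x y"
  unfolding arr_def using Hom_subspace subspace_0 by blast

lemma add_arr: "arr f x y \<Longrightarrow> arr g x y \<Longrightarrow> arr (f + g) x y"
  unfolding arr_def using Hom_subspace subspace_add by blast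

lemma diff_arr: "arr f x y \<Longrightarrow> arr g x y \<Longrightarrow> arr (f - g) x y"
  unfolding arr_def using Hom_subspace subspace_diff by blast

lemma neg_arr: "arr f x y \<Longrightarrow> arr (- f) x y"
  unfolding arr_def using Hom_subspace subspace_neg by blast

lemma cmp_Id: "arr f x y \<Longrightarrow> cmp x x y f (Id C x) = f"
  and Id_cmp: "arr f x y \<Longrightarrow> cmp x y y (Id C y) f = f"
  unfolding arr_def cmp_def using Comp_Id Id_Comp by blast+

lemma cmp_assoc: "arr f w x \<Longrightarrow> arr g x y \<Longrightarrow> arr h y z \<Longrightarrow>
    cmp w x z (cmp x y z h g) f = cmp w y z h (cmp w x y g f)"
  unfolding arr_def cmp_def using Comp_assoc by metis

lemma add_cmp: "arr f x y \<Longrightarrow> arr g y z \<Longrightarrow> arr g' y z \<Longrightarrow>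
    cmp x y z (g + g') f = cmp x y z g f + cmp x y z g' f"
  unfolding arr_def cmp_def using Comp_add_left by blast

lemma cmp_add: "arr f x y \<Longrightarrow> arr f' x y \<Longrightarrow> arr g y z \<Longrightarrow>
    cmp x y z g (f + f') = cmp x y z g f + cmp x y z g f'"
  unfolding arr_def cmp_def using Comp_add_right by blast

lemma zero_cmp: "arr f x y \<Longrightarrow> z \<in> Ob C \<Longrightarrow> cmp x y z 0 f = 0"
  using add_cmp[of f x y 0 z 0] zero_arr[of y z] by (auto simp: arr_def)

lemma cmp_zero: "x \<in> Ob C \<Longrightarrow> arr g y z \<Longrightarrow> cmp x y z g 0 = 0"
  using cmp_add[of 0 x y 0 g z] zero_arr[of x y] by (auto simp: arr_def)

lemma neg_cmp: "arr f x y \<Longrightarrow> arr g y z \<Longrightarrow> cmp x y z (- g) f = - cmp x y z g f"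
  using add_cmp[of f x y g z "- g"] neg_arr[of g y z] zero_cmp[of f x y z] arr_obs(2)[of g y z]
  by (simp add: eq_neg_iff_add_eq_0 add.commute)

lemma cmp_neg: "arr f x y \<Longrightarrow> arr g y z \<Longrightarrow> cmp x y z g (- f) = - cmp x y z g f"
  using cmp_add[of f x y "- f" g z] neg_arr[of f x y] cmp_zero[of x g y z] arr_obs(1)[of f x y]
  by (simp add: eq_neg_iff_add_eq_0 add.commute)

lemma diff_cmp: "arr f x y \<Longrightarrow> arr g y z \<Longrightarrow> arr g' y z \<Longrightarrow>
    cmp x y z (g - g') f = cmp x y z g f - cmp x y z g' f"
  using add_cmp[of f x y g z "- g'"] neg_arr[of g' y z] neg_cmp[of f x y g' z] by simp

lemma cmp_diff: "arr f x y \<Longrightarrow> arr f' x y \<Longrightarrow> arr g y z \<Longrightarrow>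
    cmp x y z g (f - f') = cmp x y z g f - cmp x y z g f'"
  using cmp_add[of f x y "- f'" g z] neg_arr[of f' x y] cmp_neg[of f' x y g z] by simp

section \<open>Biproducts, isomorphisms and complements\<close>

lemma biproduct_iff:
  "biproduct C a b s i j p q \<longleftrightarrow>
    arr i a s \<and> arr j b s \<and> arr p s a \<and> arr q s b \<and>
    cmp a s a p i = Id C a \<and> cmp b s b q j = Id C b \<and> cmp b s a p j = 0 \<and> cmp a s b q i = 0 \<and>
    cmp s a s i p + cmp s b s j q = Id C s"
  unfolding biproduct_def arr_def cmp_def by blast

lemma iso_mor_iff:
  "x \<in> Ob C \<Longrightarrow> y \<in> Ob C \<Longrightarrow> iso_mor C x y f \<longleftrightarrow>
    arr f x y \<and> (\<exists>g. arr g y x \<and> cmp x y x g f = Id C x \<and> cmp y x y f g = Id C y)"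
  unfolding iso_mor_def arr_def cmp_def by blast

lemmas cmp_simps = add_cmp cmp_add zero_cmp cmp_zero neg_cmp cmp_neg diff_cmp cmp_diff
  cmp_Id Id_cmp cmp_assoc add_arr diff_arr neg_arr cmp_arr zero_arr Id_arr

text \<open>Since \<open>cmp_assoc\<close> nests composites to the right, a known product
  \<open>g f = k\<close> is hidden as soon as something is composed on its right. This form makes it
  visible again to rewriting.\<close>

lemma cmp_reassoc:
  assumes "cmp x y z g f = k" "arr f x y" "arr g y z" "arr h w x"
  shows "cmp w y z g (cmp w x y f h) = cmp w x z k h"
  using assms cmp_assoc by metis

text \<open>The last four conclusions are the matrix identities with a further arrow
  \<open>h\<close> on the right, the shape in which they occur after reassociation.\<close>

lemma biproductD:
  assumes "biproduct C a b s i j p q"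
  shows "arr i a s" "arr j b s" "arr p s a" "arr q s b" "a \<in> Ob C" "b \<in> Ob C" "s \<in> Ob C"
    "cmp a s a p i = Id C a" "cmp b s b q j = Id C b" "cmp b s a p j = 0" "cmp a s b q i = 0"
    "\<And>h w. arr h w a \<Longrightarrow> cmp w s a p (cmp w a s i h) = h"
    "\<And>h w. arr h w b \<Longrightarrow> cmp w s b q (cmp w b s j h) = h"
    "\<And>h w. arr h w b \<Longrightarrow> cmp w s a p (cmp w b s j h) = 0"
    "\<And>h w. arr h w a \<Longrightarrow> cmp w s b q (cmp w a s i h) = 0"
proof -
  note b = assms[unfolded biproduct_iff]
  show "arr i a s" "arr j b s" "arr p s a" "arr q s b" "a \<in> Ob C" "b \<in> Ob C" "s \<in> Ob C"
    "cmp a s a p i = Id C a" "cmp b s b q j = Id C b" "cmp b s a p j = 0" "cmp a s b q i = 0"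
    using b by (simp_all add: arr_def)
  show "\<And>h w. arr h w a \<Longrightarrow> cmp w s a p (cmp w a s i h) = h"
    "\<And>h w. arr h w b \<Longrightarrow> cmp w s b q (cmp w b s j h) = h"
    "\<And>h w. arr h w b \<Longrightarrow> cmp w s a p (cmp w b s j h) = 0"
    "\<And>h w. arr h w a \<Longrightarrow> cmp w s b q (cmp w a s i h) = 0"
    subgoal for h w using b cmp_assoc[of h w a i s p a] Id_cmp[of h w a] by simp
    subgoal for h w using b cmp_assoc[of h w b j s q b] Id_cmp[of h w b] by simp
    subgoal for h w using b cmp_assoc[of h w b j s p a] zero_cmp[of h w b a] by (simp add: arr_def)
    subgoal for h w using b cmp_assoc[of h w a i s q b] zero_cmp[of h w a b] by (simp add: arr_def)
    done
qed

lemma biproduct_expand: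
  assumes "biproduct C a b s i j p q"
  shows "arr h w s \<Longrightarrow> cmp w a s i (cmp w s a p h) + cmp w b s j (cmp w s b q h) = h"
    and "arr k s w \<Longrightarrow> cmp s a w (cmp a s w k i) p + cmp s b w (cmp b s w k j) q = k"
proof -
  note [simp] = biproductD[OF assms]
  have sum: "cmp s a s i p + cmp s b s j q = Id C s" using assms by (simp add: biproduct_iff)
  show "cmp w a s i (cmp w s a p h) + cmp w b s j (cmp w s b q h) = h" if h: "arr h w s"
    using arg_cong[OF sum, of "\<lambda>k. cmp w s s k h"] h by (simp add: cmp_simps)
  show "cmp s a w (cmp a s w k i) p + cmp s b w (cmp b s w k j) q = k" if k: "arr k s w"
    using arg_cong[OF sum, of "\<lambda>h. cmp s s w k h"] k by (simp add: cmp_simps)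
qed

lemma biproduct_swap: "biproduct C a b s i j p q \<Longrightarrow> biproduct C b a s j i q p"
  by (simp add: biproduct_iff add.commute)

text \<open>Expanding \<open>p'\<close> in components gives \<open>p' = p + p' j q\<close>, so the
  new data differ from the old by a shear of \<open>a \<oplus> b\<close>. The inclusion of
  \<open>b\<close> is corrected to be killed by \<open>p'\<close>.\<close>

lemma biproduct_change_proj:
  assumes b: "biproduct C a b s i j p q" and p': "arr p' s a" "cmp a s a p' i = Id C a"
  shows "biproduct C a b s i (j - cmp b a s i (cmp b s a p' j)) p' q"
proof -
  note [simp] = biproductD[OF b] p' cmp_simps cmp_reassoc[OF p'(2) biproductD(1)[OF b] p'(1),
      simplified]
  have "cmp s a s i p + cmp s b s j q = Id C s" using b by (simp add: biproduct_iff)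
  moreover have "cmp s a s i p' = cmp s a s i p + cmp s a s i (cmp s b a (cmp b s a p' j) q)"
  proof -
    have "p' = p + cmp s b a (cmp b s a p' j) q"
      using biproduct_expand(2)[OF b p'(1)] p'(2) by (simp del: cmp_assoc)
    then have "cmp s a s i p' = cmp s a s i (p + cmp s b a (cmp b s a p' j) q)" by metis
    also have "\<dots> = cmp s a s i p + cmp s a s i (cmp s b a (cmp b s a p' j) q)" by simp
    finally show ?thesis .
  qed
  ultimately show ?thesis by (simp add: biproduct_iff)
qed

text \<open>The dual shear: \<open>i' = i + j q i'\<close>, and the projection to \<open>b\<close>
  is corrected to kill \<open>i'\<close>.\<close>

lemma biproduct_change_incl:
  assumes b: "biproduct C a b s i j p q" and i': "arr i' a s" "cmp a s a p i' = Id C a"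
  shows "biproduct C a b s i' j p (q - cmp s a b (cmp a s b q i') p)"
proof -
  note [simp] = biproductD[OF b] i' cmp_simps cmp_reassoc[OF i'(2) i'(1) biproductD(3)[OF b]]
  have "cmp s a s i p + cmp s b s j q = Id C s" using b by (simp add: biproduct_iff)
  moreover have "cmp s a s i' p = cmp s a s i p + cmp s a s (cmp a b s j (cmp a s b q i')) p"
  proof -
    have "i' = i + cmp a b s j (cmp a s b q i')"
      using biproduct_expand(1)[OF b i'(1)] i'(2) by simp
    then have "cmp s a s i' p = cmp s a s (i + cmp a b s j (cmp a s b q i')) p" by metis
    also have "\<dots> = cmp s a s i p + cmp s a s (cmp a b s j (cmp a s b q i')) p" by simp
    finally show ?thesis .
  qed
  ultimately have "cmp s a s i' p + (cmp s b s j q - cmp s a s (cmp a b s j (cmp a s b q i')) p) =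
      Id C s"
    by (simp del: cmp_assoc)
  then show ?thesis by (simp add: biproduct_iff)
qed

lemma biproduct_assoc:
  assumes b: "biproduct C a b s i j p q" and c: "biproduct C y z b i1 i2 p1 p2"
    and e: "biproduct C a y Y \<alpha>1 \<alpha>2 \<beta>1 \<beta>2"
  shows "biproduct C Y z s (cmp Y a s i \<beta>1 + cmp Y b s j (cmp Y y b i1 \<beta>2)) (cmp z b s j i2)
    (cmp s a Y \<alpha>1 p + cmp s y Y \<alpha>2 (cmp s b y p1 q)) (cmp s b z p2 q)"
proof -
  note [simp] = biproductD[OF b] biproductD[OF c] biproductD[OF e] cmp_simps
  have "cmp s a s i p + cmp s b s j q = Id C s" using b by (simp add: biproduct_iff)
  moreover have "cmp Y a Y \<alpha>1 \<beta>1 + cmp Y y Y \<alpha>2 \<beta>2 = Id C Y" using e by (simp add: biproduct_iff)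
  moreover have "cmp s y b i1 (cmp s b y p1 q) + cmp s z b i2 (cmp s b z p2 q) = q"
    using biproduct_expand(1)[OF c, of q s] by simp
  then have "cmp s b s j q = cmp s b s j (cmp s y b i1 (cmp s b y p1 q) + cmp s z b i2 (cmp s b z p2
      q))" by metis
  then have "cmp s b s j q = cmp s b s j (cmp s y b i1 (cmp s b y p1 q)) +
      cmp s b s j (cmp s z b i2 (cmp s b z p2 q))" by simp
  ultimately show ?thesis by (simp add: biproduct_iff algebra_simps)
qed

lemma isoI:
  assumes "arr f x y" "arr g y x" "cmp x y x g f = Id C x" "cmp y x y f g = Id C y"
  shows "isomorphic_ob C x y"
  using assms unfolding isomorphic_ob_def iso_mor_def arr_def cmp_def by blast

lemma isoE:
  assumes "isomorphic_ob C x y" "x \<in> Ob C" "y \<in> Ob C"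
  obtains f g where "arr f x y" "arr g y x" "cmp x y x g f = Id C x" "cmp y x y f g = Id C y"
  using assms unfolding isomorphic_ob_def iso_mor_def arr_def cmp_def by blast

lemma iso_sym: "x \<in> Ob C \<Longrightarrow> y \<in> Ob C \<Longrightarrow> isomorphic_ob C x y \<Longrightarrow> isomorphic_ob C y x"
  by (meson isoE isoI)

lemma iso_trans:
  assumes "x \<in> Ob C" "y \<in> Ob C" "z \<in> Ob C" "isomorphic_ob C x y" "isomorphic_ob C y z"
  shows "isomorphic_ob C x z"
proof -
  obtain f g where f: "arr f x y" "arr g y x" "cmp x y x g f = Id C x" "cmp y x y f g = Id C y"
    using isoE assms by blast
  obtain h k where h: "arr h y z" "arr k z y" "cmp y z y k h = Id C y" "cmp z y z h k = Id C z"
    using isoE assms by blast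
  have "cmp x z y k (cmp x y z h f) = f" "cmp z x y f (cmp z y x g k) = k"
    using f h cmp_assoc[of f x y h z k y] cmp_assoc[of k z y g x f y] by (simp_all add: cmp_simps)
  then show ?thesis
    using f h assms by (intro isoI[of "cmp x y z h f" x z "cmp z y x g k"]) (simp_all add:
        cmp_simps)
qed

lemma is_sumI: "biproduct C a b s i j p q \<Longrightarrow> is_sum C a b s"
  unfolding is_sum_def by blast

lemma is_sumE:
  assumes "is_sum C a b s" obtains i j p q where "biproduct C a b s i j p q"
  using assms unfolding is_sum_def by blast

lemma is_sum_obs: "is_sum C a b s \<Longrightarrow> a \<in> Ob C \<and> b \<in> Ob C \<and> s \<in> Ob C"
  unfolding is_sum_def biproduct_def by blast

lemma is_sum_swap: "is_sum C a b s \<Longrightarrow> is_sum C b a s"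
  unfolding is_sum_def using biproduct_swap by blast

lemma is_sum_assoc: "is_sum C a b s \<Longrightarrow> is_sum C y z b \<Longrightarrow> is_sum C a y Y \<Longrightarrow> is_sum C Y z s"
  by (elim is_sumE, rule is_sumI, rule biproduct_assoc)

lemma is_sum_assoc': "is_sum C b z s \<Longrightarrow> is_sum C a y b \<Longrightarrow> is_sum C y z Y \<Longrightarrow> is_sum C a Y s"
  by (meson is_sum_assoc is_sum_swap)

lemma is_sum_iso:
  assumes "is_sum C a b s" "t \<in> Ob C" "isomorphic_ob C s t"
  shows "is_sum C a b t"
proof -
  obtain i j p q where b: "biproduct C a b s i j p q" using assms(1) by (rule is_sumE)
  note [simp] = biproductD[OF b]
  obtain f g where f: "arr f s t" "arr g t s" "cmp s t s g f = Id C s" "cmp t s t f g = Id C t"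
    using isoE assms by (metis \<open>s \<in> Ob C\<close>)
  have [simp]: "cmp w t s g (cmp w s t f h) = h" if "arr h w s" for h w
    using cmp_assoc[of h w s f t g s] f that by (simp add: cmp_simps)
  have "cmp t s t f (cmp t a s i (cmp t s a p g) + cmp t b s j (cmp t s b q g)) = Id C t"
    using biproduct_expand(1)[OF b f(2)] f(4) by simp
  then have "biproduct C a b t (cmp a s t f i) (cmp b s t f j) (cmp t s a p g) (cmp t s b q g)"
    using f(1,2) by (simp add: biproduct_iff cmp_simps)
  then show ?thesis by (rule is_sumI)
qed

lemma zero_ob_arr: "zero_ob C z \<Longrightarrow> arr f z x \<Longrightarrow> f = 0" "zero_ob C z \<Longrightarrow> arr f x z \<Longrightarrow> f = 0"
  unfolding zero_ob_def using cmp_Id[of f z x] cmp_zero[of z f z x] Id_cmp[of f x z] zero_cmp[of f x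
      z z]
  by (auto simp: arr_def)

lemma biproduct_zero:
  "x \<in> Ob C \<Longrightarrow> zero_ob C z \<Longrightarrow> biproduct C x z x (Id C x) 0 (Id C x) 0"
  by (simp add: biproduct_iff cmp_simps zero_ob_def)

lemma is_sum_zero: "x \<in> Ob C \<Longrightarrow> zero_ob C z \<Longrightarrow> is_sum C x z x"
  using biproduct_zero is_sumI by blast

lemma is_sum_zeroD: "is_sum C a z s \<Longrightarrow> zero_ob C z \<Longrightarrow> isomorphic_ob C a s"
proof -
  assume "is_sum C a z s" and z: "zero_ob C z"
  then obtain i j p q where b: "biproduct C a z s i j p q" by (elim is_sumE)
  have "j = 0" using z biproductD(2)[OF b] by (rule zero_ob_arr)
  then show ?thesis
    using biproductD[OF b] b
    by (intro isoI[of i a s p]) (simp_all add: biproduct_iff zero_cmp)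
qed

lemma zero_iso: "zero_ob C x \<Longrightarrow> y \<in> Ob C \<Longrightarrow> isomorphic_ob C x y \<Longrightarrow> zero_ob C y"
proof -
  assume z: "zero_ob C x" and y: "y \<in> Ob C" "isomorphic_ob C x y"
  then obtain f g where f: "arr f x y" "arr g y x" "cmp y x y f g = Id C y"
    by (metis isoE zero_ob_def)
  have "f = 0" by (rule zero_ob_arr(1)[OF z f(1)])
  with f y zero_cmp[of g y x y] show ?thesis by (simp add: zero_ob_def)
qed

lemma is_sum_zero_zero: "is_sum C a b s \<Longrightarrow> zero_ob C s \<Longrightarrow> zero_ob C a"
proof -
  assume "is_sum C a b s" and z: "zero_ob C s"
  then obtain i j p q where b: "biproduct C a b s i j p q" by (elim is_sumE)
  have "i = 0" by (rule zero_ob_arr(2)[OF z biproductD(1)[OF b]])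
  with biproductD[OF b] cmp_zero[of a p s a] show ?thesis by (simp add: zero_ob_def)
qed

text \<open>The copy of \<open>b\<close> can be moved inside \<open>s\<close> onto the image of
  \<open>a\<close>, because the component from \<open>a\<close> to \<open>b\<close> is invertible.
  Then \<open>s'\<close> and \<open>r\<close> are complements of the same subobject, and projecting
  one onto the other along it is an isomorphism.\<close>

lemma complement_iso:
  assumes b: "biproduct C a s' s i i' p p'" and c: "biproduct C b r s \<iota> \<iota>' \<pi> \<pi>'"
    and v: "arr v b a" "cmp a b a v (cmp a s b \<pi> i) = Id C a" "cmp b a b (cmp a s b \<pi> i) v = Id C b"
  shows "isomorphic_ob C s' r"
proof -
  note [simp] = biproductD[OF b] biproductD[OF c] v(1) cmp_simps
  have v2 [simp]: "cmp a b a v (cmp a s b \<pi> i) = Id C a" by (rule v(2))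
  have 1: "cmp b s b \<pi> (cmp b a s i v) = Id C b"
    using v(3) by simp
  have "biproduct C b r s (cmp b a s i v) \<iota>' \<pi> (\<pi>' - cmp s b r (cmp b s r \<pi>' (cmp b a s i v)) \<pi>)"
    by (rule biproduct_change_incl[OF c _ 1]) simp
  \<comment> \<open>The projection to \<open>r\<close> along the moved copy of \<open>b\<close>; it
    kills \<open>i v\<close>, hence also \<open>i\<close>, since \<open>v\<close> is
    invertible.\<close>
  moreover define \<rho> where "\<rho> = \<pi>' - cmp s b r (cmp b s r \<pi>' (cmp b a s i v)) \<pi>"
  ultimately have e: "biproduct C b r s (cmp b a s i v) \<iota>' \<pi> \<rho>" by simp
  have [simp]: "arr \<rho> s r" by (rule biproductD(4)[OF e])
  have A: "cmp s b s (cmp b a s i v) \<pi> + cmp s r s \<iota>' \<rho> = Id C s"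
    and B: "cmp s a s i p + cmp s s' s i' p' = Id C s"
    using e b by (simp_all add: biproduct_iff)
  have vi: "cmp b a b (cmp a s b \<pi> i) v = Id C b" by (rule v(3))
  have [simp]: "cmp a s r \<rho> i = 0"
  proof -
    have "cmp b s r \<rho> (cmp b a s i v) = 0" by (rule biproductD(11)[OF e])
    then have "cmp a b r (cmp b s r \<rho> (cmp b a s i v)) (cmp a s b \<pi> i) = 0"
      by (simp only: zero_cmp[of "cmp a s b \<pi> i" a b r] cmp_arr[OF biproductD(1)[OF b]
          biproductD(3)[OF c]]
          biproductD(6)[OF c] biproductD(6)[OF e])
    then show ?thesis by simp
  qed
  have [simp]: "cmp w s r \<rho> (cmp w a s i h) = 0" if "arr h w a" for h w
    using cmp_assoc[of h w a i s \<rho> r] that zero_cmp[of h w a r] by simp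
  note [simp] = biproductD[OF e]
  \<comment> \<open>Inserting the new decomposition between \<open>p'\<close> and \<open>i'\<close>,
    the \<open>b\<close> term passes through \<open>i\<close> and dies under \<open>p'\<close>. The
    second composite is treated in the same way with the roles exchanged.\<close>
  have "cmp s' s s' p' (cmp s' s s (cmp s b s (cmp b a s i v) \<pi> + cmp s r s \<iota>' \<rho>) i') = Id C s'"
    unfolding A by simp
  then have 2: "cmp s' r s' (cmp r s s' p' \<iota>') (cmp s' s r \<rho> i') = Id C s'"
    by simp
  have "cmp r s r \<rho> (cmp r s s (cmp s a s i p + cmp s s' s i' p') \<iota>') = Id C r"
    unfolding B by simp
  then have 3: "cmp r s' r (cmp s' s r \<rho> i') (cmp r s s' p' \<iota>') = Id C r"
    by simp
  show ?thesis
    by (rule isoI[of "cmp s' s r \<rho> i'" _ _ "cmp r s s' p' \<iota>'"]) (use 2 3 in simp_all)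
qed

section \<open>Objects with local endomorphism ring\<close>

lemma local_sum_unit:
  assumes "local_End C a" "a \<in> Ob C" "arr f a a" "arr g a a" "f + g = Id C a"
  shows "(\<exists>v. arr v a a \<and> cmp a a a v f = Id C a \<and> cmp a a a f v = Id C a)
    \<or> (\<exists>v. arr v a a \<and> cmp a a a v g = Id C a \<and> cmp a a a g v = Id C a)"
proof -
  have "iso_mor C a a (Id C a)"
    using assms(2) by (simp add: iso_mor_iff cmp_simps) (metis Id_arr Id_cmp)
  then have "iso_mor C a a f \<or> iso_mor C a a g"
    using assms unfolding local_End_def arr_def by metis
  then show ?thesis by (auto simp: iso_mor_iff assms(2))
qed

lemma local_not_zero: "local_End C a \<Longrightarrow> \<not> zero_ob C a"
  by (simp add: local_End_def zero_ob_def)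

text \<open>\<open>k r\<close> is idempotent, and one of \<open>k r\<close> and
  \<open>1 - k r\<close> is invertible. An invertible idempotent is the identity; in the other case
  \<open>(1 - k r) k = 0\<close> would force \<open>k = 0\<close> and \<open>a\<close> to be
  zero.\<close>

lemma local_retract:
  assumes "local_End C b" "arr k a b" "arr r b a" "cmp a b a r k = Id C a" "\<not> zero_ob C a"
  shows "cmp b a b k r = Id C b"
proof -
  have obs: "a \<in> Ob C" "b \<in> Ob C" using assms(2) by (auto simp: arr_def)
  note [simp] = assms(2,3,4) cmp_simps obs
  have [simp]: "cmp w b a r (cmp w a b k h) = h" if "arr h w a" for h w
    using cmp_assoc[of h w a k b r a] that by simp
  have "cmp b a b k r + (Id C b - cmp b a b k r) = Id C b" by simp
  from local_sum_unit[OF assms(1) obs(2) _ _ this]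
  consider (left) v where "arr v b b" "cmp b b b v (cmp b a b k r) = Id C b"
    | (right) v where "arr v b b" "cmp b b b v (Id C b - cmp b a b k r) = Id C b"
    by auto
  then show ?thesis
  proof cases
    case (left v)
    have "cmp b b b (cmp b b b v (cmp b a b k r)) (cmp b a b k r) = cmp b a b k r"
      unfolding left by simp
    then have "cmp b b b v (cmp b a b k r) = cmp b a b k r" using left(1) by simp
    with left show ?thesis by simp
  next
    case (right v)
    have "cmp a b b (cmp b b b v (Id C b - cmp b a b k r)) k = k"
      unfolding right by simp
    then have "k = 0" using right(1) by simp
    with assms(4) cmp_zero[of a r b a] have "zero_ob C a" by (simp add: zero_ob_def)
    with assms(5) show ?thesis by contradiction
  qed
qed

text \<open>If both summands were nonzero, \<open>local_retract\<close> would make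
  \<open>i p\<close> the identity, which leaves \<open>j q = 0\<close> and so a zero second summand
  after all.\<close>

lemma local_indecomposable:
  assumes "local_End C x" "x \<in> Ob C"
  shows "indecomposable C x"
proof -
  have "zero_ob C a \<or> zero_ob C b" if "is_sum C a b x" for a b
  proof (rule ccontr)
    assume n: "\<not> (zero_ob C a \<or> zero_ob C b)"
    from that obtain i j p q where b: "biproduct C a b x i j p q" by (elim is_sumE)
    note [simp] = biproductD[OF b]
    have "cmp x a x i p = Id C x" by (rule local_retract[OF assms(1)]) (use n in simp_all)
    then have "cmp x b x j q = 0" using b by (simp add: biproduct_iff)
    then have "cmp b x b q (cmp b x x (cmp x b x j q) j) = 0" by (simp add: zero_cmp cmp_zero)
    then have "Id C b = 0" by (simp add: cmp_simps)
    then show False using n by (simp add: zero_ob_def)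
  qed
  with assms local_not_zero show ?thesis unfolding indecomposable_def by blast
qed

section \<open>Iterated sums and splitting of idempotents\<close>

text \<open>An inductive form of finite sums: each step peels off one summand together with a chosen
  complement, as the exchange arguments require.\<close>

primrec is_list_sum :: "'o list \<Rightarrow> 'o \<Rightarrow> bool" where
  "is_list_sum [] s = zero_ob C s"
| "is_list_sum (a # as) s = (\<exists>s'. is_list_sum as s' \<and> is_sum C a s' s)"

lemma list_sum_ob: "is_list_sum xs s \<Longrightarrow> s \<in> Ob C"
  by (cases xs) (auto simp: zero_ob_def dest: is_sum_obs)

lemma list_sum_iso: "is_list_sum xs s \<Longrightarrow> t \<in> Ob C \<Longrightarrow> isomorphic_ob C s t \<Longrightarrow> is_list_sum xs t"
  by (cases xs) (auto intro: zero_iso is_sum_iso)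

end

context additive_linear_category begin

lemma sum_ex: "x \<in> Ob C \<Longrightarrow> y \<in> Ob C \<Longrightarrow> \<exists>s i j p q. biproduct C x y s i j p q"
  using sum_exists unfolding is_sum_def by blast

lemma list_sum_summand: "is_list_sum xs s \<Longrightarrow> a \<in> set xs \<Longrightarrow> \<exists>y. is_sum C a y s"
proof (induction xs arbitrary: s)
  case (Cons b xs)
  then obtain s' where s': "is_list_sum xs s'" "is_sum C b s' s" by auto
  show ?case
  proof (cases "a = b")
    case False
    then obtain y where y: "is_sum C a y s'" using Cons s' by auto
    obtain Y where "is_sum C y b Y" using sum_exists is_sum_obs s'(2) y by meson
    then show ?thesis using is_sum_assoc'[OF is_sum_swap[OF s'(2)] y] by blast
  qed (use s' in auto)
qed simp

lemma list_sum_append: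
  assumes "is_list_sum xs a" "is_list_sum ys b" "is_sum C a b s"
  shows "is_list_sum (xs @ ys) s"
  using assms
proof (induction xs arbitrary: a s)
  case Nil
  then have "isomorphic_ob C b s" using is_sum_zeroD[OF is_sum_swap] by simp
  with Nil show ?case using list_sum_iso is_sum_obs by auto
next
  case (Cons x xs)
  then obtain a' where a': "is_list_sum xs a'" "is_sum C x a' a" by auto
  obtain M where M: "is_sum C a' b M" using sum_exists a' Cons by (meson list_sum_ob)
  have "is_sum C x M s" by (rule is_sum_assoc'[OF Cons.prems(3) a'(2) M])
  with Cons.IH[OF a'(1) Cons.prems(2) M] show ?case by auto
qed

text \<open>One of \<open>e\<close> and \<open>1 - e\<close> has an invertible component on the first local summand, which can
  then be split off so that \<open>e\<close> restricts to its complement.\<close>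

lemma list_sum_idempotent_split:
  assumes "is_list_sum xs x" "\<forall>a\<in>set xs. local_End C a" "arr e x x" "cmp x x x e e = e"
  shows "\<exists>y z i j p q. biproduct C y z x i j p q \<and> cmp x y x i p = e"
  using assms
proof (induction xs arbitrary: x e)
  case Nil
  then have z: "zero_ob C x" "e = 0" using zero_ob_arr by auto
  with Nil have "biproduct C x x x 0 0 0 0"
    by (simp add: biproduct_iff cmp_simps zero_ob_def)
  with z show ?case by (metis Nil.prems(4))
next
  case (Cons a xs)
  then obtain x' where x': "is_list_sum xs x'" "is_sum C a x' x" by auto
  then obtain i0 j0 p0 q0 where b: "biproduct C a x' x i0 j0 p0 q0" by (elim is_sumE)
  note [simp] = biproductD[OF b] cmp_simps
  \<comment> \<open>The case where the component of \<open>e\<close> on the first summand is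
    invertible. It is stated for a general idempotent because it is used for \<open>1 - e\<close> as
    well.\<close>
  have main: "\<exists>y z i j p q. biproduct C y z x i j p q \<and> cmp x y x i p = e"
    if e: "arr e x x" "cmp x x x e e = e" and v: "arr v a a" "cmp a a a v (cmp a x a p0 (cmp a x x e
        i0)) = Id C a"
    for e v
  proof -
    note [simp] = e v
    have [simp]: "cmp w x x e (cmp w x x e h) = cmp w x x e h" if "arr h w x" for h w
      using cmp_assoc[of h w x e x e x] that by simp
    \<comment> \<open>Chosen so that \<open>e i = i\<close>, \<open>p e = p\<close> and
      \<open>p i = v p0 e i0 = 1\<close>. The summand \<open>a\<close> is thereby moved into the
      image of \<open>e\<close>, and \<open>e\<close> becomes block diagonal with respect to
      \<open>a\<close> and its complement.\<close>
    define i p where "i = cmp a x x e i0" and "p = cmp x a a v (cmp x x a p0 e)"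
    have ip: "arr i a x" "arr p x a" by (simp_all add: i_def p_def)
    have "biproduct C a x' x i0 (j0 - cmp x' a x i0 (cmp x' x a p j0)) p q0"
      by (rule biproduct_change_proj[OF b]) (simp_all add: i_def p_def)
    from biproduct_change_incl[OF this, of i]
    obtain j q where c: "biproduct C a x' x i j p q" by (force simp: i_def p_def)
    note [simp] = biproductD[OF c]
    have [simp]: "cmp a x x e i = i" "cmp x x a p e = p" by (simp_all add: i_def p_def)
    have [simp]: "cmp w x x e (cmp w a x i h) = cmp w a x i h" if "arr h w a" for h w
      using cmp_assoc[of h w a i x e x] that by simp
    have [simp]: "cmp w x a p (cmp w x x e h) = cmp w x a p h" if "arr h w x" for h w
      using cmp_assoc[of h w x e x p a] that by simp
    have ej: "cmp x' x' x j (cmp x' x x' q (cmp x' x x e j)) = cmp x' x x e j"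
      using biproduct_expand(1)[OF c, of "cmp x' x x e j" x'] by simp
    have qe: "cmp x x' x' (cmp x' x x' q (cmp x' x x e j)) q = cmp x x x' q e"
      using biproduct_expand(2)[OF c, of "cmp x x x' q e" x'] by simp
    have jq: "cmp x x' x j (cmp x x x' q e) = e - cmp x a x i p"
      using biproduct_expand(1)[OF c, of e x] by (simp add: algebra_simps)
    \<comment> \<open>The block of \<open>e\<close> on the complement, again idempotent. Splitting
      it by induction yields \<open>y\<close>, and the image of \<open>e\<close> is
      \<open>a \<oplus> y\<close>.\<close>
    let ?e = "cmp x' x x' q (cmp x' x x e j)"
    have "cmp x' x' x' ?e ?e = cmp x' x x' q (cmp x' x x e (cmp x' x' x j ?e))" by simp
    also have "\<dots> = ?e" by (simp only: ej) simp
    finally have "cmp x' x' x' ?e ?e = ?e" .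
    from Cons.IH[OF x'(1) _ _ this] Cons.prems(2) obtain y z i1 j1 p1 q1 where
      y: "biproduct C y z x' i1 j1 p1 q1" "cmp x' y x' i1 p1 = ?e" by auto
    obtain Y \<alpha>1 \<alpha>2 \<beta>1 \<beta>2 where Y: "biproduct C a y Y \<alpha>1 \<alpha>2 \<beta>1 \<beta>2"
      using sum_ex[of a y] biproductD(5)[OF y(1)] by auto
    note [simp] = biproductD[OF y(1)] biproductD[OF Y]
    from biproduct_assoc[OF c y(1) Y]
    have *: "biproduct C Y z x (cmp Y a x i \<beta>1 + cmp Y x' x j (cmp Y y x' i1 \<beta>2)) (cmp z x' x j j1)
      (cmp x a Y \<alpha>1 p + cmp x y Y \<alpha>2 (cmp x x' y p1 q)) (cmp x x' z q1 q)" .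
    have "cmp x Y x (cmp Y a x i \<beta>1 + cmp Y x' x j (cmp Y y x' i1 \<beta>2))
        (cmp x a Y \<alpha>1 p + cmp x y Y \<alpha>2 (cmp x x' y p1 q))
      = cmp x a x i p + cmp x x' x j (cmp x x' x' (cmp x' y x' i1 p1) q)" by simp
    also have "\<dots> = e" unfolding y(2) qe jq by simp
    finally show ?thesis using * by blast
  qed
  note [simp] = Cons.prems(3,4)
  let ?f = "cmp a x a p0 (cmp a x x e i0)" and ?g = "cmp a x a p0 (cmp a x x (Id C x - e) i0)"
  have "?f + ?g = Id C a" by simp
  from local_sum_unit[OF _ _ _ _ this] Cons.prems(2)
  consider v where "arr v a a" "cmp a a a v ?f = Id C a"
    | v where "arr v a a" "cmp a a a v ?g = Id C a" by auto
  then show ?case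
  proof cases
    case 1
    show ?thesis by (rule main[OF _ _ 1]) simp_all
  next
    case (2 v)
    \<comment> \<open>A splitting of \<open>1 - e\<close> becomes one of \<open>e\<close> when the
      two summands are exchanged.\<close>
    have "\<exists>y z i j p q. biproduct C y z x i j p q \<and> cmp x y x i p = Id C x - e"
      by (rule main[OF _ _ 2]) simp_all
    then obtain y z i j p q where y: "biproduct C y z x i j p q" "cmp x y x i p = Id C x - e" by
        blast
    then have "cmp x z x j q = e" by (simp add: biproduct_iff algebra_simps)
    with biproduct_swap[OF y(1)] show ?thesis by blast
  qed
qed

end

section \<open>Indexed finite sums and the additive closure\<close>

context linear_category begin

lemma cmp_sum:
  assumes "finite I" "\<And>i. i \<in> I \<Longrightarrow> arr (f i) x y" "arr g y z" "x \<in> Ob C"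
  shows "cmp x y z g (\<Sum>i\<in>I. f i) = (\<Sum>i\<in>I. cmp x y z g (f i)) \<and> arr (\<Sum>i\<in>I. f i) x y"
  using assms by (induction I rule: finite_induct) (auto simp: cmp_simps arr_def[of g] zero_arr)

lemma sum_cmp:
  assumes "finite I" "\<And>i. i \<in> I \<Longrightarrow> arr (g i) y z" "arr f x y" "z \<in> Ob C"
  shows "cmp x y z (\<Sum>i\<in>I. g i) f = (\<Sum>i\<in>I. cmp x y z (g i) f)"
proof -
  have "arr (\<Sum>i\<in>I. g i) y z"
    using assms by (induction I rule: finite_induct) (auto simp: cmp_simps arr_def[of f] zero_arr)
  show ?thesis
    using assms(1,2)
  proof (induction I rule: finite_induct)
    case (insert i I)
    have "arr (\<Sum>i\<in>I. g i) y z"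
      using cmp_sum[of I g y z "Id C z" z] insert assms by (auto simp: Id_arr arr_def[of f])
    with insert assms show ?case by (simp add: cmp_simps)
  qed (use assms in \<open>simp add: cmp_simps\<close>)
qed

lemma finite_sum_iff:
  "is_finite_sum C n a s \<longleftrightarrow> s \<in> Ob C \<and> (\<forall>i<n. a i \<in> Ob C) \<and>
    (\<exists>\<iota> \<pi>. (\<forall>i<n. arr (\<iota> i) (a i) s \<and> arr (\<pi> i) s (a i)) \<and>
      (\<forall>i<n. \<forall>j<n. cmp (a i) s (a j) (\<pi> j) (\<iota> i) = (if i = j then Id C (a i) else 0)) \<and>
      (\<Sum>i<n. cmp s (a i) s (\<iota> i) (\<pi> i)) = Id C s)"
  unfolding is_finite_sum_def cmp_def arr_def by blast

lemma finite_sum_Suc: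
  assumes "is_finite_sum C n a s'" "is_sum C s' (a n) s"
  shows "is_finite_sum C (Suc n) a s"
proof -
  from assms(1) obtain \<iota> \<pi> where f: "s' \<in> Ob C" "\<And>i. i < n \<Longrightarrow> a i \<in> Ob C"
    "\<And>i. i < n \<Longrightarrow> arr (\<iota> i) (a i) s'" "\<And>i. i < n \<Longrightarrow> arr (\<pi> i) s' (a i)"
    "\<And>i j. i < n \<Longrightarrow> j < n \<Longrightarrow> cmp (a i) s' (a j) (\<pi> j) (\<iota> i) = (if i = j then Id C (a i) else 0)"
    "(\<Sum>i<n. cmp s' (a i) s' (\<iota> i) (\<pi> i)) = Id C s'"
    unfolding finite_sum_iff by blast
  obtain i j p q where b: "biproduct C s' (a n) s i j p q" using assms(2) by (rule is_sumE)
  note [simp] = biproductD[OF b] f(1-5) cmp_simps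
  define \<iota>' where "\<iota>' k = (if k < n then cmp (a k) s' s i (\<iota> k) else j)" for k
  define \<pi>' where "\<pi>' k = (if k < n then cmp s s' (a k) (\<pi> k) p else q)" for k
  have arrs: "\<forall>k<Suc n. a k \<in> Ob C \<and> arr (\<iota>' k) (a k) s \<and> arr (\<pi>' k) s (a k)"
    unfolding \<iota>'_def \<pi>'_def by (simp add: less_Suc_eq)
  have orth: "cmp (a k) s (a l) (\<pi>' l) (\<iota>' k) = (if k = l then Id C (a k) else 0)"
    if "k < Suc n" "l < Suc n" for k l
  proof -
    consider "k < n" "l < n" | "k < n" "l = n" | "k = n" "l < n" | "k = n" "l = n"
      using \<open>k < Suc n\<close> \<open>l < Suc n\<close> by (auto simp: less_Suc_eq)
    then show ?thesis
      by cases (simp_all add: \<iota>'_def \<pi>'_def)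
  qed
  have "(\<Sum>k<n. cmp s (a k) s (\<iota>' k) (\<pi>' k)) = cmp s s' s i p"
  proof -
    have "(\<Sum>k<n. cmp s (a k) s (\<iota>' k) (\<pi>' k)) =
        (\<Sum>k<n. cmp s s' s i (cmp s s' s' (cmp s' (a k) s' (\<iota> k) (\<pi> k)) p))"
      by (rule sum.cong) (simp_all add: \<iota>'_def \<pi>'_def)
    also have "\<dots> = cmp s s' s i (\<Sum>k<n. cmp s s' s' (cmp s' (a k) s' (\<iota> k) (\<pi> k)) p)"
      by (subst cmp_sum[THEN conjunct1]) simp_all
    also have "(\<Sum>k<n. cmp s s' s' (cmp s' (a k) s' (\<iota> k) (\<pi> k)) p) = cmp s s' s' (Id C s') p"
      unfolding f(6)[symmetric] by (rule sum_cmp[symmetric]) simp_all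
    finally show ?thesis by simp
  qed
  then have "(\<Sum>k<Suc n. cmp s (a k) s (\<iota>' k) (\<pi>' k)) = Id C s"
    using b by (simp add: biproduct_iff) (simp add: \<iota>'_def \<pi>'_def)
  with arrs orth show ?thesis
    unfolding finite_sum_iff using biproductD(7)[OF b] by blast
qed

text \<open>\<open>t\<close> is an arbitrary sum of the first \<open>n\<close> objects, with no
  given map to \<open>s\<close>. The inclusion and projection are assembled componentwise from
  \<open>\<iota> k \<beta> k\<close> and \<open>\<alpha> k \<pi> k\<close>.\<close>

lemma finite_sum_SucD:
  assumes "is_finite_sum C (Suc n) a s" "is_finite_sum C n a t"
  shows "is_sum C t (a n) s"
proof -
  from assms(1) obtain \<iota> \<pi> where f: "s \<in> Ob C" "\<And>i. i < Suc n \<Longrightarrow> a i \<in> Ob C"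
    "\<And>i. i < Suc n \<Longrightarrow> arr (\<iota> i) (a i) s" "\<And>i. i < Suc n \<Longrightarrow> arr (\<pi> i) s (a i)"
    "\<And>i j. i < Suc n \<Longrightarrow> j < Suc n \<Longrightarrow> cmp (a i) s (a j) (\<pi> j) (\<iota> i) = (if i = j then Id C (a i) else
        0)"
    "(\<Sum>i<Suc n. cmp s (a i) s (\<iota> i) (\<pi> i)) = Id C s"
    unfolding finite_sum_iff by blast
  from assms(2) obtain \<alpha> \<beta> where g: "t \<in> Ob C"
    "\<And>i. i < n \<Longrightarrow> arr (\<alpha> i) (a i) t" "\<And>i. i < n \<Longrightarrow> arr (\<beta> i) t (a i)"
    "\<And>i j. i < n \<Longrightarrow> j < n \<Longrightarrow> cmp (a i) t (a j) (\<beta> j) (\<alpha> i) = (if i = j then Id C (a i) else 0)"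
    "(\<Sum>i<n. cmp t (a i) t (\<alpha> i) (\<beta> i)) = Id C t"
    unfolding finite_sum_iff by blast
  note [simp] = f(1-5) g(1-4) cmp_simps
  define i where "i = (\<Sum>k<n. cmp t (a k) s (\<iota> k) (\<beta> k))"
  define p where "p = (\<Sum>k<n. cmp s (a k) t (\<alpha> k) (\<pi> k))"
  have ip [simp]: "arr i t s" "arr p s t"
    using cmp_sum[of "{..<n}" "\<lambda>k. cmp t (a k) s (\<iota> k) (\<beta> k)" t s "Id C s" s]
      cmp_sum[of "{..<n}" "\<lambda>k. cmp s (a k) t (\<alpha> k) (\<pi> k)" s t "Id C t" t]
    by (simp_all add: i_def p_def)
  have \<pi>i: "cmp t s (a k) (\<pi> k) i = (if k < n then \<beta> k else 0)" if "k < Suc n" for k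
  proof -
    have "cmp t s (a k) (\<pi> k) i = (\<Sum>l<n. cmp t s (a k) (\<pi> k) (cmp t (a l) s (\<iota> l) (\<beta> l)))"
      unfolding i_def using that by (subst cmp_sum[THEN conjunct1]) simp_all
    also have "\<dots> = (\<Sum>l<n. cmp t (a l) (a k) (cmp (a l) s (a k) (\<pi> k) (\<iota> l)) (\<beta> l))"
      by (rule sum.cong) (use that in \<open>simp_all del: f(5)\<close>)
    also have "\<dots> = (\<Sum>l<n. if l = k then \<beta> k else 0)"
      by (rule sum.cong) (use that in \<open>auto simp: zero_cmp\<close>)
    finally show ?thesis by simp
  qed
  have pn: "cmp (a n) s t p (\<iota> n) = 0"
  proof -
    have "cmp (a n) s t p (\<iota> n) = (\<Sum>l<n. cmp (a n) s t (cmp s (a l) t (\<alpha> l) (\<pi> l)) (\<iota> n))"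
      unfolding p_def by (subst sum_cmp) simp_all
    also have "\<dots> = (\<Sum>l<n. 0)"
      by (rule sum.cong) (simp_all)
    finally show ?thesis by simp
  qed
  have pi: "cmp t s t p i = Id C t"
  proof -
    have "cmp t s t p i = (\<Sum>l<n. cmp t s t (cmp s (a l) t (\<alpha> l) (\<pi> l)) i)"
      unfolding p_def by (subst sum_cmp) simp_all
    also have "\<dots> = (\<Sum>l<n. cmp t (a l) t (\<alpha> l) (\<beta> l))"
      by (rule sum.cong) (simp_all add: \<pi>i)
    finally show ?thesis using g(5) by simp
  qed
  have ip': "cmp s t s i p = (\<Sum>k<n. cmp s (a k) s (\<iota> k) (\<pi> k))"
  proof -
    have "cmp s t s i p = (\<Sum>k<n. cmp s t s i (cmp s (a k) t (\<alpha> k) (\<pi> k)))"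
      unfolding p_def by (subst cmp_sum[THEN conjunct1]) simp_all
    also have "\<dots> = (\<Sum>k<n. cmp s (a k) s (\<iota> k) (\<pi> k))"
    proof (rule sum.cong)
      fix k assume k: "k \<in> {..<n}"
      have "cmp (a k) t s i (\<alpha> k) = (\<Sum>l<n. cmp (a k) t s (cmp t (a l) s (\<iota> l) (\<beta> l)) (\<alpha> k))"
        unfolding i_def using k by (subst sum_cmp) simp_all
      also have "\<dots> = (\<Sum>l<n. if l = k then \<iota> k else 0)"
        by (rule sum.cong) (use k in \<open>auto simp: cmp_zero\<close>)
      finally have "cmp (a k) t s i (\<alpha> k) = \<iota> k" using k by simp
      then show "cmp s t s i (cmp s (a k) t (\<alpha> k) (\<pi> k)) = cmp s (a k) s (\<iota> k) (\<pi> k)"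
        using k cmp_assoc[of "\<pi> k" s "a k" "\<alpha> k" t i s] by simp
    qed simp
    finally show ?thesis .
  qed
  have "biproduct C t (a n) s i (\<iota> n) p (\<pi> n)"
    using pi pn \<pi>i[of n] f(6) by (simp add: biproduct_iff ip')
  then show ?thesis by (rule is_sumI)
qed

end

context additive_linear_category begin

lemma finite_sum_ex: "(\<And>i. i < n \<Longrightarrow> a i \<in> Ob C) \<Longrightarrow> \<exists>s. is_finite_sum C n a s"
proof (induction n)
  case 0
  obtain z where "zero_ob C z" using zero_ob_exists by blast
  then have "is_finite_sum C 0 a z" by (simp add: finite_sum_iff zero_ob_def)
  then show ?case by blast
next
  case (Suc n)
  then obtain s' where s': "is_finite_sum C n a s'" by auto
  then obtain s where "is_sum C s' (a n) s"
    using sum_exists[of s' "a n"] Suc.prems by (auto simp: is_finite_sum_def)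
  with s' show ?case using finite_sum_Suc by blast
qed

text \<open>The list is reversed because an indexed sum loses its last summand in the induction,
  whereas a list sum loses its head.\<close>

lemma finite_sum_iff_list_sum: "is_finite_sum C n a s \<longleftrightarrow> is_list_sum (map a (rev [0..<n])) s"
proof (induction n arbitrary: s)
  case 0
  then show ?case by (auto simp: finite_sum_iff zero_ob_def)
next
  case (Suc n)
  have "is_finite_sum C (Suc n) a s \<longleftrightarrow> (\<exists>t. is_finite_sum C n a t \<and> is_sum C t (a n) s)"
  proof
    assume s: "is_finite_sum C (Suc n) a s"
    then obtain t where "is_finite_sum C n a t"
      using finite_sum_ex[of n a] by (auto simp: is_finite_sum_def)
    with finite_sum_SucD[OF s] show "\<exists>t. is_finite_sum C n a t \<and> is_sum C t (a n) s" by blast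
  qed (auto intro: finite_sum_Suc)
  with Suc show ?case using is_sum_swap by auto
qed

lemma add_closure_iff:
  "x \<in> add_closure C t \<longleftrightarrow> (\<exists>n y s. is_list_sum (replicate n t) s \<and> is_sum C x y s)"
proof -
  have "map (\<lambda>_. t) (rev [0..<n]) = replicate n t" for n
    by (simp add: map_replicate_const)
  then show ?thesis unfolding add_closure_def finite_sum_iff_list_sum by simp
qed

lemma add_closure_ob: "x \<in> add_closure C t \<Longrightarrow> x \<in> Ob C"
  unfolding add_closure_iff using is_sum_obs by blast

lemma add_closure_zero:
  assumes "zero_ob C z" shows "z \<in> add_closure C t"
proof -
  have "is_list_sum (replicate 0 t) z" using assms by simp
  then show ?thesis unfolding add_closure_iff
    using is_sum_zero[of z z] assms by (metis zero_ob_def)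
qed

lemma add_closure_summand:
  assumes "is_sum C a b x" "x \<in> add_closure C t"
  shows "a \<in> add_closure C t"
proof -
  obtain n y s where s: "is_list_sum (replicate n t) s" "is_sum C x y s"
    using assms(2) unfolding add_closure_iff by blast
  obtain M where M: "is_sum C b y M" using sum_exists assms(1) s(2) is_sum_obs by meson
  show ?thesis unfolding add_closure_iff using is_sum_assoc'[OF s(2) assms(1) M] s(1) by blast
qed

text \<open>A complement of \<open>a\<close> in a power of \<open>t\<close> and a complement of
  \<open>b\<close> in another power add up to a complement of \<open>x\<close> in the sum of the two
  powers.\<close>

lemma add_closure_sum:
  assumes "is_sum C a b x" "a \<in> add_closure C t" "b \<in> add_closure C t"
  shows "x \<in> add_closure C t"
proof -
  obtain n y s where s: "is_list_sum (replicate n t) s" "is_sum C a y s"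
    using assms(2) unfolding add_closure_iff by blast
  obtain m z r where r: "is_list_sum (replicate m t) r" "is_sum C b z r"
    using assms(3) unfolding add_closure_iff by blast
  obtain S where S: "is_sum C s r S" using sum_exists s r is_sum_obs by meson
  obtain M where M: "is_sum C y r M" using sum_exists s r is_sum_obs by meson
  obtain N where N: "is_sum C z y N" using sum_exists s r is_sum_obs by meson
  have "is_sum C a M S" by (rule is_sum_assoc'[OF S s(2) M])
  moreover have "is_sum C b N M" by (rule is_sum_assoc'[OF is_sum_swap[OF M] r(2) N])
  ultimately have "is_sum C x N S" using assms(1) by (rule is_sum_assoc)
  moreover have "is_list_sum (replicate (n + m) t) S"
    unfolding replicate_add by (rule list_sum_append[OF s(1) r(1) S])
  ultimately show ?thesis unfolding add_closure_iff by blast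
qed

end

section \<open>Krull-Schmidt decompositions and multiplicities\<close>

locale krull_schmidt_category = additive_linear_category C
  for C :: "('k::field, 'o, 'm::ab_group_add, 'z) lin_cat_scheme" (structure) +
  assumes krull_schmidt: "krull_schmidt C"
begin

lemma local_decomposition:
  assumes "x \<in> Ob C" obtains xs where "is_list_sum xs x" "\<forall>a\<in>set xs. local_End C a"
proof -
  obtain n a where "is_finite_sum C n a x" "\<forall>i<n. local_End C (a i)"
    using krull_schmidt assms unfolding krull_schmidt_def by blast
  then show ?thesis using that[of "map a (rev [0..<n])"] finite_sum_iff_list_sum by auto
qed

text \<open>The complement of a retract is the image of the idempotent \<open>1 - k l\<close>, which
  exists because \<open>x\<close> is a sum of objects with local endomorphism ring.\<close>

lemma split_complement:
  assumes "arr k a x" "arr l x a" "cmp a x a l k = Id C a"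
  shows "\<exists>y k' l'. biproduct C a y x k k' l l'"
proof -
  note [simp] = assms cmp_simps
  have obs [simp]: "a \<in> Ob C" "x \<in> Ob C" using assms(1) by (simp_all add: arr_def)
  have [simp]: "cmp w x a l (cmp w a x k h) = h" if "arr h w a" for h w
    using cmp_assoc[of h w a k x l a] that by simp
  obtain xs where xs: "is_list_sum xs x" "\<forall>a\<in>set xs. local_End C a" using local_decomposition obs(2)
      .
  have "\<exists>y z i j p q. biproduct C y z x i j p q \<and> cmp x y x i p = Id C x - cmp x a x k l"
    by (rule list_sum_idempotent_split[OF xs]) simp_all
  then obtain y z i j p q where
    b: "biproduct C y z x i j p q" "cmp x y x i p = Id C x - cmp x a x k l" by blast
  note [simp] = biproductD[OF b(1)]
  have 1: "cmp y x a l i = 0"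
  proof -
    have "cmp y x a l (cmp y x x (cmp x y x i p) i) = 0" unfolding b(2) by simp
    then show ?thesis by simp
  qed
  have 2: "cmp a x y p k = 0"
  proof -
    have "cmp a x y p (cmp a x x (cmp x y x i p) k) = 0" unfolding b(2) by simp
    then show ?thesis by simp
  qed
  have "biproduct C a y x k i l p"
    using 1 2 b(2) by (simp add: biproduct_iff)
  then show ?thesis by blast
qed

definition iso_count :: "'o \<Rightarrow> 'o list \<Rightarrow> nat" where
  "iso_count u xs = length (filter (isomorphic_ob C u) xs)"

lemma iso_count_simps [simp]: "iso_count u [] = 0"
  "iso_count u (a # xs) = (if isomorphic_ob C u a then 1 else 0) + iso_count u xs"
  "iso_count u (xs @ ys) = iso_count u xs + iso_count u ys"
  by (simp_all add: iso_count_def)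

lemma isomorphic_cong:
  "u \<in> Ob C \<Longrightarrow> a \<in> Ob C \<Longrightarrow> b \<in> Ob C \<Longrightarrow> isomorphic_ob C a b \<Longrightarrow>
    isomorphic_ob C u a \<longleftrightarrow> isomorphic_ob C u b"
  using iso_trans iso_sym by blast

text \<open>The exchange step of the Krull-Schmidt theorem. The identity of \<open>a\<close> is the
  sum of its components through the head \<open>b\<close> and through the rest \<open>r\<close>, so
  one component is invertible. Through \<open>b\<close>, locality gives \<open>a \<cong> b\<close>
  and the complements agree. Through \<open>r\<close>, the object \<open>a\<close> splits off
  \<open>r\<close>, the induction replaces a summand there, and \<open>b\<close> is put
  back.\<close>

lemma local_exchange:
  assumes "local_End C a" "biproduct C a s' s i i' p p'" "is_list_sum ys s" "\<forall>b\<in>set ys. local_End C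
      b"
  shows "\<exists>ys'. set ys' \<subseteq> set ys \<and> is_list_sum ys' s' \<and> (\<forall>u\<in>Ob C. iso_count u ys = iso_count u (a #
      ys'))"
  using assms(2-)
proof (induction ys arbitrary: s s' i i' p p')
  case Nil
  then have "zero_ob C a" using is_sum_zero_zero is_sumI by (metis is_list_sum.simps(1))
  with local_not_zero assms(1) show ?case by blast
next
  case (Cons b ys)
  then obtain r where r: "is_list_sum ys r" "is_sum C b r s" by auto
  then obtain \<iota> \<iota>' \<pi> \<pi>' where c: "biproduct C b r s \<iota> \<iota>' \<pi> \<pi>'" by (elim is_sumE)
  note e = Cons.prems(1)
  note [simp] = biproductD[OF e] biproductD[OF c] cmp_simps
  have "cmp a s a p (cmp a b s \<iota> (cmp a s b \<pi> i)) + cmp a s a p (cmp a r s \<iota>' (cmp a s r \<pi>' i)) = Id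
      C a"
    using arg_cong[OF biproduct_expand(1)[OF c biproductD(1)[OF e]], of "\<lambda>k. cmp a s a p k"] by simp
  from local_sum_unit[OF assms(1) _ _ _ this]
  consider v where "arr v a a" "cmp a a a v (cmp a s a p (cmp a b s \<iota> (cmp a s b \<pi> i))) = Id C a"
    | v where "arr v a a" "cmp a a a v (cmp a s a p (cmp a r s \<iota>' (cmp a s r \<pi>' i))) = Id C a"
      "cmp a a a (cmp a s a p (cmp a r s \<iota>' (cmp a s r \<pi>' i))) v = Id C a" by auto
  then show ?case
  proof cases
    case (1 v)
    let ?l = "cmp b a a v (cmp b s a p \<iota>)"
    have l: "arr ?l b a" "cmp a b a ?l (cmp a s b \<pi> i) = Id C a" using 1 by simp_all
    moreover have "cmp b a b (cmp a s b \<pi> i) ?l = Id C b"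
      by (rule local_retract) (use Cons.prems(3) local_not_zero assms(1) l in simp_all)
    ultimately have "isomorphic_ob C s' r" "isomorphic_ob C a b"
      by (auto intro: complement_iso[OF e c] isoI[of "cmp a s b \<pi> i" _ _ ?l])
    then have "is_list_sum ys s'" "\<forall>u\<in>Ob C. isomorphic_ob C u a \<longleftrightarrow> isomorphic_ob C u b"
      using list_sum_iso[OF r(1) _ iso_sym] isomorphic_cong[of _ a b] by simp_all
    then show ?thesis by (intro exI[of _ ys]) auto
  next
    case (2 v)
    let ?k = "cmp a s r \<pi>' i" and ?l = "cmp r a a v (cmp r s a p \<iota>')"
    have "arr ?k a r" "arr ?l r a" "cmp a r a ?l ?k = Id C a" using 2 by simp_all
    then obtain r' k' l' where d: "biproduct C a r' r ?k k' ?l l'" using split_complement by blast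
    from Cons.IH[OF d r(1)] Cons.prems(3) obtain ys' where
      ys': "set ys' \<subseteq> set ys" "is_list_sum ys' r'" "\<forall>u\<in>Ob C. iso_count u ys = iso_count u (a # ys')"
          by auto
    obtain M \<alpha>1 \<alpha>2 \<beta>1 \<beta>2 where M: "biproduct C b r' M \<alpha>1 \<alpha>2 \<beta>1 \<beta>2"
      using sum_ex[of b r'] biproductD(6)[OF d] by auto
    from biproduct_swap[OF biproduct_assoc[OF c biproduct_swap[OF d] M]]
    obtain f h where f: "biproduct C a M s (cmp a r s \<iota>' ?k) f (cmp s r a ?l \<pi>') h" by blast
    have "isomorphic_ob C M s'"
      by (rule complement_iso[OF f e 2(1)]) (use 2 in simp_all)
    then have "is_list_sum (b # ys') s'"
      using ys'(2) is_sumI[OF M] is_sum_iso by auto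
    then show ?thesis using ys' by (intro exI[of _ "b # ys'"]) auto
  qed
qed

lemma iso_count_unique:
  assumes "is_list_sum xs s" "is_list_sum ys s" "\<forall>a\<in>set xs. local_End C a" "\<forall>a\<in>set ys. local_End C
      a" "u \<in> Ob C"
  shows "iso_count u xs = iso_count u ys"
  using assms
proof (induction xs arbitrary: s ys)
  case Nil
  show ?case
  proof (cases ys)
    case (Cons b zs)
    then have "zero_ob C b" using Nil is_sum_zero_zero by auto
    with Cons Nil local_not_zero show ?thesis by auto
  qed simp
next
  case (Cons a xs)
  then obtain s' i i' p p' where s': "is_list_sum xs s'" "biproduct C a s' s i i' p p'"
    by (auto elim: is_sumE)
  with local_exchange[OF _ s'(2) Cons.prems(2,4)] Cons.prems(3) obtain ys' where
    "set ys' \<subseteq> set ys" "is_list_sum ys' s'" "\<forall>u\<in>Ob C. iso_count u ys = iso_count u (a # ys')" by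
        auto
  with Cons.IH[OF s'(1), of ys'] Cons.prems show ?case by auto
qed

text \<open>The choice of a decomposition is immaterial by \<open>iso_count_unique\<close>.\<close>

definition summand_mult :: "'o \<Rightarrow> 'o \<Rightarrow> nat" where
  "summand_mult u x = iso_count u (SOME xs. is_list_sum xs x \<and> (\<forall>a\<in>set xs. local_End C a))"

lemma summand_mult_eq:
  assumes "is_list_sum xs x" "\<forall>a\<in>set xs. local_End C a" "u \<in> Ob C"
  shows "summand_mult u x = iso_count u xs"
proof -
  have "is_list_sum (SOME xs. is_list_sum xs x \<and> (\<forall>a\<in>set xs. local_End C a)) x \<and>
    (\<forall>a\<in>set (SOME xs. is_list_sum xs x \<and> (\<forall>a\<in>set xs. local_End C a)). local_End C a)"
    by (rule someI[of _ xs]) (use assms in simp)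
  then show ?thesis unfolding summand_mult_def using iso_count_unique assms by blast
qed

lemma summand_mult_sum:
  assumes "is_sum C a b s" "u \<in> Ob C"
  shows "summand_mult u s = summand_mult u a + summand_mult u b"
proof -
  obtain xs where xs: "is_list_sum xs a" "\<forall>a\<in>set xs. local_End C a"
    using local_decomposition[of a] is_sum_obs[OF assms(1)] by blast
  obtain ys where ys: "is_list_sum ys b" "\<forall>a\<in>set ys. local_End C a"
    using local_decomposition[of b] is_sum_obs[OF assms(1)] by blast
  have "summand_mult u s = iso_count u (xs @ ys)"
    by (rule summand_mult_eq[OF list_sum_append[OF xs(1) ys(1) assms(1)]]) (use xs ys assms in auto)
  then show ?thesis using summand_mult_eq xs ys assms(2) by simp
qed

text \<open>In a decomposition of \<open>v\<close> into local summands, the first one is nonzero, so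
  indecomposability makes its complement zero.\<close>

lemma indecomposable_local:
  assumes "indecomposable C v"
  obtains a where "a \<in> Ob C" "local_End C a" "isomorphic_ob C a v"
proof -
  obtain xs where xs: "is_list_sum xs v" "\<forall>a\<in>set xs. local_End C a"
    using local_decomposition assms unfolding indecomposable_def by blast
  show ?thesis
  proof (cases xs)
    case Nil
    then show ?thesis using xs assms by (auto simp: indecomposable_def)
  next
    case (Cons a ys)
    then obtain s where "is_sum C a s v" using xs by auto
    moreover from this have "zero_ob C s"
      using assms local_not_zero xs(2) Cons by (auto simp: indecomposable_def)
    ultimately show ?thesis using that[of a] is_sum_zeroD is_sum_obs xs(2) Cons by auto
  qed
qed

text \<open>This identifies the multiplicity of \<open>u\<close> with the dual basis functional on
  indecomposables.\<close>

lemma summand_mult_indecomposable: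
  assumes "indecomposable C v" "u \<in> Ob C"
  shows "int (summand_mult u v) = kronecker C u v"
proof -
  obtain a where a: "a \<in> Ob C" "local_End C a" "isomorphic_ob C a v"
    using indecomposable_local assms(1) .
  have v: "v \<in> Ob C" using assms(1) by (simp add: indecomposable_def)
  obtain z where z: "zero_ob C z" using zero_ob_exists by blast
  have "is_list_sum [a] v" using is_sum_iso[OF is_sum_zero[OF a(1) z] v a(3)] z by auto
  then have "summand_mult u v = iso_count u [a]" by (rule summand_mult_eq) (use a(2) assms(2) in
      simp_all)
  then show ?thesis using isomorphic_cong[OF assms(2) a(1) v a(3)] by (simp add: kronecker_def)
qed

lemma Indec_decomposition:
  assumes "x \<in> add_closure C t"
  obtains xs where "is_list_sum xs x" "set xs \<subseteq> Indec C (add_closure C t)"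
proof -
  obtain xs where xs: "is_list_sum xs x" "\<forall>a\<in>set xs. local_End C a"
    using local_decomposition add_closure_ob assms by blast
  have "a \<in> Indec C (add_closure C t)" if a: "a \<in> set xs" for a
  proof -
    obtain y where "is_sum C a y x" using list_sum_summand[OF xs(1) a] by blast
    then show ?thesis using add_closure_summand assms local_indecomposable xs(2) a is_sum_obs
      unfolding Indec_def by blast
  qed
  then show ?thesis using that xs(1) by blast
qed

end

section \<open>Angles\<close>

context angulated_category begin

abbreviation S where "S \<equiv> shift C"
abbreviation Sm where "Sm \<equiv> shift_mor C"

lemma shift_functor: "additive_functor C S Sm"
  using shift_automorphism unfolding automorphism_def by blast

lemma shift_ob: "x \<in> Ob C \<Longrightarrow> S x \<in> Ob C"
  and shift_Id: "x \<in> Ob C \<Longrightarrow> Sm (Id C x) = Id C (S x)"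
  and shift_arr: "arr f x y \<Longrightarrow> arr (Sm f) (S x) (S y)"
  and shift_add: "arr f x y \<Longrightarrow> arr g x y \<Longrightarrow> Sm (f + g) = Sm f + Sm g"
  and shift_cmp: "arr f x y \<Longrightarrow> arr g y z \<Longrightarrow>
    Sm (cmp x y z g f) = cmp (S x) (S y) (S z) (Sm g) (Sm f)"
  using shift_functor unfolding additive_functor_def arr_def cmp_def by blast+

lemma shift_zero: "x \<in> Ob C \<Longrightarrow> y \<in> Ob C \<Longrightarrow> Sm 0 = 0"
  using shift_add[of 0 x y 0] zero_arr by simp

lemma shift_inj:
  assumes "arr f x y" "arr g x y" "Sm f = Sm g" shows "f = g"
proof -
  have "inj_on Sm (Hom C x y)"
    using shift_automorphism assms(1) unfolding automorphism_def bij_betw_def arr_def by blast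
  from inj_onD[OF this assms(3)] show ?thesis using assms(1,2) by (simp add: arr_def)
qed

lemma shift_full:
  assumes "x \<in> Ob C" "y \<in> Ob C" "arr f (S x) (S y)"
  obtains g where "arr g x y" "Sm g = f"
proof -
  have "bij_betw Sm (Hom C x y) (Hom C (S x) (S y))"
    using shift_automorphism assms(1,2) by (simp add: automorphism_def)
  then have "f \<in> Sm ` Hom C x y" using assms(3) by (simp add: arr_def bij_betw_def)
  then obtain g where "f = Sm g" "g \<in> Hom C x y" by (rule imageE)
  then show ?thesis using that[of g] assms(1,2) by (simp add: arr_def)
qed

lemma shift_bij: "bij_betw S (Ob C) (Ob C)"
  using shift_automorphism by (simp add: automorphism_def)

lemma shift_ob_inj: "x \<in> Ob C \<Longrightarrow> y \<in> Ob C \<Longrightarrow> S x = S y \<Longrightarrow> x = y"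
  using shift_bij by (simp add: bij_betw_def inj_on_def)

lemma shift_ob_surj:
  assumes "y \<in> Ob C" obtains x where "x \<in> Ob C" "S x = y"
proof -
  have "y \<in> S ` Ob C" using shift_bij assms by (simp add: bij_betw_def)
  then show ?thesis using that by auto
qed

lemma shift_biproduct:
  assumes "biproduct C a b s i j p q"
  shows "biproduct C (S a) (S b) (S s) (Sm i) (Sm j) (Sm p) (Sm q)"
proof -
  note [simp] = biproductD[OF assms] shift_arr cmp_simps
  have sum: "cmp s a s i p + cmp s b s j q = Id C s" using assms by (simp add: biproduct_iff)
  have "cmp (S s) (S a) (S s) (Sm i) (Sm p) + cmp (S s) (S b) (S s) (Sm j) (Sm q) = Id C (S s)"
    using arg_cong[OF sum, of Sm] by (simp add: shift_add[of _ s s] shift_cmp[symmetric] shift_Id)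
  then show ?thesis
    using shift_cmp[of i a s p a] shift_cmp[of j b s q b] shift_cmp[of j b s p a] shift_cmp[of i a s
        q b]
      shift_zero[of a b]
    by (simp add: biproduct_iff shift_Id)
qed

lemma shift_is_sum: "is_sum C a b s \<Longrightarrow> is_sum C (S a) (S b) (S s)"
  by (elim is_sumE, rule is_sumI, rule shift_biproduct)

lemma shift_zero_ob: "zero_ob C z \<Longrightarrow> zero_ob C (S z)"
  unfolding zero_ob_def using shift_ob shift_Id shift_zero by metis

text \<open>The scalar of the rotation axiom acts only through the parity of \<open>d\<close>; as a
  sign it needs only the rules for negation.\<close>

definition sg :: "'m \<Rightarrow> 'm" where "sg f = (if even d then f else - f)"

lemma sg_scale: "Scale C ((-1) ^ d) f = sg f"
  by (simp add: sg_def)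

lemma sg_simps: "sg (sg f) = f" "sg 0 = 0" "arr f x y \<Longrightarrow> arr (sg f) x y"
  "arr f x y \<Longrightarrow> arr g y z \<Longrightarrow> cmp x y z (sg g) f = sg (cmp x y z g f)"
  "arr f x y \<Longrightarrow> arr g y z \<Longrightarrow> cmp x y z g (sg f) = sg (cmp x y z g f)"
  "sg f = sg g \<longleftrightarrow> f = g"
  by (simp_all add: sg_def cmp_simps)

lemma is_seq_iff:
  "is_seq d C c \<gamma> \<longleftrightarrow> (\<forall>i\<le>Suc d. c i \<in> Ob C) \<and> (\<forall>i\<le>d. arr (\<gamma> i) (c i) (c (Suc i))) \<and>
    arr (\<gamma> (Suc d)) (c (Suc d)) (S (c 0))"
proof -
  have "(\<forall>i\<le>Suc d. P i) \<longleftrightarrow> (\<forall>i\<le>d. P i) \<and> P (Suc d)" for P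
    using le_Suc_eq by auto
  from this[of "\<lambda>i. \<gamma> i \<in> Hom C (c i) (ext_ob d C c (Suc i))"] show ?thesis
    unfolding is_seq_def by (auto simp: ext_ob_def arr_def shift_ob)
qed

lemma AngleD:
  assumes "Angle C c \<gamma>"
  shows "i \<le> Suc d \<Longrightarrow> c i \<in> Ob C" "i \<le> d \<Longrightarrow> arr (\<gamma> i) (c i) (c (Suc i))"
    "arr (\<gamma> (Suc d)) (c (Suc d)) (S (c 0))"
  using Angle_is_seq[OF assms] unfolding is_seq_iff by auto

lemma seq_sumI:
  assumes "\<And>i. i \<le> Suc d \<Longrightarrow> biproduct C (b i) (c i) (s i) (\<iota> i) (\<iota>' i) (\<pi> i) (\<pi>' i)"
    and "\<And>i. i \<le> d \<Longrightarrow> \<sigma> i =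
      cmp (s i) (b i) (s (Suc i)) (cmp (b i) (b (Suc i)) (s (Suc i)) (\<iota> (Suc i)) (\<beta> i)) (\<pi> i) +
      cmp (s i) (c i) (s (Suc i)) (cmp (c i) (c (Suc i)) (s (Suc i)) (\<iota>' (Suc i)) (\<gamma> i)) (\<pi>' i)"
    and "\<sigma> (Suc d) =
      cmp (s (Suc d)) (b (Suc d)) (S (s 0))
        (cmp (b (Suc d)) (S (b 0)) (S (s 0)) (Sm (\<iota> 0)) (\<beta> (Suc d))) (\<pi> (Suc d)) +
      cmp (s (Suc d)) (c (Suc d)) (S (s 0))
        (cmp (c (Suc d)) (S (c 0)) (S (s 0)) (Sm (\<iota>' 0)) (\<gamma> (Suc d))) (\<pi>' (Suc d))"
  shows "seq_sum d C b \<beta> c \<gamma> s \<sigma>"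
  using assms unfolding seq_sum_def ext_mor_def cmp_def
  by (intro exI[of _ \<iota>] exI[of _ \<iota>'] exI[of _ \<pi>] exI[of _ \<pi>']) (auto simp: le_Suc_eq)

text \<open>\<open>Angle\<close> is a predicate on total functions, so even changing values beyond
  \<open>d + 1\<close> has to be justified. The changed sequence is a summand of the given one with
  the zero sequence as complement.\<close>

lemma Angle_cong:
  assumes A: "Angle C c \<gamma>" and eq: "\<And>i. i \<le> Suc d \<Longrightarrow> c' i = c i" "\<And>i. i \<le> Suc d \<Longrightarrow> \<gamma>' i = \<gamma> i"
  shows "Angle C c' \<gamma>'"
proof -
  note [simp] = AngleD[OF A] cmp_simps shift_ob shift_Id
  obtain z where z: "zero_ob C z" using zero_ob_exists by blast
  then have [simp]: "z \<in> Ob C" by (simp add: zero_ob_def)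
  have "seq_sum d C c' \<gamma>' (\<lambda>_. z) (\<lambda>_. 0) c \<gamma>"
    by (rule seq_sumI[where \<iota>="\<lambda>i. Id C (c i)" and \<pi>="\<lambda>i. Id C (c i)" and \<iota>'="\<lambda>_. 0" and \<pi>'="\<lambda>_.
        0"])
      (simp_all add: eq biproduct_zero z shift_zero[of z "c 0"])
  moreover have "is_seq d C c' \<gamma>'" "is_seq d C (\<lambda>_. z) (\<lambda>_. 0)"
    by (simp_all add: is_seq_iff eq)
  ultimately show ?thesis using N1_summand A by blast
qed

lemma Angle_rotate:
  assumes A: "Angle C c \<gamma>"
  obtains c' \<gamma>' where "Angle C c' \<gamma>'" "\<And>i. i \<le> d \<Longrightarrow> c' i = c (Suc i)" "c' (Suc d) = S (c 0)"
    "\<And>i. i \<le> d \<Longrightarrow> \<gamma>' i = \<gamma> (Suc i)" "\<gamma>' (Suc d) = sg (Sm (\<gamma> 0))"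
proof
  show "Angle C (rot_ob d C c) (rot_mor d C \<gamma>)" using N2 Angle_is_seq A by blast
qed (simp_all add: rot_ob_def rot_mor_def sg_scale)

text \<open>Surjectivity of the automorphism on objects provides the new first term and its fullness
  the new first morphism. That morphism lifts the signed connecting morphism, so that the sign of
  the rotation cancels it.\<close>

lemma Angle_rotate_back:
  assumes A: "Angle C c \<gamma>"
  obtains c' \<gamma>' where "Angle C c' \<gamma>'" "S (c' 0) = c (Suc d)" "\<And>i. i \<le> d \<Longrightarrow> c' (Suc i) = c i"
    "sg (Sm (\<gamma>' 0)) = \<gamma> (Suc d)" "\<And>i. i \<le> d \<Longrightarrow> \<gamma>' (Suc i) = \<gamma> i"
proof -
  note [simp] = AngleD[OF A]
  obtain y where y: "y \<in> Ob C" "S y = c (Suc d)" using shift_ob_surj[of "c (Suc d)"] by auto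
  have "arr (sg (\<gamma> (Suc d))) (S y) (S (c 0))" using y by (simp add: sg_simps)
  then obtain g where g: "arr g y (c 0)" "Sm g = sg (\<gamma> (Suc d))"
    using y shift_full[of y "c 0"] by auto
  define c' \<gamma>' where "c' = case_nat y c" and "\<gamma>' = case_nat g \<gamma>"
  have "c' i \<in> Ob C" if "i \<le> Suc d" for i
    using that y by (cases i) (simp_all add: c'_def)
  moreover have "arr (\<gamma>' i) (c' i) (c' (Suc i))" if "i \<le> d" for i
    using that y g by (cases i) (simp_all add: c'_def \<gamma>'_def)
  moreover have "arr (\<gamma>' (Suc d)) (c' (Suc d)) (S (c' 0))"
    using y by (simp add: c'_def \<gamma>'_def)
  ultimately have seq: "is_seq d C c' \<gamma>'" by (simp add: is_seq_iff)
  have "Angle C (rot_ob d C c') (rot_mor d C \<gamma>')"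
    by (rule Angle_cong[OF A])
      (auto simp: rot_ob_def rot_mor_def sg_scale c'_def \<gamma>'_def y g sg_simps le_Suc_eq)
  then have "Angle C c' \<gamma>'" using N2 seq by blast
  then show ?thesis
    by (rule that) (simp_all add: c'_def \<gamma>'_def y g sg_simps)
qed

lemma Angle_morphism:
  assumes "Angle C b \<beta>" "Angle C c \<gamma>" "arr f (b 0) (c 0)" "arr g (b (Suc 0)) (c (Suc 0))"
    "cmp (b 0) (b (Suc 0)) (c (Suc 0)) g (\<beta> 0) = cmp (b 0) (c 0) (c (Suc 0)) (\<gamma> 0) f"
  obtains \<phi> where "\<phi> 0 = f" "\<phi> (Suc 0) = g" "\<And>i. i \<le> Suc d \<Longrightarrow> arr (\<phi> i) (b i) (c i)"
    "\<And>i. i \<le> d \<Longrightarrow> cmp (b i) (b (Suc i)) (c (Suc i)) (\<phi> (Suc i)) (\<beta> i) =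
      cmp (b i) (c i) (c (Suc i)) (\<gamma> i) (\<phi> i)"
    "cmp (b (Suc d)) (S (b 0)) (S (c 0)) (Sm f) (\<beta> (Suc d)) =
      cmp (b (Suc d)) (c (Suc d)) (S (c 0)) (\<gamma> (Suc d)) (\<phi> (Suc d))"
proof -
  obtain \<phi> where \<phi>: "\<phi> 0 = f" "\<phi> 1 = g" "seq_mor d C b \<beta> c \<gamma> \<phi>"
    using N3[OF assms(1,2), of f g] assms(3-5) by (auto simp: arr_def cmp_def)
  have arr: "arr (\<phi> i) (b i) (c i)" if "i \<le> Suc d" for i
    using \<phi>(3) AngleD(1)[OF assms(1) that] AngleD(1)[OF assms(2) that] that
    by (auto simp: seq_mor_def arr_def)
  have comm: "ext_mor d C \<phi> (Suc i) \<cdot> \<beta> i = \<gamma> i \<cdot> \<phi> i" if "i \<le> Suc d" for i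
    using \<phi>(3) that by (simp add: seq_mor_def)
  show ?thesis
  proof (rule that)
    show "\<phi> 0 = f" "\<phi> (Suc 0) = g" using \<phi> by simp_all
    show "cmp (b i) (b (Suc i)) (c (Suc i)) (\<phi> (Suc i)) (\<beta> i) =
      cmp (b i) (c i) (c (Suc i)) (\<gamma> i) (\<phi> i)" if "i \<le> d" for i
      using comm[of i] that by (simp add: ext_mor_def cmp_def)
    show "cmp (b (Suc d)) (S (b 0)) (S (c 0)) (Sm f) (\<beta> (Suc d)) =
      cmp (b (Suc d)) (c (Suc d)) (S (c 0)) (\<gamma> (Suc d)) (\<phi> (Suc d))"
      using comm[of "Suc d"] \<phi>(1) by (simp add: ext_mor_def cmp_def)
  qed (rule arr)
qed

text \<open>Left rotation lowers the position of the identity until the trivial angle is reached.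
  Since \<open>j \<le> d\<close>, the identity never passes the end of the sequence and acquires no
  sign.\<close>

lemma two_term_Angle:
  assumes "y \<in> Ob C" "j \<le> d" "c j = y" "c (Suc j) = y" "\<gamma> j = Id C y"
    "\<And>i. i \<le> Suc d \<Longrightarrow> i \<noteq> j \<Longrightarrow> i \<noteq> Suc j \<Longrightarrow> zero_ob C (c i)"
    "\<And>i. i \<le> Suc d \<Longrightarrow> i \<noteq> j \<Longrightarrow> \<gamma> i = 0"
  shows "Angle C c \<gamma>"
  using assms(2-)
proof (induction j arbitrary: c \<gamma>)
  case 0
  then have "trivial_seq d C y c \<gamma>" using assms(1) by (auto simp: trivial_seq_def)
  then show ?case by (rule N1_trivial)
next
  case (Suc j)
  have ob: "c i \<in> Ob C" if "i \<le> Suc d" for i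
    using Suc.prems(5)[OF that] Suc.prems(2,3) assms(1)
    by (cases "i = Suc j \<or> i = Suc (Suc j)") (auto simp: zero_ob_def)
  have "arr (\<gamma> i) (c i) (c (Suc i))" if "i \<le> d" for i
    using that Suc.prems assms(1) ob by (cases "i = Suc j") (simp_all add: Id_arr zero_arr)
  moreover have "arr (\<gamma> (Suc d)) (c (Suc d)) (S (c 0))"
    using Suc.prems(1) Suc.prems(6)[of "Suc d"] ob shift_ob by (simp add: zero_arr)
  ultimately have seq: "is_seq d C c \<gamma>" using ob by (simp add: is_seq_iff)
  have "Angle C (rot_ob d C c) (rot_mor d C \<gamma>)"
    by (rule Suc.IH) (use Suc.prems ob shift_zero_ob[OF Suc.prems(5)[of 0]] shift_zero[of "c 0" "c
        0"]
      in \<open>auto simp: rot_ob_def rot_mor_def sg_scale sg_simps\<close>)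
  then show ?case using N2 seq by blast
qed

section \<open>Weak kernels and cokernels\<close>

text \<open>The pair \<open>(Id, \<gamma> 0)\<close> extends to a morphism from the trivial angle on
  \<open>c 0\<close>. Its component in degree two starts at a zero object, and commutativity in
  degree one gives \<open>\<gamma> 1 \<gamma> 0 = 0\<close>; the other positions follow by
  rotation.\<close>

lemma Angle_comp_zero:
  assumes "Angle C c \<gamma>" "i < d"
  shows "cmp (c i) (c (Suc i)) (c (Suc (Suc i))) (\<gamma> (Suc i)) (\<gamma> i) = 0"
  using assms
proof (induction i arbitrary: c \<gamma>)
  case 0
  note [simp] = AngleD[OF 0(1)] cmp_simps
  obtain z where z: "zero_ob C z" using zero_ob_exists by blast
  define t where "t i = (if i \<le> Suc 0 then c 0 else z)" for i :: nat
  define \<tau> where "\<tau> i = (if i = 0 then Id C (c 0) else 0)" for i :: nat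
  have T: "Angle C t \<tau>"
    by (rule two_term_Angle[of "c 0" 0]) (auto simp: t_def \<tau>_def z)
  obtain \<phi> where \<phi>: "\<phi> (Suc 0) = \<gamma> 0" "\<And>i. i \<le> Suc d \<Longrightarrow> arr (\<phi> i) (t i) (c i)"
    "\<And>i. i \<le> d \<Longrightarrow> cmp (t i) (t (Suc i)) (c (Suc i)) (\<phi> (Suc i)) (\<tau> i) =
      cmp (t i) (c i) (c (Suc i)) (\<gamma> i) (\<phi> i)"
    by (rule Angle_morphism[OF T 0(1), of "Id C (c 0)" "\<gamma> 0"]) (auto simp: t_def \<tau>_def)
  have "\<phi> (Suc (Suc 0)) = 0" 
    using zero_ob_arr(1)[OF z] \<phi>(2)[of "Suc (Suc 0)"] 0(2) by (auto simp: t_def)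
  then show ?case using \<phi>(1) \<phi>(3)[of "Suc 0"] 0(2) z by (simp add: t_def \<tau>_def zero_ob_def)
next
  case (Suc i)
  obtain c' \<gamma>' where A: "Angle C c' \<gamma>'" "\<And>i. i \<le> d \<Longrightarrow> c' i = c (Suc i)"
    "\<And>i. i \<le> d \<Longrightarrow> \<gamma>' i = \<gamma> (Suc i)" using Angle_rotate[OF Suc.prems(1)] by metis
  show ?case using Suc.IH[OF A(1)] Suc.prems(2) A(2,3) by simp
qed

lemma Angle_comp_zero_last:
  assumes A: "Angle C c \<gamma>"
  shows "cmp (c d) (c (Suc d)) (S (c 0)) (\<gamma> (Suc d)) (\<gamma> d) = 0"
    and "cmp (c (Suc d)) (S (c 0)) (S (c (Suc 0))) (Sm (\<gamma> 0)) (\<gamma> (Suc d)) = 0"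
proof -
  note [simp] = AngleD[OF A] shift_arr
  obtain d' where d': "d = Suc d'" using d_pos by (cases d) auto
  have *: "cmp (c d) (c (Suc d)) (S (c 0)) (\<gamma> (Suc d)) (\<gamma> d) = 0" if A: "Angle C c \<gamma>" for c \<gamma>
  proof -
    obtain c' \<gamma>' where r: "Angle C c' \<gamma>'" "\<And>i. i \<le> d \<Longrightarrow> c' i = c (Suc i)" "c' (Suc d) = S (c 0)"
      "\<And>i. i \<le> d \<Longrightarrow> \<gamma>' i = \<gamma> (Suc i)" using Angle_rotate[OF A] by metis
    show ?thesis
      using Angle_comp_zero[OF r(1), of d'] r(2)[of d] r(2)[of d'] r(3) r(4)[of d] r(4)[of d'] by
          (simp add: d')
  qed
  from *[OF A] show "cmp (c d) (c (Suc d)) (S (c 0)) (\<gamma> (Suc d)) (\<gamma> d) = 0" .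
  obtain c' \<gamma>' where r: "Angle C c' \<gamma>'" "\<And>i. i \<le> d \<Longrightarrow> c' i = c (Suc i)" "c' (Suc d) = S (c 0)"
    "\<And>i. i \<le> d \<Longrightarrow> \<gamma>' i = \<gamma> (Suc i)" "\<gamma>' (Suc d) = sg (Sm (\<gamma> 0))" using Angle_rotate[OF A] by metis
  have "sg (cmp (c (Suc d)) (S (c 0)) (S (c (Suc 0))) (Sm (\<gamma> 0)) (\<gamma> (Suc d))) = 0"
    using *[OF r(1)] r(2)[of d] r(2)[of 0] r(3,5) r(4)[of d] sg_simps(4)[of "\<gamma> (Suc d)" "c (Suc d)"
        "S (c 0)"]
    by simp
  then show "cmp (c (Suc d)) (S (c 0)) (S (c (Suc 0))) (Sm (\<gamma> 0)) (\<gamma> (Suc d)) = 0"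
    by (metis sg_simps(1,2))
qed

text \<open>\<open>(0, f)\<close> extends to a morphism into the angle with the identity of
  \<open>y\<close> in degrees one and two; its component in degree two is the factorization.\<close>

lemma weak_cokernel_1:
  assumes A: "Angle C c \<gamma>" and f: "arr f (c (Suc 0)) y" "cmp (c 0) (c (Suc 0)) y f (\<gamma> 0) = 0"
  obtains r where "arr r (c (Suc (Suc 0))) y" "cmp (c (Suc 0)) (c (Suc (Suc 0))) y r (\<gamma> (Suc 0)) =
      f"
proof -
  note [simp] = AngleD[OF A] cmp_simps f
  have y [simp]: "y \<in> Ob C" using f(1) by (simp add: arr_def)
  have d: "Suc 0 \<le> d" using d_pos by simp
  obtain z where z: "zero_ob C z" using zero_ob_exists by blast
  then have [simp]: "z \<in> Ob C" by (simp add: zero_ob_def)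
  define t where "t i = (if i = Suc 0 \<or> i = Suc (Suc 0) then y else z)" for i :: nat
  define \<tau> where "\<tau> i = (if i = Suc 0 then Id C y else 0)" for i :: nat
  have T: "Angle C t \<tau>"
    by (rule two_term_Angle[of y "Suc 0"]) (use d in \<open>auto simp: t_def \<tau>_def z\<close>)
  obtain \<phi> where \<phi>: "\<phi> (Suc 0) = f" "\<And>i. i \<le> Suc d \<Longrightarrow> arr (\<phi> i) (c i) (t i)"
    "\<And>i. i \<le> d \<Longrightarrow> cmp (c i) (c (Suc i)) (t (Suc i)) (\<phi> (Suc i)) (\<gamma> i) =
      cmp (c i) (t i) (t (Suc i)) (\<tau> i) (\<phi> i)"
    by (rule Angle_morphism[OF A T, of 0 f]) (auto simp: t_def \<tau>_def)
  show ?thesis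
    by (rule that[of "\<phi> (Suc (Suc 0))"])
      (use \<phi>(1) \<phi>(2)[of "Suc (Suc 0)"] \<phi>(3)[of "Suc 0"] d in \<open>simp_all add: t_def \<tau>_def\<close>)
qed

lemma weak_cokernel:
  assumes "Angle C c \<gamma>" "i < d" "arr f (c (Suc i)) y" "cmp (c i) (c (Suc i)) y f (\<gamma> i) = 0"
  shows "\<exists>r. arr r (c (Suc (Suc i))) y \<and> cmp (c (Suc i)) (c (Suc (Suc i))) y r (\<gamma> (Suc i)) = f"
  using assms
proof (induction i arbitrary: c \<gamma>)
  case 0
  then show ?case using weak_cokernel_1 by metis
next
  case (Suc i)
  obtain c' \<gamma>' where A: "Angle C c' \<gamma>'" "\<And>i. i \<le> d \<Longrightarrow> c' i = c (Suc i)"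
    "\<And>i. i \<le> d \<Longrightarrow> \<gamma>' i = \<gamma> (Suc i)" using Angle_rotate[OF Suc.prems(1)] by metis
  show ?case using Suc.IH[OF A(1)] Suc.prems A(2,3) by simp
qed

lemma weak_cokernel_last:
  assumes A: "Angle C c \<gamma>" and f: "arr f (c (Suc d)) y" "cmp (c d) (c (Suc d)) y f (\<gamma> d) = 0"
  shows "\<exists>r. arr r (S (c 0)) y \<and> cmp (c (Suc d)) (S (c 0)) y r (\<gamma> (Suc d)) = f"
proof -
  obtain d' where d': "d = Suc d'" using d_pos by (cases d) auto
  obtain c' \<gamma>' where r: "Angle C c' \<gamma>'" "\<And>i. i \<le> d \<Longrightarrow> c' i = c (Suc i)" "c' (Suc d) = S (c 0)"
      "\<And>i. i \<le> d \<Longrightarrow> \<gamma>' i = \<gamma> (Suc i)" using Angle_rotate[OF A] by metis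
  show ?thesis
    using weak_cokernel[OF r(1), of d' f y] f r(2)[of d] r(2)[of d'] r(3) r(4)[of d] r(4)[of d'] by
        (simp add: d')
qed

text \<open>After rotating back, the connecting morphism becomes the first morphism. Being zero, it
  puts no condition on \<open>f\<close>, so every \<open>f\<close> factors.\<close>

lemma weak_cokernel_0:
  assumes A: "Angle C c \<gamma>" and z: "\<gamma> (Suc d) = 0" and f: "arr f (c 0) y"
  shows "\<exists>r. arr r (c (Suc 0)) y \<and> cmp (c 0) (c (Suc 0)) y r (\<gamma> 0) = f"
proof -
  obtain c' \<gamma>' where r: "Angle C c' \<gamma>'" "S (c' 0) = c (Suc d)" "\<And>i. i \<le> d \<Longrightarrow> c' (Suc i) = c i"
    "sg (Sm (\<gamma>' 0)) = \<gamma> (Suc d)" "\<And>i. i \<le> d \<Longrightarrow> \<gamma>' (Suc i) = \<gamma> i"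
    using Angle_rotate_back[OF A] by metis
  have d: "Suc 0 \<le> d" using d_pos by simp
  have "arr (\<gamma>' 0) (c' 0) (c 0)" using AngleD(2)[OF r(1), of 0] r(3)[of 0] by simp
  moreover have "Sm (\<gamma>' 0) = Sm 0"
    using r(4) z sg_simps(1,2) shift_zero AngleD(1)[OF A, of 0] by (metis zero_le)
  ultimately have "\<gamma>' 0 = 0" using shift_inj[of "\<gamma>' 0" "c' 0" "c 0" 0] zero_arr[of "c' 0" "c 0"]
    by (metis arr_obs)
  then show ?thesis
    using weak_cokernel_1[OF r(1), of f y] f r(3)[of 0] r(3)[of "Suc 0"] r(5)[of 0] d
      cmp_zero[of "c' 0" f "c 0" y] AngleD(1)[OF r(1), of 0] by (metis zero_le)
qed

text \<open>The pair \<open>(f, 0)\<close> is extended to a morphism from the rotated trivial angle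
  on \<open>y\<close> to the rotation of \<open>c\<close>. Its last component goes from
  \<open>S y\<close> to \<open>S (c 0)\<close>; fullness and faithfulness of the automorphism bring
  it back to the required factorization, the two rotation signs being equal.\<close>

lemma weak_kernel_1:
  assumes A: "Angle C c \<gamma>" and f: "arr f y (c (Suc 0))"
    "cmp y (c (Suc 0)) (c (Suc (Suc 0))) (\<gamma> (Suc 0)) f = 0"
  shows "\<exists>g. arr g y (c 0) \<and> cmp y (c 0) (c (Suc 0)) (\<gamma> 0) g = f"
proof -
  note [simp] = AngleD[OF A] cmp_simps f
  have y [simp]: "y \<in> Ob C" using f(1) by (simp add: arr_def)
  have d: "Suc 0 \<le> d" using d_pos by simp
  obtain z where z: "zero_ob C z" using zero_ob_exists by blast
  then have [simp]: "z \<in> Ob C" by (simp add: zero_ob_def)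
  define t where "t i = (if i \<le> Suc 0 then y else z)" for i :: nat
  define \<tau> where "\<tau> i = (if i = 0 then Id C y else 0)" for i :: nat
  have T: "Angle C t \<tau>"
    by (rule two_term_Angle[of y 0]) (use d in \<open>auto simp: t_def \<tau>_def z\<close>)
  obtain t' \<tau>' where t': "Angle C t' \<tau>'" "\<And>i. i \<le> d \<Longrightarrow> t' i = t (Suc i)" "t' (Suc d) = S (t 0)"
    "\<And>i. i \<le> d \<Longrightarrow> \<tau>' i = \<tau> (Suc i)" "\<tau>' (Suc d) = sg (Sm (\<tau> 0))" using Angle_rotate[OF T] by metis
  obtain c' \<gamma>' where r: "Angle C c' \<gamma>'" "\<And>i. i \<le> d \<Longrightarrow> c' i = c (Suc i)" "c' (Suc d) = S (c 0)"
    "\<And>i. i \<le> d \<Longrightarrow> \<gamma>' i = \<gamma> (Suc i)" "\<gamma>' (Suc d) = sg (Sm (\<gamma> 0))" using Angle_rotate[OF A] by metis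
  obtain \<phi> where \<phi>: "\<And>i. i \<le> Suc d \<Longrightarrow> arr (\<phi> i) (t' i) (c' i)"
    "cmp (t' (Suc d)) (S (t' 0)) (S (c' 0)) (Sm f) (\<tau>' (Suc d)) =
      cmp (t' (Suc d)) (c' (Suc d)) (S (c' 0)) (\<gamma>' (Suc d)) (\<phi> (Suc d))"
    by (rule Angle_morphism[OF t'(1) r(1), of f 0]) (use d in \<open>auto simp: t'(2,4) r(2,4) t_def
        \<tau>_def\<close>)
  have "arr (\<phi> (Suc d)) (S y) (S (c 0))" using \<phi>(1)[of "Suc d"] t'(3) r(3) by (simp add: t_def)
  then obtain g where g: "arr g y (c 0)" "Sm g = \<phi> (Suc d)" by (rule shift_full[rotated 2]) simp_all
  have "sg (Sm f) = sg (cmp (S y) (S (c 0)) (S (c (Suc 0))) (Sm (\<gamma> 0)) (Sm g))"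
    using \<phi>(2) t'(2)[of 0] r(2)[of 0] t'(3,5) r(3,5) g shift_arr[OF g(1)] shift_arr[OF f(1)]
      shift_arr[OF AngleD(2)[OF A, of 0]] shift_ob[OF y]
    by (simp add: t_def \<tau>_def shift_Id sg_simps)
  then have "Sm f = Sm (cmp y (c 0) (c (Suc 0)) (\<gamma> 0) g)"
    by (simp add: sg_simps shift_cmp[OF g(1)])
  then have "cmp y (c 0) (c (Suc 0)) (\<gamma> 0) g = f"
    using shift_inj[OF f(1)] g(1) by (metis AngleD(2)[OF A] cmp_arr zero_le)
  with g show ?thesis by blast
qed

section \<open>Cancelling a common summand and the reduced cone\<close>

text \<open>The decompositions are arranged so that \<open>\<sigma> 0\<close> is the identity on
  \<open>x\<close> and block diagonal. The next morphism kills the copy of \<open>x\<close> because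
  consecutive morphisms compose to zero, and the connecting morphism has no component in
  \<open>S x\<close> for the same reason. Thus a trivial angle on \<open>x\<close> splits off, and
  closure under summands leaves an angle on the rest.\<close>

lemma split_off:
  assumes A: "Angle C s \<sigma>"
    and b0: "biproduct C x P (s 0) i j (cmp (s 0) (s (Suc 0)) x p (\<sigma> 0)) q"
    and b1: "biproduct C x Q (s (Suc 0)) (cmp x (s 0) (s (Suc 0)) (\<sigma> 0) i) j' p q'"
  obtains c \<gamma> where "Angle C c \<gamma>" "c 0 = P" "c (Suc 0) = Q"
    "\<And>k. 2 \<le> k \<Longrightarrow> k \<le> Suc d \<Longrightarrow> c k = s k"
proof -
  note arrs [simp] = biproductD(1-7)[OF b0] biproductD(1-7)[OF b1] AngleD[OF A]
  note [simp] = cmp_simps shift_arr shift_ob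
  obtain z where z: "zero_ob C z" using zero_ob_exists by blast
  then have [simp]: "z \<in> Ob C" by (simp add: zero_ob_def)
  have d: "Suc 0 \<le> d" using d_pos by simp
  define t where "t k = (if k \<le> Suc 0 then x else z)" for k :: nat
  define \<tau> where "\<tau> k = (if k = 0 then Id C x else 0)" for k :: nat
  have T: "Angle C t \<tau>"
    by (rule two_term_Angle[of x 0]) (auto simp: t_def \<tau>_def z)
  define c where "c k = (if k = 0 then P else if k = Suc 0 then Q else s k)" for k
  define \<gamma> where "\<gamma> k = (if k = 0 then cmp P (s (Suc 0)) Q q' (cmp P (s 0) (s (Suc 0)) (\<sigma> 0) j)
    else if k = Suc 0 then cmp Q (s (Suc 0)) (s (Suc (Suc 0))) (\<sigma> (Suc 0)) j'
    else if k = Suc d then cmp (s (Suc d)) (S (s 0)) (S P) (Sm q) (\<sigma> (Suc d))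
    else \<sigma> k)" for k
  define \<iota> where "\<iota> k = (if k = 0 then i else if k = Suc 0 then cmp x (s 0) (s (Suc 0)) (\<sigma> 0) i else
      0)" for k :: nat
  define \<pi> where "\<pi> k = (if k = 0 then cmp (s 0) (s (Suc 0)) x p (\<sigma> 0) else if k = Suc 0 then p else
      0)" for k :: nat
  define \<iota>' where "\<iota>' k = (if k = 0 then j else if k = Suc 0 then j' else Id C (s k))" for k
  define \<pi>' where "\<pi>' k = (if k = 0 then q else if k = Suc 0 then q' else Id C (s k))" for k
  note defs = t_def \<tau>_def c_def \<gamma>_def \<iota>_def \<pi>_def \<iota>'_def \<pi>'_def
  have seq: "is_seq d C c \<gamma>"
    unfolding is_seq_iff using d by (auto simp: defs)
  \<comment> \<open>The off-diagonal entry from \<open>P\<close> to \<open>x\<close> is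
    \<open>p \<sigma> 0 j\<close>, which vanishes because \<open>p \<sigma> 0\<close> is the
    projection to \<open>x\<close> along \<open>P\<close>.\<close>
  have 0: "\<sigma> 0 = cmp (s 0) x (s (Suc 0)) (cmp x (s 0) (s (Suc 0)) (\<sigma> 0) i) (cmp (s 0) (s (Suc 0)) x
      p (\<sigma> 0))
     + cmp (s 0) P (s (Suc 0)) (cmp P Q (s (Suc 0)) j' (\<gamma> 0)) q"
  proof -
    have e1: "cmp P x (s (Suc 0)) (cmp x (s 0) (s (Suc 0)) (\<sigma> 0) i) (cmp P (s (Suc 0)) x p (cmp P (s
        0) (s (Suc 0)) (\<sigma> 0) j)) = 0"
      using biproductD(10)[OF b0] by simp
    have "cmp P Q (s (Suc 0)) j' (\<gamma> 0) = cmp P (s 0) (s (Suc 0)) (\<sigma> 0) j"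
      using biproduct_expand(1)[OF b1, of "cmp P (s 0) (s (Suc 0)) (\<sigma> 0) j" P] e1
      by (simp add: \<gamma>_def)
    then show ?thesis using biproduct_expand(2)[OF b0, of "\<sigma> 0" "s (Suc 0)"] by simp
  qed
  have 1: "\<sigma> (Suc 0) = cmp (s (Suc 0)) Q (s (Suc (Suc 0))) (\<gamma> (Suc 0)) q'"
  proof -
    have "cmp x (s (Suc 0)) (s (Suc (Suc 0))) (\<sigma> (Suc 0)) (cmp x (s 0) (s (Suc 0)) (\<sigma> 0) i) = 0"
      using Angle_comp_zero[OF A, of 0] d cmp_assoc[of i x "s 0" "\<sigma> 0" "s (Suc 0)" "\<sigma> (Suc 0)" "s
          (Suc (Suc 0))"]
        zero_cmp[of i x "s 0"] by simp
    then show ?thesis using d biproduct_expand(2)[OF b1, of "\<sigma> (Suc 0)" "s (Suc (Suc 0))"]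
      by (simp add: \<gamma>_def)
  qed
  have 2: "\<sigma> (Suc d) = cmp (s (Suc d)) (S P) (S (s 0)) (Sm j) (\<gamma> (Suc d))"
  proof -
    have "cmp (s (Suc d)) (S (s 0)) (S x) (Sm (cmp (s 0) (s (Suc 0)) x p (\<sigma> 0))) (\<sigma> (Suc d)) = 0"
      using Angle_comp_zero_last(2)[OF A] by (simp add: shift_cmp[where x="s 0" and y="s (Suc 0)"])
    then show ?thesis using d biproduct_expand(1)[OF shift_biproduct[OF b0], of "\<sigma> (Suc d)" "s (Suc
        d)"]
      by (simp add: \<gamma>_def)
  qed
  have "seq_sum d C t \<tau> c \<gamma> s \<sigma>"
  proof (rule seq_sumI[of _ _ _ \<iota> \<iota>' \<pi> \<pi>'])
    fix k assume "k \<le> Suc d"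
    then show "biproduct C (t k) (c k) (s k) (\<iota> k) (\<iota>' k) (\<pi> k) (\<pi>' k)"
      using b0 b1 biproduct_swap[OF biproduct_zero[OF _ z, of "s k"]] by (auto simp: defs)
  next
    fix k assume k: "k \<le> d"
    consider "k = 0" | "k = Suc 0" | "2 \<le> k" by linarith
    then show "\<sigma> k = cmp (s k) (t k) (s (Suc k)) (cmp (t k) (t (Suc k)) (s (Suc k)) (\<iota> (Suc k)) (\<tau>
        k)) (\<pi> k) +
      cmp (s k) (c k) (s (Suc k)) (cmp (c k) (c (Suc k)) (s (Suc k)) (\<iota>' (Suc k)) (\<gamma> k)) (\<pi>' k)"
    proof cases
      case 1
      then show ?thesis using 0 by (simp add: t_def \<tau>_def c_def \<iota>_def \<pi>_def \<iota>'_def \<pi>'_def)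
    next
      case 2
      then show ?thesis using 1 k by (simp add: defs)
    next
      case 3
      then show ?thesis using k by (simp add: defs)
    qed
  next
    show "\<sigma> (Suc d) =
      cmp (s (Suc d)) (t (Suc d)) (S (s 0))
        (cmp (t (Suc d)) (S (t 0)) (S (s 0)) (Sm (\<iota> 0)) (\<tau> (Suc d))) (\<pi> (Suc d)) +
      cmp (s (Suc d)) (c (Suc d)) (S (s 0))
        (cmp (c (Suc d)) (S (c 0)) (S (s 0)) (Sm (\<iota>' 0)) (\<gamma> (Suc d))) (\<pi>' (Suc d))"
      using 2 d by (simp add: defs)
  qed
  from N1_summand[OF Angle_is_seq[OF T] seq this A] have "Angle C c \<gamma>" by simp
  then show ?thesis by (rule that) (simp_all add: c_def)
qed

end

context angulated_category begin

text \<open>Both angles are rotated back twice, so that a morphism between them is the identity of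
  the common last term in degree one; its mapping cone then contains this term twice, matched
  by an isomorphism that can be cancelled.\<close>

lemma cone_Angle:
  assumes B: "Angle C b \<beta>" and C: "Angle C c \<gamma>" and eq: "b (Suc d) = c (Suc d)"
    and orth: "\<And>f. arr f (b d) (S (c 0)) \<Longrightarrow> f = 0"
  obtains e \<epsilon> where "Angle C e \<epsilon>" "e 0 = b 0" "e (Suc d) = c d"
    "\<And>i. i < d \<Longrightarrow> is_sum C (b (Suc i)) (c i) (e (Suc i))"
proof -
  have d: "Suc 0 \<le> d" using d_pos by simp
  obtain b1 \<beta>1 where b1: "Angle C b1 \<beta>1" "S (b1 0) = b (Suc d)" "\<And>i. i \<le> d \<Longrightarrow> b1 (Suc i) = b i"
    using Angle_rotate_back[OF B] by metis
  obtain b2 \<beta>2 where b2: "Angle C b2 \<beta>2" "S (b2 0) = b1 (Suc d)" "\<And>i. i \<le> d \<Longrightarrow> b2 (Suc i) = b1 i"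
    using Angle_rotate_back[OF b1(1)] by metis
  obtain c1 \<gamma>1 where c1: "Angle C c1 \<gamma>1" "S (c1 0) = c (Suc d)" "\<And>i. i \<le> d \<Longrightarrow> c1 (Suc i) = c i"
    using Angle_rotate_back[OF C] by metis
  obtain c2 \<gamma>2 where c2: "Angle C c2 \<gamma>2" "S (c2 0) = c1 (Suc d)" "\<And>i. i \<le> d \<Longrightarrow> c2 (Suc i) = c1 i"
    using Angle_rotate_back[OF c1(1)] by metis
  define x where "x = b1 0"
  have x: "c1 0 = x"
    unfolding x_def using shift_ob_inj[of "c1 0" "b1 0"] AngleD(1)[OF b1(1)] AngleD(1)[OF c1(1)]
      b1(2) c1(2) eq by simp
  have ob: "b2 (Suc 0) = x" "c2 (Suc 0) = x" "b2 (Suc (Suc 0)) = b 0" "c2 (Suc (Suc 0)) = c 0"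
    "S (b2 0) = b d" "S (c2 0) = c d"
    using b1(3) b2(2,3) c1(3) c2(2,3) x d by (simp_all add: x_def)
  note arrs [simp] = AngleD[OF b2(1)] AngleD[OF c2(1)] cmp_simps
  have b20: "arr (\<beta>2 0) (b2 0) x" and c20: "arr (\<gamma>2 0) (c2 0) x" and c21: "arr (\<gamma>2 (Suc 0)) x (c 0)"
    and b21: "arr (\<beta>2 (Suc 0)) x (b 0)" and obx: "x \<in> Ob C"
    using arrs(2)[of 0] arrs(5)[of 0] arrs(2)[of "Suc 0"] arrs(5)[of "Suc 0"] arrs(1)[of "Suc 0"] ob
        d by auto
  note [simp] = b20 c20 c21 b21 obx
  \<comment> \<open>The obstruction to lifting \<open>\<beta>2 0\<close> through
    \<open>\<gamma>2 0\<close>. Its shift is an arrow from \<open>b d\<close> to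
    \<open>S (c 0)\<close>, which is zero by orthogonality.\<close>
  let ?f = "cmp (b2 0) x (c 0) (\<gamma>2 (Suc 0)) (\<beta>2 0)"
  have f: "arr ?f (b2 0) (c 0)" by simp
  have "Sm ?f = 0" using orth shift_arr[OF f] ob by simp
  then have "?f = 0" using shift_inj[OF f, of 0] shift_zero[of "b2 0" "c 0"] f
    by (metis arr_obs zero_arr)
  then obtain g where g: "arr g (b2 0) (c2 0)" "cmp (b2 0) (c2 0) x (\<gamma>2 0) g = \<beta>2 0"
    using weak_kernel_1[OF c2(1), of "\<beta>2 0" "b2 0"] ob by auto
  have "Id C x \<cdot> \<beta>2 0 = \<gamma>2 0 \<cdot> g"
    using g(2) Id_cmp[OF b20] by (simp add: cmp_def)
  then obtain \<phi> where \<phi>: "\<phi> 1 = Id C x" "\<forall>s \<sigma>. is_cone d C b2 \<beta>2 c2 \<gamma>2 \<phi> s \<sigma> \<longrightarrow> Angle C s \<sigma>"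
    using N4[OF b2(1) c2(1), of g "Id C x"] g(1) ob Id_arr[OF obx] by (auto simp: arr_def)
  have "\<forall>i. \<exists>s \<iota> \<iota>' \<pi> \<pi>'. i \<le> Suc d \<longrightarrow> biproduct C (ext_ob d C b2 (Suc i)) (c2 i) s \<iota> \<iota>' \<pi> \<pi>'"
    using sum_ex by (auto simp: ext_ob_def shift_ob)
  then obtain s \<iota> \<iota>' \<pi> \<pi>' where bip: "\<And>i. i \<le> Suc d \<Longrightarrow>
      biproduct C (ext_ob d C b2 (Suc i)) (c2 i) (s i) (\<iota> i) (\<iota>' i) (\<pi> i) (\<pi>' i)"
    by metis
  define \<sigma> where "\<sigma> i = ext_mor d C \<iota> (i + 1) \<cdot> (- ext_mor d C \<beta>2 (i + 1)) \<cdot> \<pi> i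
        + ext_mor d C \<iota>' (i + 1) \<cdot> ext_mor d C \<phi> (i + 1) \<cdot> \<pi> i
        + ext_mor d C \<iota>' (i + 1) \<cdot> \<gamma>2 i \<cdot> \<pi>' i" for i
  have "is_cone d C b2 \<beta>2 c2 \<gamma>2 \<phi> s \<sigma>"
    unfolding is_cone_def
    by (intro exI[of _ \<iota>] exI[of _ \<iota>'] exI[of _ \<pi>] exI[of _ \<pi>']) (simp add: bip \<sigma>_def)
  then have A: "Angle C s \<sigma>" using \<phi>(2) by blast
  have bip0: "biproduct C x (c2 0) (s 0) (\<iota> 0) (\<iota>' 0) (\<pi> 0) (\<pi>' 0)"
    using bip[of 0] d ob by (simp add: ext_ob_def)
  have bip1: "biproduct C x (b 0) (s (Suc 0)) (\<iota>' (Suc 0)) (\<iota> (Suc 0)) (\<pi>' (Suc 0)) (\<pi> (Suc 0))"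
    using biproduct_swap[OF bip[of "Suc 0"]] d ob by (simp add: ext_ob_def)
  note [simp] = biproductD[OF bip0] biproductD[OF bip1] AngleD[OF A]
  have \<sigma>0: "\<sigma> 0 = cmp (s 0) x (s (Suc 0)) (cmp x (b 0) (s (Suc 0)) (\<iota> (Suc 0)) (- \<beta>2 (Suc 0))) (\<pi> 0)
      + cmp (s 0) x (s (Suc 0)) (cmp x x (s (Suc 0)) (\<iota>' (Suc 0)) (Id C x)) (\<pi> 0)
      + cmp (s 0) (c2 0) (s (Suc 0)) (cmp (c2 0) x (s (Suc 0)) (\<iota>' (Suc 0)) (\<gamma>2 0)) (\<pi>' 0)"
    using \<phi>(1) by (simp add: \<sigma>_def ext_mor_def cmp_def)
  \<comment> \<open>The entry of the first cone morphism from \<open>b2 1 = x\<close> to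
    \<open>c2 1 = x\<close> is \<open>\<phi> 1\<close>, chosen as the identity; this is what makes
    the two copies of \<open>x\<close> cancel.\<close>
  have id: "cmp x (s (Suc 0)) x (\<pi>' (Suc 0)) (cmp x (s 0) (s (Suc 0)) (\<sigma> 0) (\<iota> 0)) = Id C x"
    unfolding \<sigma>0 by simp
  have "\<exists>j q. biproduct C x (c2 0) (s 0) (\<iota> 0) j (cmp (s 0) (s (Suc 0)) x (\<pi>' (Suc 0)) (\<sigma> 0)) q"
    using biproduct_change_proj[OF bip0, of "cmp (s 0) (s (Suc 0)) x (\<pi>' (Suc 0)) (\<sigma> 0)"] id
    by auto
  moreover have "\<exists>j q. biproduct C x (b 0) (s (Suc 0)) (cmp x (s 0) (s (Suc 0)) (\<sigma> 0) (\<iota> 0)) j (\<pi>'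
      (Suc 0)) q"
    using biproduct_change_incl[OF bip1, of "cmp x (s 0) (s (Suc 0)) (\<sigma> 0) (\<iota> 0)"] id
    by auto
  ultimately obtain a \<alpha> where a: "Angle C a \<alpha>" "a 0 = c2 0" "a (Suc 0) = b 0"
    "\<And>k. 2 \<le> k \<Longrightarrow> k \<le> Suc d \<Longrightarrow> a k = s k"
    using split_off[OF A] by metis
  \<comment> \<open>After the cancellation the first term is \<open>c2 0\<close>; one rotation moves
    it to the end as \<open>S (c2 0) = c d\<close> and puts \<open>b 0\<close> in front.\<close>
  obtain e \<epsilon> where e: "Angle C e \<epsilon>" "\<And>i. i \<le> d \<Longrightarrow> e i = a (Suc i)" "e (Suc d) = S (a 0)"
    using Angle_rotate[OF a(1)] by metis
  show ?thesis
  proof (rule that[OF e(1)])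
    show "e 0 = b 0" "e (Suc d) = c d" using e(2)[of 0] e(3) a(2,3) ob by simp_all
    fix i assume i: "i < d"
    \<comment> \<open>For \<open>i = d - 1\<close> the index is \<open>d + 2\<close>, where the term
      is \<open>S (b2 0) = b d\<close> and not a value of \<open>b2\<close>.\<close>
    have "ext_ob d C b2 (Suc (Suc (Suc i))) = b (Suc i)"
    proof (cases "Suc i = d")
      case False
      then show ?thesis
        using i b1(3)[of "Suc i"] b2(3)[of "Suc (Suc i)"] by (simp add: ext_ob_def)
    qed (use i ob in \<open>simp add: ext_ob_def\<close>)
    moreover have "c2 (Suc (Suc i)) = c i" using i c1(3)[of i] c2(3)[of "Suc i"] by simp
    ultimately show "is_sum C (b (Suc i)) (c i) (e (Suc i))"
      using is_sumI[OF bip[of "Suc (Suc i)"]] i e(2)[of "Suc i"] a(4)[of "Suc (Suc i)"] by simp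
  qed
qed

end

section \<open>Splitting of angles with zero connecting morphism\<close>

locale krull_schmidt_angulated_category = angulated_category d C + krull_schmidt_category C
  for d :: nat and C :: "('k::field, 'o, 'm::ab_group_add, 'z) ang_cat_scheme" (structure)
begin

text \<open>\<open>z (i + 1)\<close> plays the role of the image of \<open>\<epsilon> i\<close>. A
  zero connecting morphism makes \<open>\<epsilon> 0\<close> a split monomorphism; its complement
  embeds as a summand under the next morphism, and so on to the right end, where nothing is left
  over.\<close>

lemma split_Angle:
  assumes A: "Angle C e \<epsilon>" and last: "\<epsilon> (Suc d) = 0"
  obtains z where "zero_ob C (z 0)" "zero_ob C (z (Suc (Suc d)))"
    "\<And>i. i \<le> Suc d \<Longrightarrow> is_sum C (z i) (z (Suc i)) (e i)"
proof -
  note [simp] = AngleD[OF A] cmp_simps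
  \<comment> \<open>If the projection \<open>q\<close> to the complement factors as
    \<open>r \<epsilon> i\<close>, then \<open>r\<close> is a left inverse of
    \<open>\<epsilon> i k\<close>, so \<open>y\<close> splits off the next term. The new projection
    kills \<open>\<epsilon> i\<close> and is therefore ready for a factorization through the
    following morphism.\<close>
  have step: "\<exists>y' j' k' p' q'. biproduct C y y' (e (Suc i)) j' k' p' q' \<and>
      j' = cmp y (e i) (e (Suc i)) (\<epsilon> i) k \<and> cmp (e i) (e (Suc i)) y' q' (\<epsilon> i) = 0"
    if i: "i \<le> d" and b: "biproduct C z y (e i) j k p q" "cmp z (e i) (e (Suc i)) (\<epsilon> i) j = 0"
      and r: "arr r (e (Suc i)) y" "cmp (e i) (e (Suc i)) y r (\<epsilon> i) = q" for i z y j k p q r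
  proof -
    note [simp] = i biproductD[OF b(1)] r(1)
    let ?j = "cmp y (e i) (e (Suc i)) (\<epsilon> i) k"
    have "cmp y (e (Suc i)) y r ?j = Id C y"
      using cmp_assoc[of k y "e i" "\<epsilon> i" "e (Suc i)" r y] r(2) by simp
    then obtain y' k' l' q' where b': "biproduct C y y' (e (Suc i)) ?j k' l' q'"
      using split_complement[of ?j y "e (Suc i)" r] by auto
    note [simp] = biproductD[OF b']
    have "\<epsilon> i = cmp (e i) y (e (Suc i)) ?j q"
      using biproduct_expand(2)[OF b(1), of "\<epsilon> i" "e (Suc i)"] b(2) by (simp add: zero_cmp)
    then have "cmp (e i) (e (Suc i)) y' q' (\<epsilon> i) = cmp (e i) (e (Suc i)) y' q' (cmp (e i) y (e (Suc
        i)) ?j q)"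
      by metis
    also have "\<dots> = 0" using cmp_assoc[of q "e i" y ?j "e (Suc i)" q' y'] biproductD(11)[OF b']
        zero_cmp[of q "e i" y y'] by (simp del: cmp_assoc)
    finally show ?thesis using b' by blast
  qed
  \<comment> \<open>The invariant carries the factorization \<open>r\<close> along with the
    decomposition; it starts with a zero object for \<open>z 0\<close> and the identity of
    \<open>e 0\<close>, which factors because the connecting morphism is zero.\<close>
  have "\<exists>z. zero_ob C (z 0) \<and> (\<forall>k<i. is_sum C (z k) (z (Suc k)) (e k)) \<and>
    (\<exists>j k p q r. biproduct C (z i) (z (Suc i)) (e i) j k p q \<and>
      cmp (z i) (e i) (e (Suc i)) (\<epsilon> i) j = 0 \<and>
      arr r (e (Suc i)) (z (Suc i)) \<and> cmp (e i) (e (Suc i)) (z (Suc i)) r (\<epsilon> i) = q)" if "i \<le> d" for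
          i
    using that
  proof (induction i)
    case 0
    obtain z0 where z0: "zero_ob C z0" using zero_ob_exists by blast
    obtain r where r: "arr r (e (Suc 0)) (e 0)" "cmp (e 0) (e (Suc 0)) (e 0) r (\<epsilon> 0) = Id C (e 0)"
      using weak_cokernel_0[OF A last, of "Id C (e 0)" "e 0"] by auto
    have "z0 \<in> Ob C" using z0 by (simp add: zero_ob_def)
    then show ?case
      using z0 r biproduct_swap[OF biproduct_zero[OF _ z0, of "e 0"]]
      by (intro exI[of _ "case_nat z0 (\<lambda>_. e 0)"]) force
  next
    case (Suc i)
    then obtain z j k p q r where z: "zero_ob C (z 0)" "\<forall>k<i. is_sum C (z k) (z (Suc k)) (e k)"
      and b: "biproduct C (z i) (z (Suc i)) (e i) j k p q" "cmp (z i) (e i) (e (Suc i)) (\<epsilon> i) j = 0"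
      and r: "arr r (e (Suc i)) (z (Suc i))" "cmp (e i) (e (Suc i)) (z (Suc i)) r (\<epsilon> i) = q" by auto
    from step[OF _ b r] Suc.prems obtain y' j' k' p' q' where
      b': "biproduct C (z (Suc i)) y' (e (Suc i)) j' k' p' q'"
        "j' = cmp (z (Suc i)) (e i) (e (Suc i)) (\<epsilon> i) k" "cmp (e i) (e (Suc i)) y' q' (\<epsilon> i) = 0" by
            auto
    obtain r' where r': "arr r' (e (Suc (Suc i))) y'" "cmp (e (Suc i)) (e (Suc (Suc i))) y' r' (\<epsilon>
        (Suc i)) = q'"
      using weak_cokernel[OF A _ biproductD(4)[OF b'(1)] b'(3)] Suc.prems by auto
    have "cmp (z (Suc i)) (e (Suc i)) (e (Suc (Suc i))) (\<epsilon> (Suc i)) j' = 0"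
      unfolding b'(2) using Angle_comp_zero[OF A, of i] Suc.prems biproductD(1-7)[OF b(1)]
        cmp_assoc[of k "z (Suc i)" "e i" "\<epsilon> i" "e (Suc i)" "\<epsilon> (Suc i)" "e (Suc (Suc i))"]
            zero_cmp[of k "z (Suc i)" "e i"]
      by simp
    then show ?case
      using z is_sumI[OF b(1)] b'(1) r'
      by (intro exI[of _ "z(Suc (Suc i) := y')"]) (auto simp: less_Suc_eq fun_upd_def intro!: exI)
  qed
  from this[of d] obtain z j k p q r where z: "zero_ob C (z 0)" "\<forall>k<d. is_sum C (z k) (z (Suc k)) (e
      k)"
    and b: "biproduct C (z d) (z (Suc d)) (e d) j k p q" "cmp (z d) (e d) (e (Suc d)) (\<epsilon> d) j = 0"
    and r: "arr r (e (Suc d)) (z (Suc d))" "cmp (e d) (e (Suc d)) (z (Suc d)) r (\<epsilon> d) = q" by auto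
  from step[OF _ b r] obtain y' j' k' p' q' where
      b': "biproduct C (z (Suc d)) y' (e (Suc d)) j' k' p' q'" "cmp (e d) (e (Suc d)) y' q' (\<epsilon> d) =
          0" by auto
  obtain r' where "arr r' (S (e 0)) y'" "cmp (e (Suc d)) (S (e 0)) y' r' (\<epsilon> (Suc d)) = q'"
    using weak_cokernel_last[OF A biproductD(4)[OF b'(1)] b'(2)] by auto
  \<comment> \<open>The last projection factors through the connecting morphism, hence vanishes, and
    the final complement is zero.\<close>
  then have "q' = 0" using last cmp_zero[of "e (Suc d)" r' "S (e 0)" y'] by simp
  then have "zero_ob C y'"
    using biproductD[OF b'(1)] zero_cmp[of k' y' "e (Suc d)" y'] by (simp add: zero_ob_def)
  then show ?thesis
    using z is_sumI[OF b(1)] is_sumI[OF b'(1)]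
    by (intro that[of "z(Suc (Suc d) := y')"]) (auto simp: le_Suc_eq nat_less_le)
qed

end

section \<open>Split Grothendieck groups\<close>

text \<open>Two homomorphisms that agree on generators agree on the carrier, and extensionality
  fixes the values outside it; together these make the description unique.\<close>

lemma the_hom_eq:
  assumes G: "group G" and H: "group H" and h: "h \<in> hom G H" "h \<in> extensional (carrier G)"
    and vals: "\<And>i. i \<in> I \<Longrightarrow> h (p i) = q i"
    and gen: "p ` I \<subseteq> carrier G" "carrier G \<subseteq> generate G (p ` I)"
  shows "the_hom G H I p q = h"
  unfolding the_hom_def
proof (rule the_equality)
  fix k assume k: "k \<in> hom G H \<and> k \<in> extensional (carrier G) \<and> (\<forall>i\<in>I. k (p i) = q i)"
  interpret h: group_hom G H h using G H h by (simp add: group_hom_def group_hom_axioms_def)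
  interpret k: group_hom G H k using G H k by (simp add: group_hom_def group_hom_axioms_def)
  have "x \<in> carrier G \<and> k x = h x" if "x \<in> generate G (p ` I)" for x
    using that by (induction rule: generate.induct) (use gen(1) vals k in auto)
  then show "k = h"
    using gen(2) h(2) k by (intro extensionalityI[of k "carrier G" h]) auto
qed (use h vals in simp)

lemma the_hom_props:
  assumes "group G" "group H" "h \<in> hom G H" "\<And>i. i \<in> I \<Longrightarrow> h (p i) = q i"
    "p ` I \<subseteq> carrier G" "carrier G \<subseteq> generate G (p ` I)"
  shows "the_hom G H I p q \<in> hom G H" "\<And>i. i \<in> I \<Longrightarrow> the_hom G H I p q (p i) = q i"
proof -
  have "the_hom G H I p q = restrict h (carrier G)"
    by (rule the_hom_eq) (use assms in \<open>auto simp: group.hom_restrict\<close>)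
  moreover have "restrict h (carrier G) \<in> hom G H"
    by (rule group.hom_restrict[OF assms(1,3)]) simp
  ultimately show "the_hom G H I p q \<in> hom G H" "\<And>i. i \<in> I \<Longrightarrow> the_hom G H I p q (p i) = q i"
    using assms(4,5) by auto
qed

lemma K0_relations_subgroup: "subgroup (K0_relations C A) (free_Abelian_group A)"
  unfolding K0_relations_def
proof (rule group.generate_is_subgroup[OF group_free_Abelian_group], rule subsetI)
  fix w assume "w \<in> {frag_of a - (frag_of a\<^sub>0 + frag_of a\<^sub>1) | a a\<^sub>0 a\<^sub>1.
        a \<in> A \<and> a\<^sub>0 \<in> A \<and> a\<^sub>1 \<in> A \<and> is_sum C a\<^sub>0 a\<^sub>1 a}"
  then obtain a b c where "w = frag_of a - (frag_of b + frag_of c)" "a \<in> A" "b \<in> A" "c \<in> A" by blast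
  then show "w \<in> carrier (free_Abelian_group A)"
    using keys_diff[of "frag_of a" "frag_of b + frag_of c"] keys_add[of "frag_of b" "frag_of c"]
    by (auto simp: keys_frag_of)
qed

lemma K0_relations_keys: "x \<in> K0_relations C A \<Longrightarrow> Poly_Mapping.keys x \<subseteq> A"
  using subgroup.mem_carrier[OF K0_relations_subgroup] by fastforce

lemma K0_relations_zero: "0 \<in> K0_relations C A"
  using subgroup.one_closed[OF K0_relations_subgroup] by fastforce

lemma K0_relations_add: "x \<in> K0_relations C A \<Longrightarrow> y \<in> K0_relations C A \<Longrightarrow> x + y \<in> K0_relations C A"
  using subgroup.m_closed[OF K0_relations_subgroup] by fastforce

lemma K0_relations_minus: "x \<in> K0_relations C A \<Longrightarrow> - x \<in> K0_relations C A"
  using subgroup.m_inv_closed[OF K0_relations_subgroup] K0_relations_keys inv_free_Abelian_group by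
      fastforce

lemma K0_relations_diff: "x \<in> K0_relations C A \<Longrightarrow> y \<in> K0_relations C A \<Longrightarrow> x - y \<in> K0_relations C A"
  using K0_relations_add[of x C A "- y"] K0_relations_minus[of y C A] by simp

lemma K0_relations_sign: "x \<in> K0_relations C A \<Longrightarrow> frag_cmul ((-1) ^ i) x \<in> K0_relations C A"
  by (cases "even i") (simp_all add: K0_relations_minus flip: minus_frag_cmul)

lemma K0_relationsI:
  "is_sum C b c a \<Longrightarrow> a \<in> A \<Longrightarrow> b \<in> A \<Longrightarrow> c \<in> A \<Longrightarrow> frag_of a - (frag_of b + frag_of c) \<in> K0_relations C A"
  unfolding K0_relations_def by (rule generate.incl) blast

lemma K0_relations_normal: "K0_relations C A \<lhd> free_Abelian_group A"
  by (rule comm_group.subgroup_imp_normal[OF abelian_free_Abelian_group K0_relations_subgroup])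

lemma comm_group_K0: "comm_group (K0 C A)"
  unfolding K0_def by (rule comm_group.abelian_FactGroup[OF abelian_free_Abelian_group
      K0_relations_subgroup])

lemma group_K0: "group (K0 C A)"
  using comm_group_K0 by (rule comm_group.axioms(2))

lemma carrier_K0: "carrier (K0 C A) = K0_class C A ` {w. Poly_Mapping.keys w \<subseteq> A}"
proof -
  have "carrier (free_Abelian_group A) = {w. Poly_Mapping.keys w \<subseteq> A}" by auto
  then show ?thesis by (simp add: K0_def carrier_FactGroup K0_class_def[abs_def])
qed

lemma K0_class_closed: "Poly_Mapping.keys w \<subseteq> A \<Longrightarrow> K0_class C A w \<in> carrier (K0 C A)"
  by (simp add: carrier_K0)

lemma K0_class_add:
  "Poly_Mapping.keys w \<subseteq> A \<Longrightarrow> Poly_Mapping.keys v \<subseteq> A \<Longrightarrow>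
    K0_class C A w \<otimes>\<^bsub>K0 C A\<^esub> K0_class C A v = K0_class C A (w + v)"
  unfolding K0_class_def K0_def
  using normal.rcos_sum[OF K0_relations_normal, of w A v C] by simp

lemma K0_class_eqI:
  assumes "Poly_Mapping.keys w \<subseteq> A" "w - v \<in> K0_relations C A"
  shows "K0_class C A w = K0_class C A v"
proof -
  have "v = (v - w) + w" by simp
  moreover have "v - w \<in> K0_relations C A" using K0_relations_minus[OF assms(2)] by simp
  ultimately have "v \<in> K0_class C A w"
    unfolding K0_class_def r_coset_def by (auto intro!: bexI[of _ "v - w"])
  then show ?thesis unfolding K0_class_def
    by (rule group.repr_independence[OF group_free_Abelian_group])
      (simp_all add: assms(1) K0_relations_subgroup)
qed

lemma K0_class_zero: "\<one>\<^bsub>K0 C A\<^esub> = K0_class C A 0"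
proof -
  have "K0_class C A 0 \<otimes>\<^bsub>K0 C A\<^esub> K0_class C A 0 = K0_class C A 0"
    using K0_class_add[of 0 A 0 C] by simp
  then show ?thesis using group.l_cancel_one[OF group_K0, of "K0_class C A 0"] K0_class_closed[of 0
      A C]
    by (metis empty_subsetI keys_zero)
qed

lemma K0_class_minus:
  assumes "Poly_Mapping.keys w \<subseteq> A"
  shows "inv\<^bsub>K0 C A\<^esub> K0_class C A w = K0_class C A (- w)"
  by (rule group.inv_equality[OF group_K0])
    (simp_all add: assms K0_class_add K0_class_zero K0_class_closed)

text \<open>Additivity on direct sums says that the extension of \<open>q\<close> to the free group
  kills the generating relations, so it factors through the quotient.\<close>

lemma K0_hom_ex:
  assumes H: "comm_group H" and q: "\<And>a. a \<in> A \<Longrightarrow> q a \<in> carrier H"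
    and sum: "\<And>a b c. a \<in> A \<Longrightarrow> b \<in> A \<Longrightarrow> c \<in> A \<Longrightarrow> is_sum C b c a \<Longrightarrow> q a = q b \<otimes>\<^bsub>H\<^esub> q c"
  obtains h where "h \<in> hom (K0 C A) H" "\<And>a. a \<in> A \<Longrightarrow> h (K0_class C A (frag_of a)) = q a"
proof -
  interpret H: comm_group H by (rule H)
  obtain g where g: "g \<in> hom (free_Abelian_group A) H" "\<And>a. a \<in> A \<Longrightarrow> g (frag_of a) = q a"
    using H.free_Abelian_group_universal[of q A] q by blast
  interpret g: group_hom "free_Abelian_group A" H g
    using g by (simp add: group_hom_def group_hom_axioms_def H.group_axioms)
  have "K0_relations C A \<subseteq> kernel (free_Abelian_group A) H g"
    unfolding K0_relations_def
  proof (rule group.generate_subgroup_incl[OF group_free_Abelian_group _ g.subgroup_kernel], rule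
      subsetI)
    fix w assume "w \<in> {frag_of a - (frag_of a\<^sub>0 + frag_of a\<^sub>1) | a a\<^sub>0 a\<^sub>1.
        a \<in> A \<and> a\<^sub>0 \<in> A \<and> a\<^sub>1 \<in> A \<and> is_sum C a\<^sub>0 a\<^sub>1 a}"
    then obtain a b c where w: "w = frag_of a - (frag_of b + frag_of c)"
      and abc: "a \<in> A" "b \<in> A" "c \<in> A" "is_sum C b c a" by blast
    have k: "Poly_Mapping.keys (frag_of b + frag_of c) \<subseteq> A"
      using keys_add[of "frag_of b" "frag_of c"] abc by (auto simp: keys_frag_of)
    have kw: "Poly_Mapping.keys w \<subseteq> A"
      unfolding w using keys_diff[of "frag_of a" "frag_of b + frag_of c"] k abc(1) by (auto simp:
          keys_frag_of)
    have "g (w + (frag_of b + frag_of c)) = g w \<otimes>\<^bsub>H\<^esub> g (frag_of b + frag_of c)"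
      using g.hom_mult[of w "frag_of b + frag_of c"] kw k by simp
    moreover have "g (frag_of b + frag_of c) = q b \<otimes>\<^bsub>H\<^esub> q c"
      using g.hom_mult[of "frag_of b" "frag_of c"] abc g(2) by simp
    ultimately have "q a = g w \<otimes>\<^bsub>H\<^esub> q a" using sum[OF abc] g(2) abc(1) by (simp add: w)
    moreover have "g w \<in> carrier H" using g.hom_closed[of w] kw by simp
    ultimately have "g w = \<one>\<^bsub>H\<^esub>" using H.r_cancel_one' q[OF abc(1)] by metis
    then show "w \<in> kernel (free_Abelian_group A) H g" using kw by (simp add: kernel_def)
  qed
  then obtain h where "h \<in> hom (K0 C A) H"
    "\<And>x. x \<in> carrier (free_Abelian_group A) \<Longrightarrow> h (K0_class C A x) = g x"
    using g.FactGroup_universal_kernel[OF K0_relations_normal] unfolding K0_def K0_class_def by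
        metis
  then show ?thesis using g(2) by (intro that[of h]) auto
qed

lemma K0_subgroup_full:
  assumes H: "subgroup H (K0 C A)" and "\<And>a. a \<in> A \<Longrightarrow> K0_class C A (frag_of a) \<in> H"
  shows "carrier (K0 C A) \<subseteq> H"
proof -
  have "K0_class C A w \<in> H" if "Poly_Mapping.keys w \<subseteq> A" for w
  proof (rule free_Abelian_group_induct[OF that, where P = "\<lambda>w. K0_class C A w \<in> H"])
    show "K0_class C A 0 \<in> H" using subgroup.one_closed[OF H] by (simp add: K0_class_zero)
    fix x y assume xy: "Poly_Mapping.keys x \<subseteq> A" "Poly_Mapping.keys y \<subseteq> A"
      "K0_class C A x \<in> H" "K0_class C A y \<in> H"
    then have "K0_class C A x \<otimes>\<^bsub>K0 C A\<^esub> K0_class C A (- y) \<in> H"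
      using subgroup.m_closed[OF H] subgroup.m_inv_closed[OF H] K0_class_minus[of y A C] by metis
    then show "K0_class C A (x - y) \<in> H" using xy by (simp add: K0_class_add)
  qed (use assms in auto)
  then show ?thesis by (auto simp: carrier_K0)
qed

lemma K0_gen: "carrier (K0 C A) \<subseteq> generate (K0 C A) ((\<lambda>a. K0_class C A (frag_of a)) ` A)"
proof (rule K0_subgroup_full)
  show "subgroup (generate (K0 C A) ((\<lambda>a. K0_class C A (frag_of a)) ` A)) (K0 C A)"
    by (rule group.generate_is_subgroup[OF group_K0]) (auto intro!: K0_class_closed)
qed (auto intro: generate.incl)

section \<open>Alternating sums\<close>

text \<open>Signs are counted from the left end of an angle. The index counts from the right, and
  \<open>asum_rev\<close> accounts for the difference.\<close>

definition asum :: "nat \<Rightarrow> (nat \<Rightarrow> 'a \<Rightarrow>\<^sub>0 int) \<Rightarrow> 'a \<Rightarrow>\<^sub>0 int" where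
  "asum n f = (\<Sum>i\<le>n. frag_cmul ((-1) ^ i) (f i))"

lemma asum_0: "asum 0 f = f 0"
  and asum_Suc: "asum (Suc n) f = asum n f + frag_cmul ((-1) ^ Suc n) (f (Suc n))"
  by (simp_all add: asum_def)

lemma asum_cong: "(\<And>i. i \<le> n \<Longrightarrow> f i = g i) \<Longrightarrow> asum n f = asum n g"
  by (auto simp: asum_def intro: sum.cong)

lemma asum_shift: "asum (Suc n) f = f 0 - asum n (\<lambda>i. f (Suc i))"
  by (induction n) (simp_all add: asum_0 asum_Suc flip: minus_frag_cmul)

lemma asum_add: "asum n (\<lambda>i. f i + g i) = asum n f + asum n g"
  by (simp add: asum_def frag_cmul_distrib2 sum.distrib)

lemma asum_diff: "asum n (\<lambda>i. f i - g i) = asum n f - asum n g"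
  using asum_add[of n "\<lambda>i. f i - g i" g] by simp

text \<open>Each inner \<open>z i\<close> occurs in two neighbouring terms with opposite signs; this
  is applied to the summands of a split angle.\<close>

lemma asum_telescope: "asum n (\<lambda>i. z i + z (Suc i)) = z 0 + frag_cmul ((-1) ^ n) (z (Suc n))"
  by (induction n) (simp_all add: asum_0 asum_Suc frag_cmul_distrib2 flip: minus_frag_cmul)

lemma asum_rev: "asum n (\<lambda>i. f (n - i)) = frag_cmul ((-1) ^ n) (asum n f)"
proof (induction n arbitrary: f)
  case (Suc n)
  have "asum (Suc n) (\<lambda>i. f (Suc n - i)) = f (Suc n) - asum n (\<lambda>i. f (n - i))"
    by (simp add: asum_shift)
  then show ?case
    by (cases "even n") (simp_all add: Suc asum_Suc)
qed (simp add: asum_0)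

lemma keys_asum: "(\<And>i. i \<le> n \<Longrightarrow> Poly_Mapping.keys (f i) \<subseteq> A) \<Longrightarrow> Poly_Mapping.keys (asum n f) \<subseteq> A"
  unfolding asum_def by (rule order.trans[OF keys_sum]) auto

lemma asum_relations:
  "(\<And>i. i \<le> n \<Longrightarrow> f i \<in> K0_relations C A) \<Longrightarrow> asum n f \<in> K0_relations C A"
proof (induction n)
  case (Suc n)
  then show ?case
    using K0_relations_add K0_relations_sign[of "f (Suc n)" C A "Suc n"] by (simp add: asum_Suc)
qed (simp add: asum_0)

lemma hom_K0_sign:
  assumes h: "h \<in> hom (K0 C A) (K0 D B)" and "Poly_Mapping.keys w \<subseteq> A" "Poly_Mapping.keys v \<subseteq> B"
    "h (K0_class C A w) = K0_class D B v"
  shows "h (K0_class C A (frag_cmul ((-1) ^ i) w)) = K0_class D B (frag_cmul ((-1) ^ i) v)"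
proof -
  interpret h: group_hom "K0 C A" "K0 D B" h
    using h by (simp add: group_hom_def group_hom_axioms_def group_K0)
  show ?thesis
    using h.hom_inv[OF K0_class_closed[OF assms(2)]] K0_class_minus[OF assms(2), of C]
      K0_class_minus[OF assms(3), of D] assms(4) by (cases "even i") simp_all
qed

lemma hom_K0_asum:
  assumes h: "h \<in> hom (K0 C A) (K0 D B)"
    and k: "\<And>i. i \<le> n \<Longrightarrow> Poly_Mapping.keys (f i) \<subseteq> A" "\<And>i. i \<le> n \<Longrightarrow> Poly_Mapping.keys (g i) \<subseteq> B"
    and "\<And>i. i \<le> n \<Longrightarrow> h (K0_class C A (f i)) = K0_class D B (g i)"
  shows "h (K0_class C A (asum n f)) = K0_class D B (asum n g)"
  using k assms(4)
proof (induction n)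
  case (Suc n)
  have "h (K0_class C A (asum n f + frag_cmul ((-1) ^ Suc n) (f (Suc n))))
    = h (K0_class C A (asum n f)) \<otimes>\<^bsub>K0 D B\<^esub> h (K0_class C A (frag_cmul ((-1) ^ Suc n) (f (Suc n))))"
  proof (subst K0_class_add[symmetric])
    show "Poly_Mapping.keys (frag_cmul ((-1) ^ Suc n) (f (Suc n))) \<subseteq> A"
      by (rule order.trans[OF keys_cmul]) (simp add: Suc.prems)
    then show "h (K0_class C A (asum n f) \<otimes>\<^bsub>K0 C A\<^esub> K0_class C A (frag_cmul ((-1) ^ Suc n) (f (Suc
        n)))) =
      h (K0_class C A (asum n f)) \<otimes>\<^bsub>K0 D B\<^esub> h (K0_class C A (frag_cmul ((-1) ^ Suc n) (f (Suc n))))"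
      by (intro hom_mult[OF h] K0_class_closed keys_asum) (simp_all add: Suc.prems)
  qed (simp add: keys_asum Suc.prems)
  also have "h (K0_class C A (asum n f)) = K0_class D B (asum n g)"
    by (rule Suc.IH) (simp_all add: Suc.prems)
  also have "h (K0_class C A (frag_cmul ((-1) ^ Suc n) (f (Suc n)))) = K0_class D B (frag_cmul ((-1)
      ^ Suc n) (g (Suc n)))"
    by (rule hom_K0_sign[OF h]) (simp_all add: Suc.prems)
  also have "K0_class D B (asum n g) \<otimes>\<^bsub>K0 D B\<^esub> K0_class D B (frag_cmul ((-1) ^ Suc n) (g (Suc n))) =
      K0_class D B (asum n g + frag_cmul ((-1) ^ Suc n) (g (Suc n)))"
    by (rule K0_class_add[OF keys_asum order.trans[OF keys_cmul]]) (simp_all add: Suc.prems)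
  finally show ?case by (simp add: asum_Suc)
qed (simp add: asum_0)

lemma K0_subgroup_asum:
  assumes H: "subgroup H (K0 C A)"
    and "\<And>i. i \<le> n \<Longrightarrow> Poly_Mapping.keys (f i) \<subseteq> A" "\<And>i. i \<le> n \<Longrightarrow> K0_class C A (f i) \<in> H"
  shows "K0_class C A (asum n f) \<in> H"
  using assms(2,3)
proof (induction n)
  case (Suc n)
  let ?w = "frag_cmul ((-1) ^ Suc n) (f (Suc n))"
  have "K0_class C A (- f (Suc n)) \<in> H"
    using Suc.prems[of "Suc n"] subgroup.m_inv_closed[OF H, of "K0_class C A (f (Suc n))"]
      K0_class_minus[of "f (Suc n)" A C] by simp
  then have "K0_class C A ?w \<in> H"
    using Suc.prems(2)[of "Suc n"] by (cases "even n") simp_all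
  moreover have "K0_class C A (asum n f) \<in> H" using Suc by simp
  ultimately have "K0_class C A (asum n f) \<otimes>\<^bsub>K0 C A\<^esub> K0_class C A ?w \<in> H"
    using subgroup.m_closed[OF H] by blast
  moreover have "K0_class C A (asum n f) \<otimes>\<^bsub>K0 C A\<^esub> K0_class C A ?w = K0_class C A (asum n f + ?w)"
    by (rule K0_class_add[OF keys_asum order.trans[OF keys_cmul]]) (simp_all add: Suc.prems)
  ultimately show ?case by (simp add: asum_Suc)
qed (simp add: asum_0)

section \<open>Induced maps and operations on whole angles\<close>

context additive_linear_category begin

text \<open>With \<open>f\<close> the class of an object, or its index, this passes from
  indecomposables to all objects of the additive closure.\<close>

lemma list_sum_in_subgroup:
  assumes H: "subgroup H G"
    and sum: "\<And>a b s. is_sum C a b s \<Longrightarrow> s \<in> add_closure C t \<Longrightarrow> f s = f a \<otimes>\<^bsub>G\<^esub> f b"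
    and zero: "\<And>z. zero_ob C z \<Longrightarrow> f z \<in> H"
    and x: "is_list_sum xs x" "x \<in> add_closure C t" "\<And>a. a \<in> set xs \<Longrightarrow> f a \<in> H"
  shows "f x \<in> H"
  using x
proof (induction xs arbitrary: x)
  case (Cons a xs)
  then obtain y where y: "is_list_sum xs y" "is_sum C a y x" by auto
  have "y \<in> add_closure C t"
    using add_closure_summand[OF is_sum_swap[OF y(2)] Cons.prems(2)] .
  then have "f y \<in> H" using Cons y by simp
  then show ?case using sum[OF y(2) Cons.prems(2)] Cons.prems(3)[of a] subgroup.m_closed[OF H] by
      simp
qed (use zero in simp)

text \<open>A zero object satisfies \<open>z \<cong> z \<oplus> z\<close>, and the resulting
  relation reduces to minus its class.\<close>

lemma frag_of_zero:
  assumes "zero_ob C z" "z \<in> A" shows "frag_of z \<in> K0_relations C A"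
proof -
  have "is_sum C z z z" using is_sum_zero assms by (simp add: zero_ob_def)
  then have "frag_of z - (frag_of z + frag_of z) \<in> K0_relations C A"
    by (rule K0_relationsI) (simp_all add: assms)
  from K0_relations_minus[OF this] show ?thesis by simp
qed

lemma K0_incl:
  assumes "A \<subseteq> Ob C"
  shows "K0_incl C A \<in> hom (K0 C A) (K0 C (Ob C))"
    "a \<in> A \<Longrightarrow> K0_incl C A (K0_class C A (frag_of a)) = K0_class C (Ob C) (frag_of a)"
proof -
  have sum: "K0_class C (Ob C) (frag_of a) = K0_class C (Ob C) (frag_of b) \<otimes>\<^bsub>K0 C (Ob C)\<^esub> K0_class C
      (Ob C) (frag_of c)"
    if "is_sum C b c a" for a b c
    using is_sum_obs[OF that] keys_add[of "frag_of b" "frag_of c"] K0_relationsI[OF that, of "Ob C"]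
    by (subst K0_class_add) (auto simp: keys_frag_of intro!: K0_class_eqI)
  obtain h where h: "h \<in> hom (K0 C A) (K0 C (Ob C))"
    "\<And>a. a \<in> A \<Longrightarrow> h (K0_class C A (frag_of a)) = K0_class C (Ob C) (frag_of a)"
    by (rule K0_hom_ex[OF comm_group_K0, where A = A and C = C and q = "\<lambda>a. K0_class C (Ob C)
        (frag_of a)", OF _ sum])
      (use assms in \<open>auto intro!: K0_class_closed\<close>)
  show "K0_incl C A \<in> hom (K0 C A) (K0 C (Ob C))"
    unfolding K0_incl_def by (rule the_hom_props(1)[OF group_K0 group_K0 h _ K0_gen]) (auto intro!:
        K0_class_closed)
  show "K0_incl C A (K0_class C A (frag_of a)) = K0_class C (Ob C) (frag_of a)" if "a \<in> A"
    unfolding K0_incl_def by (rule the_hom_props(2)[OF group_K0 group_K0 h _ K0_gen]) (use that in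
        \<open>auto intro!: K0_class_closed\<close>)
qed

end

context angulated_category begin

lemma K0_shift:
  shows "K0_shift C \<in> hom (K0 C (Ob C)) (K0 C (Ob C))"
    "a \<in> Ob C \<Longrightarrow> K0_shift C (K0_class C (Ob C) (frag_of a)) = K0_class C (Ob C) (frag_of (S a))"
proof -
  have sum: "K0_class C (Ob C) (frag_of (S a)) = K0_class C (Ob C) (frag_of (S b)) \<otimes>\<^bsub>K0 C (Ob C)\<^esub>
      K0_class C (Ob C) (frag_of (S c))"
    if "is_sum C b c a" for a b c
    using is_sum_obs[OF that] keys_add[of "frag_of (S b)" "frag_of (S c)"]
      K0_relationsI[OF shift_is_sum[OF that], of "Ob C"] shift_ob
    by (subst K0_class_add) (auto simp: keys_frag_of intro!: K0_class_eqI)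
  obtain h where h: "h \<in> hom (K0 C (Ob C)) (K0 C (Ob C))"
    "\<And>a. a \<in> Ob C \<Longrightarrow> h (K0_class C (Ob C) (frag_of a)) = K0_class C (Ob C) (frag_of (S a))"
    by (rule K0_hom_ex[OF comm_group_K0, where A = "Ob C" and C = C and q = "\<lambda>a. K0_class C (Ob C)
        (frag_of (S a))", OF _ sum])
      (auto intro!: K0_class_closed shift_ob)
  show "K0_shift C \<in> hom (K0 C (Ob C)) (K0 C (Ob C))"
    unfolding K0_shift_def by (rule the_hom_props(1)[OF group_K0 group_K0 h _ K0_gen]) (auto intro!:
        K0_class_closed)
  show "K0_shift C (K0_class C (Ob C) (frag_of a)) = K0_class C (Ob C) (frag_of (S a))" if "a \<in> Ob
      C"
    unfolding K0_shift_def by (rule the_hom_props(2)[OF group_K0 group_K0 h _ K0_gen]) (use that in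
        \<open>auto intro!: K0_class_closed\<close>)
qed

text \<open>After \<open>k\<close> rotations the terms are those of \<open>c\<close> from position
  \<open>k\<close> on, followed by the shifts of the earlier ones; \<open>k = d + 1\<close> brings
  the last term to the front. Only objects are recorded, since signs of morphisms do not affect
  classes.\<close>

lemma Angle_rotate_around:
  assumes "Angle C c \<gamma>"
  obtains e \<epsilon> where "Angle C e \<epsilon>" "e 0 = c (Suc d)" "\<And>i. i \<le> d \<Longrightarrow> e (Suc i) = S (c i)"
proof -
  have "\<exists>e \<epsilon>. Angle C e \<epsilon> \<and>
      (\<forall>i\<le>Suc d. e i = (if i + k \<le> Suc d then c (i + k) else S (c (i + k - Suc (Suc d)))))"
    if "k \<le> Suc d" for k
    using that
  proof (induction k)
    case 0
    show ?case using assms by (intro exI[of _ c] exI[of _ \<gamma>]) simp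
  next
    case (Suc k)
    then obtain e \<epsilon> where e: "Angle C e \<epsilon>"
      "\<And>i. i \<le> Suc d \<Longrightarrow> e i = (if i + k \<le> Suc d then c (i + k) else S (c (i + k - Suc (Suc d))))" by
          auto
    obtain e' \<epsilon>' where e': "Angle C e' \<epsilon>'" "\<And>i. i \<le> d \<Longrightarrow> e' i = e (Suc i)" "e' (Suc d) = S (e 0)"
      using Angle_rotate[OF e(1)] by metis
    show ?case
    proof (intro exI[of _ e'] exI[of _ \<epsilon>'] conjI e'(1) allI impI)
      fix i assume "i \<le> Suc d"
      then show "e' i = (if i + Suc k \<le> Suc d then c (i + Suc k) else S (c (i + Suc k - Suc (Suc
          d))))"
        using e(2)[of "Suc i"] e(2)[of 0] e'(2)[of i] e'(3) Suc.prems by (cases "i = Suc d") auto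
    qed
  qed
  from this[of "Suc d"] obtain e \<epsilon> where e: "Angle C e \<epsilon>"
      "\<And>i. i \<le> Suc d \<Longrightarrow> e i = (if i + Suc d \<le> Suc d then c (i + Suc d) else S (c (i + Suc d - Suc
          (Suc d))))" by auto
  show ?thesis by (rule that[OF e(1)]) (simp_all add: e(2))
qed

text \<open>The last term is prescribed so that two resolutions add up to a resolution of a given
  sum; the other biproducts are chosen freely.\<close>

lemma Angle_sum:
  assumes B: "Angle C b \<beta>" and C: "Angle C c \<gamma>" and s: "is_sum C (b (Suc d)) (c (Suc d)) s"
  obtains e \<epsilon> where "Angle C e \<epsilon>" "e (Suc d) = s" "\<And>i. i \<le> Suc d \<Longrightarrow> is_sum C (b i) (c i) (e i)"
proof -
  note [simp] = AngleD[OF B] AngleD[OF C]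
  have "\<forall>i. \<exists>e \<iota> \<iota>' \<pi> \<pi>'. (i = Suc d \<longrightarrow> e = s) \<and> (i \<le> Suc d \<longrightarrow> biproduct C (b i) (c i) e \<iota> \<iota>' \<pi> \<pi>')"
  proof
    fix i show "\<exists>e \<iota> \<iota>' \<pi> \<pi>'. (i = Suc d \<longrightarrow> e = s) \<and> (i \<le> Suc d \<longrightarrow> biproduct C (b i) (c i) e \<iota> \<iota>' \<pi>
        \<pi>')"
      using s sum_ex[of "b i" "c i"] by (cases "i = Suc d"; cases "i \<le> Suc d") (auto simp:
          is_sum_def)
  qed
  then obtain e \<iota> \<iota>' \<pi> \<pi>' where e: "e (Suc d) = s"
    "\<And>i. i \<le> Suc d \<Longrightarrow> biproduct C (b i) (c i) (e i) (\<iota> i) (\<iota>' i) (\<pi> i) (\<pi>' i)" by metis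
  define \<epsilon> where "\<epsilon> i = ext_mor d C \<iota> (i + 1) \<cdot> \<beta> i \<cdot> \<pi> i + ext_mor d C \<iota>' (i + 1) \<cdot> \<gamma> i \<cdot> \<pi>' i" for
      i
  have "seq_sum d C b \<beta> c \<gamma> e \<epsilon>"
    unfolding seq_sum_def by (intro exI[of _ \<iota>] exI[of _ \<iota>'] exI[of _ \<pi>] exI[of _ \<pi>']) (simp add: e
        \<epsilon>_def)
  then have "Angle C e \<epsilon>" by (rule N1_sum[OF B C])
  then show ?thesis by (rule that) (use e is_sumI in blast)+
qed

end

context krull_schmidt_category begin

text \<open>Supplies the uniqueness half of the description of the dual classes.\<close>

lemma K0_gen_Indec:
  "carrier (K0 C (add_closure C t)) \<subseteq>
    generate (K0 C (add_closure C t)) ((\<lambda>v. K0_class C (add_closure C t) (frag_of v)) ` Indec C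
        (add_closure C t))"
    (is "_ \<subseteq> generate ?K (?f ` ?I)")
proof (rule K0_subgroup_full)
  let ?A = "add_closure C t"
  have I: "?I \<subseteq> ?A" by (auto simp: Indec_def)
  show H: "subgroup (generate ?K (?f ` ?I)) ?K"
    by (rule group.generate_is_subgroup[OF group_K0]) (use I in \<open>auto intro!: K0_class_closed\<close>)
  fix a assume a: "a \<in> ?A"
  obtain xs where xs: "is_list_sum xs a" "set xs \<subseteq> ?I" using Indec_decomposition[OF a] .
  show "?f a \<in> generate ?K (?f ` ?I)"
  proof (rule list_sum_in_subgroup[OF H _ _ xs(1) a])
    fix x y s assume s: "is_sum C x y s" "s \<in> ?A"
    have xy: "x \<in> ?A" "y \<in> ?A"
      using add_closure_summand[OF s] add_closure_summand[OF is_sum_swap[OF s(1)] s(2)] by simp_all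
    show "?f s = ?f x \<otimes>\<^bsub>?K\<^esub> ?f y"
      using xy s K0_relationsI[OF s(1), of ?A]
      by (subst K0_class_add) (auto simp: keys_frag_of intro!: K0_class_eqI)
  next
    fix z assume z: "zero_ob C z"
    have "?f z = \<one>\<^bsub>?K\<^esub>" unfolding K0_class_zero
      by (rule K0_class_eqI) (use add_closure_zero[OF z] frag_of_zero[OF z] in auto)
    then show "?f z \<in> generate ?K (?f ` ?I)" using subgroup.one_closed[OF H] by simp
  qed (use xs(2) in \<open>auto intro: generate.incl\<close>)
qed

text \<open>The witness is the multiplicity of \<open>u\<close>: it is additive on sums, and on an
  indecomposable it is the Kronecker symbol.\<close>

lemma dual_class:
  assumes "u \<in> Ob C"
  shows "dual_class C (add_closure C t) u \<in> hom (K0 C (add_closure C t)) integer_group"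
    "v \<in> Indec C (add_closure C t) \<Longrightarrow>
      dual_class C (add_closure C t) u (K0_class C (add_closure C t) (frag_of v)) = kronecker C u v"
proof -
  obtain h where h: "h \<in> hom (K0 C (add_closure C t)) integer_group"
    "\<And>a. a \<in> add_closure C t \<Longrightarrow> h (K0_class C (add_closure C t) (frag_of a)) = int (summand_mult u
        a)"
    by (rule K0_hom_ex[OF abelian_integer_group, of "add_closure C t" "\<lambda>a. int (summand_mult u a)"
        C])
      (auto simp: summand_mult_sum assms)
  have val: "h (K0_class C (add_closure C t) (frag_of v)) = kronecker C u v" if "v \<in> Indec C
      (add_closure C t)" for v
    using that h(2)[of v] summand_mult_indecomposable[OF _ assms] by (auto simp: Indec_def)
  show "dual_class C (add_closure C t) u \<in> hom (K0 C (add_closure C t)) integer_group"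
    unfolding dual_class_def by (rule the_hom_props(1)[OF group_K0 group_integer_group h(1) val _
        K0_gen_Indec]) (auto simp: Indec_def intro!: K0_class_closed)
  show "dual_class C (add_closure C t) u (K0_class C (add_closure C t) (frag_of v)) = kronecker C u
      v" if "v \<in> Indec C (add_closure C t)"
    unfolding dual_class_def by (rule the_hom_props(2)[OF group_K0 group_integer_group h(1) val _
        K0_gen_Indec]) (use that in \<open>auto simp: Indec_def intro!: K0_class_closed\<close>)
qed

end

section \<open>The index and the c-vector\<close>

locale cluster_tilting = krull_schmidt_angulated_category d C
  for d :: nat and C :: "('k::field, 'o, 'm::ab_group_add, 'z) ang_cat_scheme" (structure) +
  fixes T :: 'o
  assumes cluster_tilting: "OT_cluster_tilting d C T"
begin

abbreviation A where "A \<equiv> add_closure C T"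
abbreviation R where "R \<equiv> K0_relations C A"

lemma rigid: "x \<in> A \<Longrightarrow> y \<in> A \<Longrightarrow> arr f x (S y) \<Longrightarrow> f = 0"
  using cluster_tilting unfolding OT_cluster_tilting_def arr_def by blast

lemma Angle_relation:
  assumes E: "Angle C e \<epsilon>" and A: "\<And>i. i \<le> Suc d \<Longrightarrow> e i \<in> A"
  shows "asum (Suc d) (\<lambda>i. frag_of (e i)) \<in> R"
proof -
  have "\<epsilon> (Suc d) = 0" by (rule rigid[OF A A AngleD(3)[OF E]]) simp_all
  then obtain z where z: "zero_ob C (z 0)" "zero_ob C (z (Suc (Suc d)))"
    "\<And>i. i \<le> Suc d \<Longrightarrow> is_sum C (z i) (z (Suc i)) (e i)" using split_Angle[OF E] by metis
  have zA: "z i \<in> A" "z (Suc i) \<in> A" if "i \<le> Suc d" for i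
    using add_closure_summand[OF z(3)[OF that]] add_closure_summand[OF is_sum_swap[OF z(3)[OF
        that]]] A[OF that] by simp_all
  have "asum (Suc d) (\<lambda>i. frag_of (e i) - (frag_of (z i) + frag_of (z (Suc i)))) \<in> R"
    by (rule asum_relations) (rule K0_relationsI[OF z(3)], simp_all add: A zA)
  \<comment> \<open>The sum telescopes to the classes, up to sign, of the zero objects
    \<open>z 0\<close> and \<open>z (d + 2)\<close>.\<close>
  moreover have "asum (Suc d) (\<lambda>i. frag_of (z i) + frag_of (z (Suc i))) \<in> R"
    unfolding asum_telescope[of "Suc d" "\<lambda>i. frag_of (z i)"]
    by (intro K0_relations_add K0_relations_sign frag_of_zero z zA) simp_all
  ultimately show ?thesis using K0_relations_add unfolding asum_diff by fastforce
qed

text \<open>The sign accounts for the indexing of angles from the left.\<close>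

definition idx :: "'o \<Rightarrow> ('o \<Rightarrow>\<^sub>0 int) \<Rightarrow> bool" where
  "idx x w \<longleftrightarrow> Poly_Mapping.keys w \<subseteq> A \<and> (\<exists>c \<gamma>. Angle C c \<gamma> \<and> c (Suc d) = x \<and> (\<forall>i\<le>d. c i \<in> A) \<and>
    w - frag_cmul ((-1) ^ d) (asum d (\<lambda>i. frag_of (c i))) \<in> R)"

lemma idxI:
  assumes "Angle C c \<gamma>" "c (Suc d) = x" "\<And>i. i \<le> d \<Longrightarrow> c i \<in> A"
  shows "idx x (frag_cmul ((-1) ^ d) (asum d (\<lambda>i. frag_of (c i))))"
  unfolding idx_def
proof (intro conjI exI[of _ c] exI[of _ \<gamma>])
  show "Poly_Mapping.keys (frag_cmul ((-1) ^ d) (asum d (\<lambda>i. frag_of (c i)))) \<subseteq> A"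
    by (rule order.trans[OF keys_cmul], rule keys_asum) (simp add: assms keys_frag_of)
qed (use assms K0_relations_zero in auto)

lemma Angle_ex:
  assumes "x \<in> Ob C"
  obtains c \<gamma> where "Angle C c \<gamma>" "c (Suc d) = x" "\<And>i. i \<le> d \<Longrightarrow> c i \<in> A"
proof -
  obtain t c \<gamma> where t: "\<forall>i\<le>d. t i \<in> A" "Angle C c \<gamma>" "c (d + 1) = x" "\<forall>i\<le>d. c (d - i) = t i"
    using cluster_tilting assms unfolding OT_cluster_tilting_def resolution_def by blast
  have "c i \<in> A" if "i \<le> d" for i
    using t(1,4) that by (metis diff_diff_cancel diff_le_self)
  then show ?thesis using that[of c \<gamma>] t by simp
qed

lemma idx_ex: "x \<in> Ob C \<Longrightarrow> \<exists>w. idx x w"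
  using Angle_ex idxI by metis

text \<open>Bookkeeping for the angle of \<open>cone_Angle\<close>: its term in degree
  \<open>i\<close> contributes \<open>u i\<close> from one angle and \<open>v (i - 1)\<close> from
  the other, and the displacement by one turns the second alternating sum into its negative.\<close>

lemma cone_relation:
  assumes "\<And>i. i \<le> Suc d \<Longrightarrow> g i - ((if i \<le> d then u i else 0) + (case i of 0 \<Rightarrow> 0 | Suc j \<Rightarrow> v j)) \<in> R"
  shows "asum (Suc d) g - (asum d u - asum d v) \<in> R"
proof -
  have "asum (Suc d) (\<lambda>i. if i \<le> d then u i else 0) = asum d u"
    by (simp add: asum_Suc cong: asum_cong)
  moreover have "asum (Suc d) (\<lambda>i. case i of 0 \<Rightarrow> 0 | Suc j \<Rightarrow> v j) = - asum d v"
    by (simp add: asum_shift)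
  moreover have "asum (Suc d) (\<lambda>i. g i - ((if i \<le> d then u i else 0) +
      (case i of 0 \<Rightarrow> 0 | Suc j \<Rightarrow> v j))) \<in> R"
    by (rule asum_relations) (rule assms)
  ultimately show ?thesis by (simp add: asum_diff asum_add)
qed

text \<open>The cone over the common end \<open>x\<close> is an angle lying entirely in
  \<open>A\<close>, so its alternating sum vanishes; by \<open>cone_relation\<close> that sum is the
  difference of the two resolutions.\<close>

lemma resolution_unique:
  assumes B: "Angle C b \<beta>" "b (Suc d) = x" "\<And>i. i \<le> d \<Longrightarrow> b i \<in> A"
    and C: "Angle C c \<gamma>" "c (Suc d) = x" "\<And>i. i \<le> d \<Longrightarrow> c i \<in> A"
  shows "asum d (\<lambda>i. frag_of (b i)) - asum d (\<lambda>i. frag_of (c i)) \<in> R"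
proof -
  have orth: "f = 0" if "arr f (b d) (S (c 0))" for f
    by (rule rigid[OF B(3) C(3) that]) simp_all
  obtain e \<epsilon> where e: "Angle C e \<epsilon>" "e 0 = b 0" "e (Suc d) = c d"
    "\<And>i. i < d \<Longrightarrow> is_sum C (b (Suc i)) (c i) (e (Suc i))"
    by (rule cone_Angle[OF B(1) C(1)]) (use B(2) C(2) orth in auto)
  have eA: "e i \<in> A" if "i \<le> Suc d" for i
  proof (cases i)
    case (Suc j)
    then show ?thesis using that add_closure_sum[OF e(4)[of j]] B(3) C(3) e(3)
      by (cases "j = d") auto
  qed (use e(2) B(3) in auto)
  have "asum (Suc d) (\<lambda>i. frag_of (e i)) -
      (asum d (\<lambda>i. frag_of (b i)) - asum d (\<lambda>i. frag_of (c i))) \<in> R"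
  proof (rule cone_relation)
    fix i assume i: "i \<le> Suc d"
    show "frag_of (e i) - ((if i \<le> d then frag_of (b i) else 0) + (case i of 0 \<Rightarrow> 0 | Suc j \<Rightarrow> frag_of
        (c j))) \<in> R"
    proof (cases i)
      case (Suc j)
      then show ?thesis using i K0_relationsI[OF e(4)[of j], of A] B(3) C(3) eA e(3)
          K0_relations_zero
        by (cases "j = d") auto
    qed (use e(2) K0_relations_zero in auto)
  qed
  from K0_relations_diff[OF Angle_relation[OF e(1) eA] this] show ?thesis by simp
qed

lemma idx_unique:
  assumes "idx x w" "idx x v" shows "w - v \<in> R"
proof -
  obtain b \<beta> where b: "Angle C b \<beta>" "b (Suc d) = x" "\<And>i. i \<le> d \<Longrightarrow> b i \<in> A"
    "w - frag_cmul ((-1) ^ d) (asum d (\<lambda>i. frag_of (b i))) \<in> R" using assms(1) unfolding idx_def by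
        blast
  obtain c \<gamma> where c: "Angle C c \<gamma>" "c (Suc d) = x" "\<And>i. i \<le> d \<Longrightarrow> c i \<in> A"
    "v - frag_cmul ((-1) ^ d) (asum d (\<lambda>i. frag_of (c i))) \<in> R" using assms(2) unfolding idx_def by
        blast
  let ?b = "asum d (\<lambda>i. frag_of (b i))" and ?c = "asum d (\<lambda>i. frag_of (c i))"
  have "frag_cmul ((-1) ^ d) (?b - ?c) \<in> R"
    by (rule K0_relations_sign[OF resolution_unique[OF b(1-3) c(1-3)]])
  then have "frag_cmul ((-1) ^ d) ?b - frag_cmul ((-1) ^ d) ?c \<in> R"
    by (cases "even d") simp_all
  from K0_relations_add[OF K0_relations_diff[OF b(4) c(4)] this] show ?thesis by simp
qed

text \<open>The resolution has zero terms up to position \<open>d - 1\<close> and the identity of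
  \<open>x\<close> from position \<open>d\<close> to \<open>d + 1\<close>; the two signs at position
  \<open>d\<close> cancel.\<close>

lemma idx_self:
  assumes "x \<in> A" shows "idx x (frag_of x)"
proof -
  have x: "x \<in> Ob C" using assms by (rule add_closure_ob)
  obtain z where z: "zero_ob C z" using zero_ob_exists by blast
  define c where "c i = (if i < d then z else x)" for i :: nat
  have "Angle C c (\<lambda>i. if i = d then Id C x else 0)"
    by (rule two_term_Angle[OF x, of d]) (auto simp: c_def z)
  moreover have "frag_of x - frag_cmul ((-1) ^ d) (asum d (\<lambda>i. frag_of (c i))) \<in> R"
  proof -
    have "asum d (\<lambda>i. frag_of (c i) - (if i = d then frag_of x else 0)) \<in> R"
      by (rule asum_relations) (use z add_closure_zero frag_of_zero K0_relations_zero in \<open>auto simp: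
          c_def\<close>)
    moreover have "asum d (\<lambda>i. if i = d then frag_of x else 0) = frag_cmul ((-1) ^ d) (frag_of x)"
      by (simp add: asum_def if_distrib[of "frag_cmul _"] cong: if_cong)
    ultimately have *: "asum d (\<lambda>i. frag_of (c i)) - frag_cmul ((-1) ^ d) (frag_of x) \<in> R"
      by (simp add: asum_diff)
    show ?thesis
      using * K0_relations_minus[OF *] by (cases "even d") (simp_all add: add.commute)
  qed
  ultimately show ?thesis unfolding idx_def
    using assms add_closure_zero[OF z] x
    by (intro conjI exI[of _ c] exI) (auto simp: keys_frag_of c_def)
qed

lemma idx_sum:
  assumes "is_sum C x y s" "idx x w" "idx y v" shows "idx s (w + v)"
proof -
  obtain b \<beta> where b: "Angle C b \<beta>" "b (Suc d) = x" "\<And>i. i \<le> d \<Longrightarrow> b i \<in> A"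
    "w - frag_cmul ((-1) ^ d) (asum d (\<lambda>i. frag_of (b i))) \<in> R" using assms(2) unfolding idx_def by
        blast
  obtain c \<gamma> where c: "Angle C c \<gamma>" "c (Suc d) = y" "\<And>i. i \<le> d \<Longrightarrow> c i \<in> A"
    "v - frag_cmul ((-1) ^ d) (asum d (\<lambda>i. frag_of (c i))) \<in> R" using assms(3) unfolding idx_def by
        blast
  let ?b = "asum d (\<lambda>i. frag_of (b i))" and ?c = "asum d (\<lambda>i. frag_of (c i))"
  obtain e \<epsilon> where e: "Angle C e \<epsilon>" "e (Suc d) = s" "\<And>i. i \<le> Suc d \<Longrightarrow> is_sum C (b i) (c i) (e i)"
    using Angle_sum[OF b(1) c(1), of s] b(2) c(2) assms(1) by metis
  have eA: "e i \<in> A" if "i \<le> d" for i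
    using add_closure_sum[OF e(3)] that b(3) c(3) by simp
  let ?e = "asum d (\<lambda>i. frag_of (e i))"
  have "asum d (\<lambda>i. frag_of (e i) - (frag_of (b i) + frag_of (c i))) \<in> R"
    by (rule asum_relations) (rule K0_relationsI[OF e(3)], simp_all add: eA b(3) c(3))
  then have "frag_cmul ((-1) ^ d) (?e - (?b + ?c)) \<in> R"
    unfolding asum_diff asum_add by (rule K0_relations_sign)
  from K0_relations_minus[OF this]
  have "frag_cmul ((-1) ^ d) ?b + frag_cmul ((-1) ^ d) ?c - frag_cmul ((-1) ^ d) ?e \<in> R"
    by (cases "even d") (simp_all add: algebra_simps)
  from K0_relations_add[OF K0_relations_add[OF b(4) c(4)] this]
  have "w + v - frag_cmul ((-1) ^ d) ?e \<in> R" by (simp add: algebra_simps)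
  moreover have "Poly_Mapping.keys (w + v) \<subseteq> A"
    using assms(2,3) keys_add[of w v] unfolding idx_def by blast
  ultimately show ?thesis unfolding idx_def using e(1,2) eA by blast
qed

text \<open>Replacing the last term by its resolution and passing to the cone increases the number of
  terms in \<open>A\<close>, until all terms are in \<open>A\<close> and the angle splits.\<close>

lemma idx_additive:
  assumes "Angle C s \<sigma>" "s 0 \<in> A" "\<And>i. i \<le> Suc d \<Longrightarrow> idx (s i) (w i)"
  shows "asum (Suc d) w \<in> R"
proof -
  \<comment> \<open>\<open>k\<close> is the number of final terms that need not lie in
    \<open>A\<close>. At \<open>k = 0\<close> all terms do and \<open>Angle_relation\<close>
    applies; at \<open>k = Suc d\<close> only \<open>s 0\<close> is known to, which is the
    hypothesis.\<close>
  have "asum (Suc d) w \<in> R"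
    if "k \<le> Suc d" "Angle C s \<sigma>" "\<And>i. i + k \<le> Suc d \<Longrightarrow> s i \<in> A" "\<And>i. i \<le> Suc d \<Longrightarrow> idx (s i) (w i)" for
        k s \<sigma> w
    using that
  proof (induction k arbitrary: s \<sigma> w)
    case 0
    have "asum (Suc d) (\<lambda>i. w i - frag_of (s i)) \<in> R"
      by (rule asum_relations) (use 0 in \<open>auto intro: idx_unique idx_self\<close>)
    from K0_relations_add[OF this Angle_relation[OF 0(2)]] 0(3) show ?case by (simp add: asum_diff)
  next
    case (Suc k)
    obtain b \<beta> where b: "Angle C b \<beta>" "b (Suc d) = s (Suc d)" "\<And>i. i \<le> d \<Longrightarrow> b i \<in> A"
      "w (Suc d) - frag_cmul ((-1) ^ d) (asum d (\<lambda>i. frag_of (b i))) \<in> R"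
      using Suc.prems(4)[of "Suc d"] unfolding idx_def by auto
    let ?b = "asum d (\<lambda>i. frag_of (b i))"
    have orth: "f = 0" if "arr f (b d) (S (s 0))" for f
      by (rule rigid[OF b(3) Suc.prems(3) that]) (use Suc.prems(1) in simp_all)
    obtain e \<epsilon> where e: "Angle C e \<epsilon>" "e 0 = b 0" "e (Suc d) = s d"
      "\<And>i. i < d \<Longrightarrow> is_sum C (b (Suc i)) (s i) (e (Suc i))"
      by (rule cone_Angle[OF b(1) Suc.prems(2) b(2)]) (use orth in auto)
    \<comment> \<open>Representatives for the indices of the cone terms, which are
      \<open>b i \<oplus> s (i - 1)\<close>. The terms \<open>b i\<close> lie in \<open>A\<close>
      and represent themselves; each end term has only one summand.\<close>
    define g where "g i = (if i \<le> d then frag_of (b i) else 0) + (case i of 0 \<Rightarrow> 0 | Suc j \<Rightarrow> w j)"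
        for i
    have "asum (Suc d) g \<in> R"
    proof (rule Suc.IH[OF _ e(1)])
      show "k \<le> Suc d" using Suc.prems by simp
      fix i
      show "e i \<in> A" if "i + k \<le> Suc d"
      proof (cases i)
        case (Suc j)
        then show ?thesis using that add_closure_sum[OF e(4)[of j]] b(3) Suc.prems(3)[of j] e(3)
          by (cases "j = d") auto
      qed (use e(2) b(3) in auto)
      show "idx (e i) (g i)" if "i \<le> Suc d"
      proof (cases i)
        case 0
        then show ?thesis using e(2) idx_self b(3) by (simp add: g_def)
      next
        case (Suc j)
        then show ?thesis
          using that e(3) idx_sum[OF e(4)[of j]] idx_self[OF b(3)] Suc.prems(4)[of j]
          by (cases "j = d") (auto simp: g_def)
      qed
    qed
    moreover have "asum (Suc d) g - (?b - asum d w) \<in> R"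
      by (rule cone_relation) (simp add: g_def K0_relations_zero)
    ultimately have "?b - asum d w \<in> R" using K0_relations_diff by fastforce
    \<comment> \<open>The last term of the sum, \<open>(-1) ^ (d + 1)\<close> times
      \<open>w (d + 1)\<close>, is congruent to \<open>- ?b\<close>, and \<open>asum d w\<close> to
      \<open>?b\<close>; they cancel.\<close>
    from K0_relations_add[OF K0_relations_minus[OF this] K0_relations_sign[OF b(4), of "Suc d"]]
    show ?case by (cases "even d") (simp_all add: asum_Suc)
  qed
  from this[of "Suc d"] show ?thesis using assms by auto
qed

text \<open>Reversing the numbering of a resolution turns its alternating sum into
  \<open>(-1) ^ d\<close> times the sum from the left, which is the normalization of
  \<open>idx\<close>; \<open>idx_unique\<close> then makes the description definite.\<close>

lemma index_ob: assumes "idx x w" shows "index_ob d C A x = K0_class C A w"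
  unfolding index_ob_def
proof (rule the_equality)
  have *: "idx x (asum d (\<lambda>i. frag_of (t i)))" if "resolution d C A x t" for t
  proof -
    from that obtain c \<gamma> where c: "Angle C c \<gamma>" "c (d + 1) = x" "\<forall>i\<le>d. t i \<in> A" "\<forall>i\<le>d. c (d - i) = t
        i"
      unfolding resolution_def by blast
    have "c i \<in> A" if "i \<le> d" for i
      using c(3,4) that by (metis diff_diff_cancel diff_le_self)
    from idxI[OF c(1) _ this] c(2)
    have "idx x (frag_cmul ((-1) ^ d) (asum d (\<lambda>i. frag_of (c i))))" by simp
    moreover have "asum d (\<lambda>i. frag_of (t i)) = asum d (\<lambda>i. frag_of (c (d - i)))"
      by (rule asum_cong) (simp add: c(4))
    ultimately show ?thesis by (simp add: asum_rev[of d "\<lambda>i. frag_of (c i)"])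
  qed
  have eq: "K0_class C A v = K0_class C A w" if "idx x v" for v
    by (rule K0_class_eqI[OF _ idx_unique[OF that assms]]) (use that in \<open>simp add: idx_def\<close>)
  have res_eq: "K0_class C A (\<Sum>i\<le>d. frag_cmul ((-1) ^ i) (frag_of (t i))) = K0_class C A w"
    if "resolution d C A x t" for t
    using eq[OF *[OF that]] by (simp add: asum_def)
  obtain c \<gamma> where c: "Angle C c \<gamma>" "c (Suc d) = x" "\<forall>i\<le>d. c i \<in> A" using assms unfolding idx_def by
      blast
  then have "resolution d C A x (\<lambda>i. c (d - i))"
    unfolding resolution_def by auto
  with res_eq show "\<exists>t. resolution d C A x t \<and>
      K0_class C A w = K0_class C A (\<Sum>i\<le>d. frag_cmul ((-1) ^ i) (frag_of (t i)))"
    by (intro exI[of _ "\<lambda>i. c (d - i)"]) simp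
  show "k = K0_class C A w" if "\<exists>t. resolution d C A x t \<and>
      k = K0_class C A (\<Sum>i\<le>d. frag_cmul ((-1) ^ i) (frag_of (t i)))" for k
    using that res_eq by auto
qed

lemma index_ob_closed: "x \<in> Ob C \<Longrightarrow> index_ob d C A x \<in> carrier (K0 C A)"
proof -
  assume "x \<in> Ob C"
  then obtain w where "idx x w" using idx_ex by blast
  then show ?thesis using index_ob[of x w] K0_class_closed[of w A C] by (simp add: idx_def)
qed

lemma index_ob_sum:
  assumes "is_sum C x y s"
  shows "index_ob d C A s = index_ob d C A x \<otimes>\<^bsub>K0 C A\<^esub> index_ob d C A y"
proof -
  obtain w v where w: "idx x w" "idx y v" using idx_ex is_sum_obs[OF assms] by blast
  then show ?thesis
    using index_ob[OF idx_sum[OF assms w]] index_ob[OF w(1)] index_ob[OF w(2)] K0_class_add[of w A v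
        C]
    by (simp add: idx_def)
qed

lemma index_hom:
  shows "index_hom d C A \<in> hom (K0 C (Ob C)) (K0 C A)"
    "x \<in> Ob C \<Longrightarrow> index_hom d C A (K0_class C (Ob C) (frag_of x)) = index_ob d C A x"
proof -
  obtain h where h: "h \<in> hom (K0 C (Ob C)) (K0 C A)"
    "\<And>a. a \<in> Ob C \<Longrightarrow> h (K0_class C (Ob C) (frag_of a)) = index_ob d C A a"
    by (rule K0_hom_ex[OF comm_group_K0, where A = "Ob C" and C = C and q = "index_ob d C A",
        OF index_ob_closed index_ob_sum]) auto
  show "index_hom d C A \<in> hom (K0 C (Ob C)) (K0 C A)"
    unfolding index_hom_def by (rule the_hom_props(1)[OF group_K0 group_K0 h _ K0_gen]) (auto
        intro!: K0_class_closed)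
  show "index_hom d C A (K0_class C (Ob C) (frag_of x)) = index_ob d C A x" if "x \<in> Ob C"
    unfolding index_hom_def by (rule the_hom_props(2)[OF group_K0 group_K0 h _ K0_gen]) (use that in
        \<open>auto intro!: K0_class_closed\<close>)
qed

end

section \<open>Comparison of two cluster tilting objects\<close>

locale cluster_tilting_pair = T: cluster_tilting d C T + U: cluster_tilting d C U
  for d :: nat and C :: "('k::field, 'o, 'm::ab_group_add, 'z) ang_cat_scheme" (structure) and T U
      :: 'o
begin

text \<open>\<open>t\<close> starts the angle obtained by rotating the \<open>U\<close>-resolution of \<open>\<Sigma>\<^sup>d t\<close>, so
  \<open>idx_additive\<close> expresses \<open>[t]\<close> by the indices of objects of \<open>add U\<close>.\<close>

lemma index_gen:
  "carrier (K0 C T.A) \<subseteq> generate (K0 C T.A) (index_ob d C T.A ` Indec C U.A)"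
proof (rule K0_subgroup_full)
  let ?H = "generate (K0 C T.A) (index_ob d C T.A ` Indec C U.A)"
  have I: "Indec C U.A \<subseteq> Ob C" using T.add_closure_ob by (auto simp: Indec_def)
  show H: "subgroup ?H (K0 C T.A)"
    by (rule group.generate_is_subgroup[OF group_K0]) (use I T.index_ob_closed in auto)
  \<comment> \<open>Additivity of the index on direct sums passes from the indecomposables to every
    object of add U.\<close>
  have index_U: "index_ob d C T.A x \<in> ?H" if x: "x \<in> U.A" for x
  proof -
    obtain xs where xs: "T.is_list_sum xs x" "set xs \<subseteq> Indec C U.A" using T.Indec_decomposition[OF
        x] .
    show ?thesis
    proof (rule T.list_sum_in_subgroup[OF H _ _ xs(1) x])
      fix z assume z: "zero_ob C z"
      have "z \<in> T.A" by (rule T.add_closure_zero[OF z])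
      then have "index_ob d C T.A z = \<one>\<^bsub>K0 C T.A\<^esub>"
        unfolding T.index_ob[OF T.idx_self[OF \<open>z \<in> T.A\<close>]] K0_class_zero
        by (intro K0_class_eqI) (simp_all add: T.frag_of_zero[OF z])
      then show "index_ob d C T.A z \<in> ?H" using subgroup.one_closed[OF H] by simp
    qed (use xs(2) T.index_ob_sum in \<open>auto intro: generate.incl\<close>)
  qed
  fix t assume t: "t \<in> T.A"
  then have tob: "t \<in> Ob C" by (rule T.add_closure_ob)
  obtain c \<gamma> where c: "Angle C c \<gamma>" "c (Suc d) = shift C t" "\<And>i. i \<le> d \<Longrightarrow> c i \<in> U.A"
    using U.Angle_ex T.shift_ob[OF tob] by metis
  obtain s \<sigma> where s: "Angle C s \<sigma>" "shift C (s 0) = c (Suc d)" "\<And>i. i \<le> d \<Longrightarrow> s (Suc i) = c i"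
    using T.Angle_rotate_back[OF c(1)] by metis
  have s0: "s 0 = t" using T.shift_ob_inj[of "s 0" t] T.AngleD(1)[OF s(1), of 0] tob s(2) c(2) by
      simp
  have "\<forall>i. \<exists>w. i \<le> d \<longrightarrow> T.idx (c i) w" using T.idx_ex c(3) T.add_closure_ob by blast
  then obtain w where w: "\<And>i. i \<le> d \<Longrightarrow> T.idx (c i) (w i)" by metis
  \<comment> \<open>The first term \<open>t\<close> lies in add T and represents its own index; the
    relation then expresses it as the alternating sum of the others.\<close>
  have "asum (Suc d) (case_nat (frag_of t) w) \<in> T.R"
  proof (rule T.idx_additive[OF s(1)])
    fix i assume "i \<le> Suc d"
    then show "T.idx (s i) (case i of 0 \<Rightarrow> frag_of t | Suc i \<Rightarrow> w i)"
      using s0 T.idx_self[OF t] w s(3) by (cases i) simp_all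
  qed (use s0 t in simp)
  then have "frag_of t - asum d w \<in> T.R" by (simp add: asum_shift)
  then have "K0_class C T.A (frag_of t) = K0_class C T.A (asum d w)"
    by (intro K0_class_eqI) (simp_all add: t)
  also have "\<dots> \<in> ?H"
  proof (rule K0_subgroup_asum[OF H])
    fix i assume i: "i \<le> d"
    show "Poly_Mapping.keys (w i) \<subseteq> T.A" using w[OF i] by (simp add: T.idx_def)
    show "K0_class C T.A (w i) \<in> ?H" using index_U[OF c(3)[OF i]] T.index_ob[OF w[OF i]] by simp
  qed
  finally show "K0_class C T.A (frag_of t) \<in> ?H" .
qed

definition transfer :: "('o \<Rightarrow>\<^sub>0 int) set \<Rightarrow> ('o \<Rightarrow>\<^sub>0 int) set" where
  "transfer x = index_hom d C U.A (K0_shift C (K0_incl C T.A x))"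

lemma transfer_hom: "transfer \<in> hom (K0 C T.A) (K0 C U.A)"
proof -
  have "T.A \<subseteq> Ob C" using T.add_closure_ob by blast
  from hom_compose[OF hom_compose[OF T.K0_incl(1)[OF this] T.K0_shift(1)] U.index_hom(1)]
  show ?thesis by (simp add: transfer_def[abs_def] comp_def)
qed

lemma transfer_class:
  assumes "t \<in> T.A"
  shows "transfer (K0_class C T.A (frag_of t)) = index_ob d C U.A (shift C t)"
proof -
  have "T.A \<subseteq> Ob C" using T.add_closure_ob by blast
  then show ?thesis
    using assms T.shift_ob by (auto simp: transfer_def T.K0_incl(2) T.K0_shift(2) U.index_hom(2))
qed

text \<open>The index of \<open>v\<close> is \<open>(-1) ^ d\<close> times the left alternating sum
  of its resolution. Transferring it replaces each class by an index of a shifted term, and the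
  relation of the rotated angle identifies the alternating sum of these with \<open>[v]\<close>. The
  sign is what remains.\<close>

lemma transfer_index:
  assumes "v \<in> U.A"
  shows "transfer (index_ob d C T.A v) = K0_class C U.A (frag_cmul ((-1) ^ d) (frag_of v))"
proof -
  obtain c \<gamma> where c: "Angle C c \<gamma>" "c (Suc d) = v" "\<And>i. i \<le> d \<Longrightarrow> c i \<in> T.A"
    using T.Angle_ex[OF T.add_closure_ob[OF assms]] by metis
  have cob: "c i \<in> Ob C" if "i \<le> d" for i using T.add_closure_ob[OF c(3)[OF that]] .
  obtain e \<epsilon> where e: "Angle C e \<epsilon>" "e 0 = c (Suc d)" "\<And>i. i \<le> d \<Longrightarrow> e (Suc i) = shift C (c i)"
    using T.Angle_rotate_around[OF c(1)] by metis
  have "\<forall>i. \<exists>w. i \<le> d \<longrightarrow> U.idx (shift C (c i)) w" using U.idx_ex cob T.shift_ob by blast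
  then obtain w where w: "\<And>i. i \<le> d \<Longrightarrow> U.idx (shift C (c i)) (w i)" by metis
  have keys: "Poly_Mapping.keys (w i) \<subseteq> U.A" if "i \<le> d" for i using w[OF that] by (simp add:
      U.idx_def)
  have "asum (Suc d) (case_nat (frag_of v) w) \<in> U.R"
  proof (rule U.idx_additive[OF e(1)])
    fix i assume "i \<le> Suc d"
    then show "U.idx (e i) (case i of 0 \<Rightarrow> frag_of v | Suc i \<Rightarrow> w i)"
      using e(2,3) c(2) U.idx_self[OF assms] w by (cases i) simp_all
  qed (use e(2) c(2) assms in simp)
  then have "frag_cmul ((-1) ^ d) (frag_of v - asum d w) \<in> U.R"
    by (intro K0_relations_sign) (simp add: asum_shift)
  then have rel: "frag_cmul ((-1) ^ d) (frag_of v) - frag_cmul ((-1) ^ d) (asum d w) \<in> U.R"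
    by (cases "even d") simp_all
  have "transfer (index_ob d C T.A v) =
      transfer (K0_class C T.A (frag_cmul ((-1) ^ d) (asum d (\<lambda>i. frag_of (c i)))))"
    using T.index_ob[OF T.idxI[OF c]] by simp
  also have "\<dots> = K0_class C U.A (frag_cmul ((-1) ^ d) (asum d w))"
  proof (rule hom_K0_sign[OF transfer_hom])
    show "transfer (K0_class C T.A (asum d (\<lambda>i. frag_of (c i)))) = K0_class C U.A (asum d w)"
      by (rule hom_K0_asum[OF transfer_hom])
        (simp_all add: c(3) keys transfer_class U.index_ob[OF w])
  qed (auto intro!: keys_asum keys simp: c(3))
  also have "\<dots> = K0_class C U.A (frag_cmul ((-1) ^ d) (frag_of v))"
    by (rule K0_class_eqI[symmetric, OF _ rel]) (use keys_cmul[of _ "frag_of v"] assms in auto)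
  finally show ?thesis .
qed

text \<open>The right-hand side is itself the witness for the description: it has Kronecker values
  on the indices by \<open>transfer_index\<close>, and \<open>index_gen\<close> makes it the only
  such homomorphism.\<close>

lemma c_vector_eq:
  assumes u: "u \<in> Ob C"
  shows "c_vector d C T.A u U.A =
    (\<lambda>x\<in>carrier (K0 C T.A). (-1) ^ d * dual_class C U.A u (transfer x))"
  unfolding c_vector_def
proof (rule the_hom_eq[OF group_K0 group_integer_group])
  interpret dual: group_hom "K0 C U.A" integer_group "dual_class C U.A u"
    by (simp add: group_hom_def group_hom_axioms_def group_K0 T.dual_class(1) u)
  interpret tr: group_hom "K0 C T.A" "K0 C U.A" transfer
    by (simp add: group_hom_def group_hom_axioms_def group_K0 transfer_hom)
  show "(\<lambda>x\<in>carrier (K0 C T.A). (-1) ^ d * dual_class C U.A u (transfer x)) \<in> hom (K0 C T.A)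
      integer_group"
    by (rule homI) (simp_all add: distrib_left)
  fix v assume v: "v \<in> Indec C U.A"
  then have vU: "v \<in> U.A" and vob: "v \<in> Ob C" using T.add_closure_ob by (auto simp: Indec_def)
  have "dual_class C U.A u (K0_class C U.A (frag_cmul ((-1) ^ d) (frag_of v))) = (-1) ^ d *
      kronecker C u v"
    using dual.hom_inv[OF K0_class_closed[of "frag_of v"]] K0_class_minus[of "frag_of v" U.A C]
      T.dual_class(2)[OF u v] vU by (cases "even d") simp_all
  then show "(\<lambda>x\<in>carrier (K0 C T.A). (-1) ^ d * dual_class C U.A u (transfer x)) (index_ob d C T.A
      v) =
      kronecker C u v"
    \<comment> \<open>The sign produced by \<open>transfer_index\<close> meets the explicit one, and
      \<open>(-1) ^ d\<close> squares to one.\<close>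
    by (simp add: T.index_ob_closed[OF vob] transfer_index[OF vU] flip: mult.assoc
        power_mult_distrib)
qed (use index_gen T.index_ob_closed T.add_closure_ob in \<open>auto simp: Indec_def\<close>)

end

theorem theorem4p1:
  fixes C :: "('k::alg_closed_field, 'o, 'm::ab_group_add) ang_cat"
    and d :: nat and T U u :: 'o
  assumes "angulated_category d C"
    and "hom_finite_category C"
    and "krull_schmidt C"
    and "calabi_yau C"
    and "OT_cluster_tilting d C T" and "basic C T"
    and "OT_cluster_tilting d C U" and "basic C U"
    and "u \<in> Indec C (add_closure C U)"
  shows "c_vector d C (add_closure C T) u (add_closure C U) =
    (\<lambda>x \<in> carrier (K0 C (add_closure C T)).
      (-1) ^ d * dual_class C (add_closure C U) u
        (index_hom d C (add_closure C U) (K0_shift C (K0_incl C (add_closure C T) x))))"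
proof -
  interpret angulated_category d C by fact
  interpret cluster_tilting_pair d C T U
    by unfold_locales (fact assms)+
  have "u \<in> Ob C" using assms(9) add_closure_ob by (auto simp: Indec_def)
  from c_vector_eq[OF this] show ?thesis by (simp add: transfer_def)
qed

end
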